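(* Let $r$ be a graphon with $\log r,\ \log(1-r)\in L^1([0,1]^2)$, and let $(r_N)_{N\in\mathbb N}$ be graphons $r_N\colon[0,1]^2\to(0,1)$ such that $r_N$ is constant on the blocks $[\frac{i-1}{N},\frac iN)\times[\frac{j-1}{N},\frac jN)$, $1\le i,j\le N$, and, as $N\to\infty$, $r_N\to r$ a.e., $\|r_N-r\|_1\to0$, $\|\log r_N-\log r\|_1\to0$ and $\|\log(1-r_N)-\log(1-r)\|_1\to0$. Let $G_N$ be the inhomogeneous Erdős–Rényi random graph on $[N]$ with reference graphon $r_N$, let $\lambda_N$ be the largest eigenvalue of its Laplacian matrix $L_N$, let $\mathbb P^*_N$ be the law of $\lambda_N$, and let $C_r=\|\mathcal L_r\|$. Then for every $\beta\in[0,C_r]$, $$\lim_{N\to\infty}\binom N2^{-1}\log\mathbb P^*_N(\lambda_N/N\le\beta)=-\psi_r(\beta),$$ with $$\psi_r(\beta)=\inf_{\widetilde h\in\widetilde{\mathcal W},\ \|\mathcal L_{\widetilde h}\|\le\beta}J_r(\widetilde h)=\inf_{h\in\mathcal W,\ \|\mathcal L_h\|\le\beta}I_r(h).$$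
   Context: Graphons: $\mathcal W$ is the set of measurable $h\colon[0,1]^2\to[0,1]$ with $h(x,y)=h(y,x)$ for all $x,y$. $\mathcal M$ is the set of Lebesgue-measure-preserving bijections $\phi\colon[0,1]\to[0,1]$, and $h^\phi(x,y)=h(\phi(x),\phi(y))$. Cut-distance: $d_\square(h_1,h_2)=\sup_{S,T\subset[0,1]}\big|\int_{S\times T}[h_1-h_2]\,dx\,dy\big|$ (measurable $S,T$); cut-metric: $\delta_\square(h_1,h_2)=\inf_{\phi\in\mathcal M}d_\square(h_1,h_2^\phi)$. $\widetilde{\mathcal W}=\mathcal W/\!\sim$, where $h_1\sim h_2$ iff $\delta_\square(h_1,h_2)=0$; $\widetilde h$ is the class of $h$. Laplacian operator: for $h\in\mathcal W$, $\mathcal L_h$ acts on $L^2([0,1])$ by $(\mathcal L_hu)(x)=\int_{[0,1]}h(x,y)[u(x)-u(y)]\,dy$; $\|\mathcal L_h\|$ is its operator norm, and $\|\mathcal L_{\widetilde h}\|:=\|\mathcal L_h\|$ for any representative $h$. Random graph: in the inhomogeneous Erdős–Rényi random graph $G_N$ with vertex set $[N]=\{1,\dots,N\}$ and reference graphon $r_N$, each pair $i\ne j$ is connected by an edge with probability equal to the value of $r_N$ on the block $[\frac{i-1}{N},\frac iN)\times[\frac{j-1}{N},\frac jN)$, independently over pairs. $A_N$ is the adjacency matrix, $D_N$ the diagonal matrix of degrees, $L_N=D_N-A_N$. Rate functions: $\mathcal R(a\mid b)=a\log\frac ab+(1-a)\log\frac{1-a}{1-b}$ for $a\in[0,1]$,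 $b\in(0,1)$, with $0\log0=0$; $I_r(h)=\int_{[0,1]^2}\mathcal R(h(x,y)\mid r(x,y))\,dx\,dy$ for $h\in\mathcal W$; $J_r(\widetilde h)=\inf_{\phi\in\mathcal M}I_r(h^\phi)$ for any representative $h$ of $\widetilde h$. *)

theory Defs
  imports
    "HOL-Probability.Probability"
    "HOL-Probability.Product_PMF"
    "Jordan_Normal_Form.Spectral_Radius"
begin

abbreviation unit_leb :: "real measure" where
  "unit_leb \<equiv> lebesgue_on {0..1}"

abbreviation unit_square :: "(real \<times> real) set" where
  "unit_square \<equiv> {0..1} \<times> {0..1}"

abbreviation square_leb :: "(real \<times> real) measure" where
  "square_leb \<equiv> lebesgue_on unit_square"


subsection \<open>Graphons and the cut-metric\<close>

text \<open>
  Measurability is Lebesgue measurability. Graphons are total HOL functions, but all notions below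
  depend only on their values on the unit square.
\<close>

definition graphons :: "(real \<times> real \<Rightarrow> real) set" where
  "graphons = {h. h \<in> borel_measurable square_leb \<and>
     (\<forall>p\<in>unit_square. 0 \<le> h p \<and> h p \<le> 1) \<and>
     (\<forall>x\<in>{0..1}. \<forall>y\<in>{0..1}. h (x, y) = h (y, x))}"

definition mp_bijections :: "(real \<Rightarrow> real) set" where
  "mp_bijections = {\<phi>. bij_betw \<phi> {0..1} {0..1} \<and>
     \<phi> \<in> measurable unit_leb unit_leb \<and> distr unit_leb unit_leb \<phi> = unit_leb}"

definition rearrange :: "(real \<times> real \<Rightarrow> real) \<Rightarrow> (real \<Rightarrow> real) \<Rightarrow> real \<times> real \<Rightarrow> real" where
  "rearrange h \<phi> = (\<lambda>(x, y). h (\<phi> x, \<phi> y))"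

definition cut_distance :: "(real \<times> real \<Rightarrow> real) \<Rightarrow> (real \<times> real \<Rightarrow> real) \<Rightarrow> real" where
  "cut_distance h\<^sub>1 h\<^sub>2 =
     (SUP (S, T) \<in> sets unit_leb \<times> sets unit_leb.
        \<bar>LINT p:S \<times> T|lebesgue. h\<^sub>1 p - h\<^sub>2 p\<bar>)"

definition cut_metric :: "(real \<times> real \<Rightarrow> real) \<Rightarrow> (real \<times> real \<Rightarrow> real) \<Rightarrow> real" where
  "cut_metric h\<^sub>1 h\<^sub>2 = (INF \<phi>\<in>mp_bijections. cut_distance h\<^sub>1 (rearrange h\<^sub>2 \<phi>))"

definition cut_equiv :: "((real \<times> real \<Rightarrow> real) \<times> (real \<times> real \<Rightarrow> real)) set" where
  "cut_equiv = {(h\<^sub>1, h\<^sub>2). h\<^sub>1 \<in> graphons \<and> h\<^sub>2 \<in> graphons \<and> cut_metric h\<^sub>1 h\<^sub>2 = 0}"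

definition graphon_classes :: "(real \<times> real \<Rightarrow> real) set set" where
  "graphon_classes = graphons // cut_equiv"

text \<open>
  A choice of representative. The functionals on classes defined through it below are independent
  of the choice (for the rate function, when the logarithms of the reference graphon \<open>r\<close> and of
  \<open>1 - r\<close> are integrable).
\<close>

definition class_rep :: "(real \<times> real \<Rightarrow> real) set \<Rightarrow> real \<times> real \<Rightarrow> real" where
  "class_rep C = (SOME h. h \<in> C)"


subsection \<open>The Laplacian operator and its norm\<close>

definition L2_fun :: "(real \<Rightarrow> real) set" where
  "L2_fun = {u. u \<in> borel_measurable unit_leb \<and> integrable unit_leb (\<lambda>x. (u x)\<^sup>2)}"

definition L2_norm :: "(real \<Rightarrow> real) \<Rightarrow> real" where
  "L2_norm u = sqrt (LINT x|unit_leb. (u x)\<^sup>2)"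

definition L2_opnorm :: "((real \<Rightarrow> real) \<Rightarrow> (real \<Rightarrow> real)) \<Rightarrow> real" where
  "L2_opnorm T = (SUP u \<in> {u \<in> L2_fun. L2_norm u \<le> 1}. L2_norm (T u))"

definition laplacian_op :: "(real \<times> real \<Rightarrow> real) \<Rightarrow> (real \<Rightarrow> real) \<Rightarrow> real \<Rightarrow> real" where
  "laplacian_op h u x = (LINT y|unit_leb. h (x, y) * (u x - u y))"

definition laplacian_norm :: "(real \<times> real \<Rightarrow> real) \<Rightarrow> real" where
  "laplacian_norm h = L2_opnorm (laplacian_op h)"

definition class_laplacian_norm :: "(real \<times> real \<Rightarrow> real) set \<Rightarrow> real" where
  "class_laplacian_norm C = laplacian_norm (class_rep C)"


subsection \<open>The inhomogeneous Erdos-Renyi random graph\<close>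

text \<open>
  Vertices are numbered \<open>0, \<dots>, N - 1\<close> instead of \<open>1, \<dots>, N\<close>, so that vertex \<open>i\<close> corresponds to the
  interval \<open>[i/N, (i+1)/N)\<close>.
\<close>

definition block :: "nat \<Rightarrow> nat \<Rightarrow> real set" where
  "block N i = {real i / real N ..< (real i + 1) / real N}"

definition block_constant :: "nat \<Rightarrow> (real \<times> real \<Rightarrow> real) \<Rightarrow> bool" where
  "block_constant N h \<longleftrightarrow>
     (\<forall>i<N. \<forall>j<N. \<exists>c. \<forall>p \<in> block N i \<times> block N j. h p = c)"

text \<open>
  A graph is given by its adjacency relation. One independent coin is tossed for each pair
  \<open>i < j < N\<close>; its success probability is the value of a block-constant \<open>r\<close> on the block \<open>(i, j)\<close>,
  read off at the corner of the block. Outside these pairs the coin is constantly \<open>False\<close>, so the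
  relation is symmetric and irreflexive.
\<close>

definition er_graph :: "nat \<Rightarrow> (real \<times> real \<Rightarrow> real) \<Rightarrow> (nat \<Rightarrow> nat \<Rightarrow> bool) pmf" where
  "er_graph N r =
     map_pmf (\<lambda>\<omega> i j. \<omega> (i, j) \<or> \<omega> (j, i))
       (Pi_pmf {(i, j). i < j \<and> j < N} False
          (\<lambda>(i, j). bernoulli_pmf (r (real i / real N, real j / real N))))"

definition adjacency_mat :: "nat \<Rightarrow> (nat \<Rightarrow> nat \<Rightarrow> bool) \<Rightarrow> real mat" where
  "adjacency_mat N E = mat N N (\<lambda>(i, j). of_bool (E i j))"

definition degree_mat :: "nat \<Rightarrow> (nat \<Rightarrow> nat \<Rightarrow> bool) \<Rightarrow> real mat" where
  "degree_mat N E = mat N N (\<lambda>(i, j). if i = j then real (card {k. k < N \<and> E i k}) else 0)"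

definition laplacian_mat :: "nat \<Rightarrow> (nat \<Rightarrow> nat \<Rightarrow> bool) \<Rightarrow> real mat" where
  "laplacian_mat N E = degree_mat N E - adjacency_mat N E"

definition largest_eigenvalue :: "real mat \<Rightarrow> real" where
  "largest_eigenvalue A = Max (spectrum A)"

definition laplacian_law :: "nat \<Rightarrow> (real \<times> real \<Rightarrow> real) \<Rightarrow> real pmf" where
  "laplacian_law N r = map_pmf (\<lambda>E. largest_eigenvalue (laplacian_mat N E)) (er_graph N r)"


subsection \<open>Rate functions\<close>

text \<open>The convention \<open>0 log 0 = 0\<close> holds because multiplication by \<open>0\<close> gives \<open>0\<close>.\<close>

definition rel_entropy :: "real \<Rightarrow> real \<Rightarrow> real" where
  "rel_entropy a b = a * ln (a / b) + (1 - a) * ln ((1 - a) / (1 - b))"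

text \<open>
  If \<open>0 < r < 1\<close> almost everywhere and \<open>ln r\<close>, \<open>ln (1 - r)\<close> are integrable, then the integrand is
  bounded almost everywhere by the integrable function \<open>- ln r - ln (1 - r)\<close> for every graphon \<open>h\<close>,
  so the real-valued integral is the genuine one.
\<close>

definition rate_I :: "(real \<times> real \<Rightarrow> real) \<Rightarrow> (real \<times> real \<Rightarrow> real) \<Rightarrow> real" where
  "rate_I r h = (LINT p|square_leb. rel_entropy (h p) (r p))"

definition rate_J :: "(real \<times> real \<Rightarrow> real) \<Rightarrow> (real \<times> real \<Rightarrow> real) set \<Rightarrow> real" where
  "rate_J r C = (INF \<phi>\<in>mp_bijections. rate_I r (rearrange (class_rep C) \<phi>))"

definition rate_psi :: "(real \<times> real \<Rightarrow> real) \<Rightarrow> real \<Rightarrow> real" where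
  "rate_psi r \<beta> = (INF C \<in> {C \<in> graphon_classes. class_laplacian_norm C \<le> \<beta>}. rate_J r C)"

text \<open>
  Since \<open>ln 0 = 0\<close> in HOL, integrability of the logarithms has to be accompanied by their being
  finite almost everywhere.
\<close>

definition log_integrable :: "(real \<times> real \<Rightarrow> real) \<Rightarrow> bool" where
  "log_integrable r \<longleftrightarrow>
     (AE p in square_leb. 0 < r p \<and> r p < 1) \<and>
     integrable square_leb (\<lambda>p. ln (r p)) \<and> integrable square_leb (\<lambda>p. ln (1 - r p))"

end

(*
  The event that the largest Laplacian eigenvalue is at most beta * N is convex in the adjacency
  matrix, since it says that a family of linear functionals is bounded. Upper bound: the marginals q
  of the edge law conditioned on this event again satisfy the constraint, and superadditivity of
  relative entropy bounds the log-probability by minus the sum of the edge costs, without any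
  compactness of the space of graphons. Lower bound: tilt the edges to the block averages of (1 - d) h
  for a feasible h; a fourth moment bound shows that the tilted graph satisfies the constraint with
  high probability, and convexity of the entropy compares its cost with the rate of (1 - d) h. The
  norm of a step graphon is read off from its matrix because the Laplacian acts on the fluctuations
  within a block as multiplication by the degree. On classes: if g is cut-equivalent to h, then
  rearrangements of g converge to h weakly, and even strongly in L^2 because the L^2 norms agree, so
  the rate is continuous along them.
*)
theory Submission
  imports Defs
begin

section \<open>Large deviation bounds for product Bernoulli measures\<close>

text \<open>What shapes the details is that a graph has no loops while a graphon has diagonal
  blocks. Each passage between a matrix and an operator has to pay for \<open>N\<close> diagonal
  entries: at most 1/N in the degrees, or the vanishing entropy \<open>diag_mass\<close>. The factor
  1 - d of the lower bound has two uses. It opens a margin of order N in the largest eigenvalue,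
  against fluctuations of order N^(3/4) in the moment bound used here (second moments, summed over N
  rows, would not suffice). It also keeps all block averages below 1, where the entropy has a
  vertical tangent. The operator norm is always handled through the quadratic form, which is
  possible because the Laplacian is self-adjoint and positive semidefinite. Graphons are only
  Lebesgue measurable on the square, so Fubini's theorem needs the Lebesgue measure there as the
  completion of a product measure. The representative of a class is an arbitrary choice, and the
  infimum in the cut-metric need not be attained; hence the work with sequences of
  rearrangements.\<close>

definition bernoulli_prod :: "'a set \<Rightarrow> ('a \<Rightarrow> real) \<Rightarrow> ('a \<Rightarrow> bool) pmf" where
  "bernoulli_prod I p = Pi_pmf I False (\<lambda>e. bernoulli_pmf (p e))"

definition configs :: "'a set \<Rightarrow> ('a \<Rightarrow> bool) set" where
  "configs I = PiE_dflt I False (\<lambda>_. UNIV)"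

lemma finite_configs [simp]: "finite I \<Longrightarrow> finite (configs I)"
  unfolding configs_def by (intro finite_PiE_dflt) auto

lemma set_bernoulli_prod: "finite I \<Longrightarrow> set_pmf (bernoulli_prod I p) \<subseteq> configs I"
  unfolding configs_def bernoulli_prod_def by (subst set_Pi_pmf) (auto simp: PiE_dflt_def)

lemma pmf_bernoulli_prod:
  assumes "finite I" "\<omega> \<in> configs I" "\<And>e. e \<in> I \<Longrightarrow> 0 \<le> p e \<and> p e \<le> 1"
  shows "pmf (bernoulli_prod I p) \<omega> = (\<Prod>e\<in>I. if \<omega> e then p e else 1 - p e)"
  unfolding bernoulli_prod_def using assms
  by (subst pmf_Pi') (auto simp: configs_def PiE_dflt_def intro!: prod.cong)

lemma prob_bernoulli_prod:
  assumes "finite I"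
  shows "measure_pmf.prob (bernoulli_prod I p) K = (\<Sum>\<omega>\<in>configs I \<inter> K. pmf (bernoulli_prod I p) \<omega>)"
proof -
  have "measure_pmf.prob (bernoulli_prod I p) K = measure_pmf.prob (bernoulli_prod I p) (configs I \<inter> K)"
    by (rule measure_pmf.finite_measure_eq_AE)
       (use set_bernoulli_prod[OF assms] in \<open>auto simp: AE_measure_pmf_iff\<close>)
  then show ?thesis
    using assms by (simp add: measure_measure_pmf_finite)
qed

lemma sum_bernoulli_prod:
  assumes "finite I"
  shows "(\<Sum>\<omega>\<in>configs I. pmf (bernoulli_prod I p) \<omega>) = 1"
  using prob_bernoulli_prod[OF assms, of p UNIV] by simp

lemma marginal_bernoulli_prod:
  assumes "finite I" "e \<in> I" "0 \<le> p e" "p e \<le> 1"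
  shows "(\<Sum>\<omega>\<in>configs I. pmf (bernoulli_prod I p) \<omega> * of_bool (\<omega> e)) = p e"
proof -
  have "(\<Sum>\<omega>\<in>configs I. pmf (bernoulli_prod I p) \<omega> * of_bool (\<omega> e))
      = measure_pmf.expectation (bernoulli_prod I p) (\<lambda>\<omega>. of_bool (\<omega> e))"
    using assms set_bernoulli_prod[OF assms(1), of p]
    by (subst integral_measure_pmf_real[of "configs I"]) (auto simp: mult.commute)
  also have "\<dots> = measure_pmf.expectation (map_pmf (\<lambda>\<omega>. \<omega> e) (bernoulli_prod I p)) of_bool"
    by simp
  also have "map_pmf (\<lambda>\<omega>. \<omega> e) (bernoulli_prod I p) = bernoulli_pmf (p e)"
    unfolding bernoulli_prod_def using assms by (simp add: Pi_pmf_component)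
  finally show ?thesis using assms by simp
qed

text \<open>This is \<open>ln x \<le> x - 1\<close> at \<open>x = c * b / a\<close>, multiplied by
  \<open>a\<close>. The slope \<open>c\<close> stays free: the value 1 yields nonnegativity of
  relative entropy, and the inverse of a probability brings the logarithm of that probability into
  the bound.\<close>

lemma gibbs_term:
  fixes a b c :: real
  assumes "0 \<le> a" "0 < b" "0 < c"
  shows "a * ln (a / b) \<ge> a * ln c + a - c * b"
proof (cases "a = 0")
  case False
  then have a: "a > 0" using assms by simp
  have "ln (c * b / a) \<le> c * b / a - 1"
    using a assms by (intro ln_le_minus_one) auto
  moreover have "ln (c * b / a) = ln c - ln (a / b)"
    using a assms by (simp add: ln_div ln_mult)
  ultimately have "a * (ln c - ln (a / b)) \<le> a * (c * b / a - 1)"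
    using a by (intro mult_left_mono) auto
  then show ?thesis using a by (simp add: algebra_simps)
qed (use assms in auto)

lemma gibbs_sum:
  fixes a b :: "'a \<Rightarrow> real"
  assumes "\<And>x. x \<in> A \<Longrightarrow> 0 \<le> a x" "\<And>x. x \<in> A \<Longrightarrow> 0 < b x" "0 < c"
  shows "(\<Sum>x\<in>A. a x * ln (a x / b x)) \<ge> (\<Sum>x\<in>A. a x) * ln c + (\<Sum>x\<in>A. a x) - c * (\<Sum>x\<in>A. b x)"
proof -
  have "(\<Sum>x\<in>A. a x * ln c + a x - c * b x) \<le> (\<Sum>x\<in>A. a x * ln (a x / b x))"
    using assms by (intro sum_mono gibbs_term) auto
  then show ?thesis
    by (simp add: sum.distrib sum_subtractf sum_distrib_left sum_distrib_right)
qed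

definition log_likelihood :: "'a set \<Rightarrow> ('a \<Rightarrow> real) \<Rightarrow> ('a \<Rightarrow> real) \<Rightarrow> ('a \<Rightarrow> bool) \<Rightarrow> real" where
  "log_likelihood I q p \<omega> = (\<Sum>e\<in>I. if \<omega> e then ln (q e / p e) else ln ((1 - q e) / (1 - p e)))"

text \<open>The log density of one product law with respect to another is a sum of functions of
  single coordinates, so its mean under any weights \<open>w\<close> depends on the marginals of
  \<open>w\<close> alone. It is applied to a product law and to a conditioned law, which is not a
  product.\<close>

lemma mean_log_likelihood:
  fixes w :: "('a \<Rightarrow> bool) \<Rightarrow> real"
  assumes "(\<Sum>\<omega>\<in>A. w \<omega>) = 1" "\<And>e. e \<in> I \<Longrightarrow> (\<Sum>\<omega>\<in>A. w \<omega> * of_bool (\<omega> e)) = q e"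
  shows "(\<Sum>\<omega>\<in>A. w \<omega> * log_likelihood I q p \<omega>) = (\<Sum>e\<in>I. rel_entropy (q e) (p e))"
proof -
  have "(\<Sum>\<omega>\<in>A. w \<omega> * log_likelihood I q p \<omega>)
      = (\<Sum>\<omega>\<in>A. \<Sum>e\<in>I. w \<omega> * of_bool (\<omega> e) * ln (q e / p e)
           + (w \<omega> - w \<omega> * of_bool (\<omega> e)) * ln ((1 - q e) / (1 - p e)))"
    unfolding log_likelihood_def sum_distrib_left by (intro sum.cong) auto
  also have "\<dots> = (\<Sum>e\<in>I. \<Sum>\<omega>\<in>A. w \<omega> * of_bool (\<omega> e) * ln (q e / p e)
           + (w \<omega> - w \<omega> * of_bool (\<omega> e)) * ln ((1 - q e) / (1 - p e)))"
    by (rule sum.swap)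
  also have "\<dots> = (\<Sum>e\<in>I. rel_entropy (q e) (p e))"
    by (intro sum.cong refl) 
       (simp only: sum.distrib sum_subtractf assms rel_entropy_def flip: sum_distrib_right)
  finally show ?thesis .
qed

text \<open>Configurations of tilted mass 0 have to be excluded: there \<open>ln 0 = 0\<close> hides
  single factors that vanish, and the logarithm of the product is no longer the sum.\<close>

lemma ln_pmf_ratio:
  assumes I: "finite I" "\<omega> \<in> configs I" and q: "\<And>e. e \<in> I \<Longrightarrow> 0 \<le> q e \<and> q e \<le> 1"
    and p: "\<And>e. e \<in> I \<Longrightarrow> 0 < p e \<and> p e < 1" and pos: "pmf (bernoulli_prod I q) \<omega> \<noteq> 0"
  shows "ln (pmf (bernoulli_prod I q) \<omega> / pmf (bernoulli_prod I p) \<omega>) = log_likelihood I q p \<omega>"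
proof -
  have Q: "pmf (bernoulli_prod I q) \<omega> = (\<Prod>e\<in>I. if \<omega> e then q e else 1 - q e)"
    using I q by (rule pmf_bernoulli_prod)
  have P: "pmf (bernoulli_prod I p) \<omega> = (\<Prod>e\<in>I. if \<omega> e then p e else 1 - p e)"
    using I p by (intro pmf_bernoulli_prod) (auto simp: less_imp_le)
  have nz: "(if \<omega> e then q e else 1 - q e) > 0" if "e \<in> I" for e
    using pos that q[of e] I(1) unfolding Q by (auto simp: order.order_iff_strict)
  have "ln (pmf (bernoulli_prod I q) \<omega> / pmf (bernoulli_prod I p) \<omega>)
      = ln (\<Prod>e\<in>I. (if \<omega> e then q e else 1 - q e) / (if \<omega> e then p e else 1 - p e))"
    unfolding P Q by (simp add: prod_dividef)
  also have "\<dots> = (\<Sum>e\<in>I. ln ((if \<omega> e then q e else 1 - q e) / (if \<omega> e then p e else 1 - p e)))"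
  proof (intro ln_prod I(1))
    fix e assume "e \<in> I"
    then show "(if \<omega> e then q e else 1 - q e) / (if \<omega> e then p e else 1 - p e) \<noteq> 0"
      using nz[of e] p[of e] by (cases "\<omega> e") auto
  qed
  also have "\<dots> = log_likelihood I q p \<omega>"
    unfolding log_likelihood_def by (intro sum.cong) auto
  finally show ?thesis .
qed

lemma pmf_bernoulli_prod_pos:
  assumes "finite I" "\<omega> \<in> configs I" "\<And>e. e \<in> I \<Longrightarrow> 0 < p e \<and> p e < 1"
  shows "pmf (bernoulli_prod I p) \<omega> > 0"
  using assms by (subst pmf_bernoulli_prod) (auto intro!: prod_pos simp: less_imp_le)

text \<open>Change of measure. The entropy of the tilted law is split over \<open>K\<close> and its
  complement. On \<open>K\<close> the slope \<open>1 / PK\<close> in \<open>gibbs_sum\<close>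
  produces \<open>- QK * ln PK\<close> with a loss of at most 1; off \<open>K\<close> the slope 1
  loses at most 1. The constant 2 collects both losses and is negligible against entropies of order
  N^2.\<close>

lemma ln_prob_ge_tilted:
  assumes I: "finite I" and q: "\<And>e. e \<in> I \<Longrightarrow> 0 \<le> q e \<and> q e \<le> 1"
    and p: "\<And>e. e \<in> I \<Longrightarrow> 0 < p e \<and> p e < 1"
    and pos: "measure_pmf.prob (bernoulli_prod I q) K > 0"
  shows "ln (measure_pmf.prob (bernoulli_prod I p) K)
     \<ge> - ((\<Sum>e\<in>I. rel_entropy (q e) (p e)) + 2) / measure_pmf.prob (bernoulli_prod I q) K"
proof -
  define P Q where "P = pmf (bernoulli_prod I p)" and "Q = pmf (bernoulli_prod I q)"
  define PK QK where "PK = (\<Sum>\<omega>\<in>configs I \<inter> K. P \<omega>)" and "QK = (\<Sum>\<omega>\<in>configs I \<inter> K. Q \<omega>)"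
  have QK: "QK > 0" using pos I by (simp add: QK_def Q_def prob_bernoulli_prod)
  have Q0: "Q \<omega> \<ge> 0" and P0: "P \<omega> \<ge> 0" for \<omega> by (auto simp: Q_def P_def)
  have Ppos: "P \<omega> > 0" if "\<omega> \<in> configs I" for \<omega>
    unfolding P_def by (rule pmf_bernoulli_prod_pos[OF I that p])
  have "configs I \<inter> K \<noteq> {}" using QK by (auto simp: QK_def)
  then have PK: "PK > 0" unfolding PK_def using Ppos I by (intro sum_pos) auto
  have "(\<Sum>e\<in>I. rel_entropy (q e) (p e)) = (\<Sum>\<omega>\<in>configs I. Q \<omega> * log_likelihood I q p \<omega>)"
    using I q by (intro mean_log_likelihood[symmetric])
      (simp_all only: Q_def sum_bernoulli_prod marginal_bernoulli_prod)
  also have "\<dots> = (\<Sum>\<omega>\<in>configs I. Q \<omega> * ln (Q \<omega> / P \<omega>))"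
  proof (intro sum.cong refl)
    fix \<omega> assume "\<omega> \<in> configs I"
    then show "Q \<omega> * log_likelihood I q p \<omega> = Q \<omega> * ln (Q \<omega> / P \<omega>)"
      using ln_pmf_ratio[OF I _ q p, of \<omega>] unfolding P_def Q_def
      by (cases "pmf (bernoulli_prod I q) \<omega> = 0") auto
  qed
  also have "\<dots> = (\<Sum>\<omega>\<in>configs I \<inter> K. Q \<omega> * ln (Q \<omega> / P \<omega>)) + (\<Sum>\<omega>\<in>configs I - K. Q \<omega> * ln (Q \<omega> / P \<omega>))"
    using I by (simp add: sum.Int_Diff[of "configs I" _ K])
  finally have "(\<Sum>e\<in>I. rel_entropy (q e) (p e)) =
      (\<Sum>\<omega>\<in>configs I \<inter> K. Q \<omega> * ln (Q \<omega> / P \<omega>)) + (\<Sum>\<omega>\<in>configs I - K. Q \<omega> * ln (Q \<omega> / P \<omega>))" .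
  moreover have "(\<Sum>\<omega>\<in>configs I \<inter> K. Q \<omega> * ln (Q \<omega> / P \<omega>)) \<ge> QK * ln (1 / PK) + QK - (1 / PK) * PK"
    unfolding QK_def PK_def using Q0 Ppos PK by (intro gibbs_sum) (auto simp: PK_def)
  moreover have "(\<Sum>\<omega>\<in>configs I - K. Q \<omega> * ln (Q \<omega> / P \<omega>))
      \<ge> (\<Sum>\<omega>\<in>configs I - K. Q \<omega>) * ln 1 + (\<Sum>\<omega>\<in>configs I - K. Q \<omega>) - 1 * (\<Sum>\<omega>\<in>configs I - K. P \<omega>)"
    using Q0 Ppos by (intro gibbs_sum) auto
  moreover have "(\<Sum>\<omega>\<in>configs I - K. P \<omega>) \<le> (\<Sum>\<omega>\<in>configs I. P \<omega>)"
    using I P0 by (intro sum_mono2) auto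
  moreover have "(\<Sum>\<omega>\<in>configs I. P \<omega>) = 1" using I by (simp add: P_def sum_bernoulli_prod)
  moreover have "(\<Sum>\<omega>\<in>configs I - K. Q \<omega>) \<ge> 0" using Q0 by (intro sum_nonneg) auto
  ultimately have "(\<Sum>e\<in>I. rel_entropy (q e) (p e)) \<ge> - QK * ln PK - 2"
    using PK QK ln_div[of 1 PK] by (simp only: ln_one) (simp; linarith)
  then have "ln PK \<ge> - ((\<Sum>e\<in>I. rel_entropy (q e) (p e)) + 2) / QK"
    using QK by (simp add: field_simps)
  then show ?thesis
    using I by (simp add: PK_def QK_def P_def Q_def prob_bernoulli_prod)
qed

text \<open>
  The vector \<open>q\<close> consists of the marginals of the product measure conditioned on \<open>K\<close>; relative
  entropy with respect to a product measure is superadditive over coordinates.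
\<close>

lemma ln_prob_le_marginals:
  assumes I: "finite I" and p: "\<And>e. e \<in> I \<Longrightarrow> 0 < p e \<and> p e < 1"
    and pos: "measure_pmf.prob (bernoulli_prod I p) K > 0"
  shows "\<exists>q. (\<forall>e. 0 \<le> q e \<and> q e \<le> 1) \<and>
    (\<forall>c b. (\<forall>\<omega>\<in>configs I \<inter> K. (\<Sum>e\<in>I. c e * of_bool (\<omega> e)) \<le> b) \<longrightarrow> (\<Sum>e\<in>I. c e * q e) \<le> b) \<and>
    ln (measure_pmf.prob (bernoulli_prod I p) K) \<le> - (\<Sum>e\<in>I. rel_entropy (q e) (p e))"
proof -
  define A where "A = configs I \<inter> K"
  define P where "P = pmf (bernoulli_prod I p)"
  define PK where "PK = (\<Sum>\<omega>\<in>A. P \<omega>)"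
  define w where "w \<omega> = P \<omega> / PK" for \<omega>
  define q where "q e = (\<Sum>\<omega>\<in>A. w \<omega> * of_bool (\<omega> e))" for e
  have finA: "finite A" using I by (simp add: A_def)
  have PK: "PK > 0" using pos I by (simp add: PK_def P_def A_def prob_bernoulli_prod)
  have Ppos: "P \<omega> > 0" if "\<omega> \<in> A" for \<omega>
    using that pmf_bernoulli_prod_pos[OF I _ p, of \<omega>] by (simp add: P_def A_def)
  have wpos: "w \<omega> > 0" if "\<omega> \<in> A" for \<omega>
    using Ppos[OF that] PK by (simp add: w_def)
  have w1: "(\<Sum>\<omega>\<in>A. w \<omega>) = 1"
    using PK by (simp add: w_def PK_def flip: sum_divide_distrib)
  have q0: "0 \<le> q e" for e
    unfolding q_def using wpos by (intro sum_nonneg) (auto simp: less_imp_le)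
  have q': "1 - q e = (\<Sum>\<omega>\<in>A. w \<omega> * of_bool (\<not> \<omega> e))" for e
    unfolding q_def w1[symmetric] sum_subtractf[symmetric] by (intro sum.cong) auto
  have q1: "q e \<le> 1" for e
  proof -
    have "0 \<le> 1 - q e" unfolding q' using wpos by (intro sum_nonneg) (auto simp: less_imp_le)
    then show ?thesis by simp
  qed
  have lin: "(\<Sum>e\<in>I. c e * q e) \<le> b"
    if *: "\<forall>\<omega>\<in>configs I \<inter> K. (\<Sum>e\<in>I. c e * of_bool (\<omega> e)) \<le> b" for c b
  proof -
    have "(\<Sum>e\<in>I. c e * q e) = (\<Sum>\<omega>\<in>A. w \<omega> * (\<Sum>e\<in>I. c e * of_bool (\<omega> e)))"
      unfolding q_def sum_distrib_left by (subst sum.swap) (intro sum.cong, auto)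
    also have "\<dots> \<le> (\<Sum>\<omega>\<in>A. w \<omega> * b)"
      using * wpos by (intro sum_mono mult_left_mono) (auto simp: A_def less_imp_le)
    finally show ?thesis using w1 by (simp flip: sum_distrib_right)
  qed
  define Q where "Q = pmf (bernoulli_prod I q)"
  \<comment> \<open>A configuration of \<open>A\<close> has positive conditional weight, and this
    weight is a summand in the marginal of every coordinate value that it shows. So no factor of the
    product law vanishes on \<open>A\<close>.\<close>
  have Qpos: "Q \<omega> > 0" if \<omega>: "\<omega> \<in> A" for \<omega>
  proof -
    have "(if \<omega> e then q e else 1 - q e) > 0" if "e \<in> I" for e
    proof (cases "\<omega> e")
      case True
      have "w \<omega> * of_bool (\<omega> e) \<le> q e"
        unfolding q_def using finA \<omega> wpos by (intro member_le_sum) (auto simp: less_imp_le)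
      then show ?thesis using True wpos[OF \<omega>] by simp
    next
      case False
      have "w \<omega> * of_bool (\<not> \<omega> e) \<le> 1 - q e"
        unfolding q' using finA \<omega> wpos by (intro member_le_sum) (auto simp: less_imp_le)
      then show ?thesis using False wpos[OF \<omega>] by simp
    qed
    moreover have "Q \<omega> = (\<Prod>e\<in>I. if \<omega> e then q e else 1 - q e)"
      unfolding Q_def using I q0 q1 \<omega> by (intro pmf_bernoulli_prod) (auto simp: A_def)
    ultimately show ?thesis by (simp add: prod_pos)
  qed
  \<comment> \<open>The product of the marginals may charge configurations outside \<open>A\<close>.
    Its mass on \<open>A\<close> is then below 1, which is the right direction for the entropy of
    \<open>w\<close> relative to \<open>Q\<close> to be nonnegative.\<close>
  have "(\<Sum>\<omega>\<in>A. Q \<omega>) \<le> (\<Sum>\<omega>\<in>configs I. Q \<omega>)"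
    using I by (intro sum_mono2) (auto simp: A_def Q_def)
  also have "\<dots> = 1" using I by (simp add: Q_def sum_bernoulli_prod)
  finally have Q1: "(\<Sum>\<omega>\<in>A. Q \<omega>) \<le> 1" .
  have "(\<Sum>\<omega>\<in>A. w \<omega>) * ln 1 + (\<Sum>\<omega>\<in>A. w \<omega>) - 1 * (\<Sum>\<omega>\<in>A. Q \<omega>) \<le> (\<Sum>\<omega>\<in>A. w \<omega> * ln (w \<omega> / Q \<omega>))"
    using wpos Qpos by (intro gibbs_sum) (auto simp: less_imp_le)
  then have "0 \<le> (\<Sum>\<omega>\<in>A. w \<omega> * ln (w \<omega> / Q \<omega>))" using w1 Q1 by simp
  \<comment> \<open>On \<open>A\<close> the conditioned law has the constant density
    \<open>1 / PK\<close> with respect to \<open>P\<close>, so its entropy relative to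
    \<open>P\<close> is \<open>- ln PK\<close>. Inserting \<open>Q\<close> between \<open>w\<close>
    and \<open>P\<close> splits off the mean log-likelihood, which sees only the marginals.\<close>
  also have "\<dots> = (\<Sum>\<omega>\<in>A. w \<omega> * (- ln PK) - w \<omega> * log_likelihood I q p \<omega>)"
  proof (intro sum.cong refl)
    fix \<omega> assume \<omega>: "\<omega> \<in> A"
    have "log_likelihood I q p \<omega> = ln (Q \<omega> / P \<omega>)"
      unfolding P_def Q_def using I \<omega> p q0 q1 Qpos[OF \<omega>]
      by (intro ln_pmf_ratio[symmetric]) (auto simp: A_def Q_def)
    moreover have "ln (w \<omega> / Q \<omega>) = - ln PK - ln (Q \<omega> / P \<omega>)"
      using Ppos[OF \<omega>] Qpos[OF \<omega>] PK by (simp add: w_def ln_div ln_mult)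
    ultimately show "w \<omega> * ln (w \<omega> / Q \<omega>) = w \<omega> * (- ln PK) - w \<omega> * log_likelihood I q p \<omega>"
      by (simp only: right_diff_distrib)
  qed
  also have "\<dots> = - ln PK - (\<Sum>e\<in>I. rel_entropy (q e) (p e))"
    using w1 mean_log_likelihood[OF w1, of I q p] 
    by (simp add: sum_subtractf sum_negf q_def flip: sum_distrib_right)
  finally have "ln PK \<le> - (\<Sum>e\<in>I. rel_entropy (q e) (p e))" by simp
  then have "ln (measure_pmf.prob (bernoulli_prod I p) K) \<le> - (\<Sum>e\<in>I. rel_entropy (q e) (p e))"
    using I by (simp add: PK_def P_def A_def prob_bernoulli_prod)
  with q0 q1 lin show ?thesis by (intro exI[of _ q] conjI allI impI)
qed


section \<open>Concentration of the random quadratic form\<close>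

definition pairs :: "nat \<Rightarrow> (nat \<times> nat) set" where
  "pairs N = {(i, j). i < j \<and> j < N}"

definition edge :: "nat \<Rightarrow> nat \<Rightarrow> nat \<times> nat" where
  "edge i j = (min i j, max i j)"

lemma finite_pairs [simp]: "finite (pairs N)"
  by (rule finite_subset[of _ "{..<N} \<times> {..<N}"]) (auto simp: pairs_def)

lemma edge_commute: "edge i j = edge j i"
  by (auto simp: edge_def)

lemma edge_eq_iff: "edge i j = edge k l \<longleftrightarrow> i = k \<and> j = l \<or> i = l \<and> j = k"
  by (auto simp: edge_def min_def max_def)

lemma edge_in_pairs: "i < N \<Longrightarrow> j < N \<Longrightarrow> i \<noteq> j \<Longrightarrow> edge i j \<in> pairs N"
  by (auto simp: edge_def pairs_def min_def max_def)

lemma sum_pairs: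
  fixes f :: "nat \<Rightarrow> nat \<Rightarrow> real"
  assumes sym: "\<And>i j. i < N \<Longrightarrow> j < N \<Longrightarrow> f i j = f j i" and diag: "\<And>i. i < N \<Longrightarrow> f i i = 0"
  shows "(\<Sum>(i, j)\<in>pairs N. f i j) = (\<Sum>i<N. \<Sum>j<N. f i j) / 2"
proof -
  define P' where "P' = {(i, j). j < i \<and> i < N}"
  have split: "{..<N} \<times> {..<N} = (pairs N \<union> P') \<union> {(i, j). i = j \<and> i < N}"
    by (auto simp: pairs_def P'_def)
  have finP': "finite P'"
    by (rule finite_subset[of _ "{..<N} \<times> {..<N}"]) (auto simp: P'_def)
  have finD: "finite {(i, j). i = j \<and> i < N}"
    by (rule finite_subset[of _ "{..<N} \<times> {..<N}"]) auto
  have "(\<Sum>i<N. \<Sum>j<N. f i j) = (\<Sum>(i, j)\<in>{..<N} \<times> {..<N}. f i j)"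
    by (simp add: sum.cartesian_product)
  also have "\<dots> = (\<Sum>(i, j)\<in>pairs N \<union> P'. f i j) + (\<Sum>(i, j)\<in>{(i, j). i = j \<and> i < N}. f i j)"
    unfolding split using finP' finD finite_pairs[of N]
    by (intro sum.union_disjoint) (auto simp: pairs_def P'_def simp del: finite_pairs)
  also have "(\<Sum>(i, j)\<in>{(i, j). i = j \<and> i < N}. f i j) = 0"
    using diag by (intro sum.neutral) auto
  also have "(\<Sum>(i, j)\<in>pairs N \<union> P'. f i j) = (\<Sum>(i, j)\<in>pairs N. f i j) + (\<Sum>(i, j)\<in>P'. f i j)"
    using finP' finite_pairs[of N]
    by (intro sum.union_disjoint) (auto simp: pairs_def P'_def simp del: finite_pairs)
  also have "(\<Sum>(i, j)\<in>P'. f i j) = (\<Sum>(i, j)\<in>pairs N. f i j)"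
    by (rule sum.reindex_bij_witness[of _ prod.swap prod.swap])
       (auto simp: pairs_def P'_def intro: sym)
  finally show ?thesis by simp
qed

lemma sum_pairs_edge:
  fixes v :: "nat \<Rightarrow> real" and a :: "nat \<times> nat \<Rightarrow> real"
  shows "(\<Sum>(i, j)\<in>pairs N. a (i, j) * (v i - v j)\<^sup>2)
       = (\<Sum>i<N. \<Sum>j<N. a (edge i j) * (v i - v j)\<^sup>2) / 2"
proof -
  have "(\<Sum>(i, j)\<in>pairs N. a (i, j) * (v i - v j)\<^sup>2) = (\<Sum>(i, j)\<in>pairs N. a (edge i j) * (v i - v j)\<^sup>2)"
    by (intro sum.cong) (auto simp: pairs_def edge_def min_def max_def)
  also have "\<dots> = (\<Sum>i<N. \<Sum>j<N. a (edge i j) * (v i - v j)\<^sup>2) / 2"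
    by (rule sum_pairs) (auto simp: edge_commute power2_commute)
  finally show ?thesis .
qed

text \<open>The identity for v^T (D - Y) v, where D is the diagonal matrix of row sums of Y. It
  serves for the adjacency matrix, for the centred noise, and for the integrals of a function over
  the parts of a partition.\<close>

lemma symmetric_form_expand:
  fixes v :: "nat \<Rightarrow> real" and y :: "nat \<Rightarrow> nat \<Rightarrow> real"
  assumes "\<And>i j. i < N \<Longrightarrow> j < N \<Longrightarrow> y i j = y j i"
  shows "(\<Sum>i<N. \<Sum>j<N. y i j * (v i - v j)\<^sup>2) / 2
       = (\<Sum>i<N. (\<Sum>j<N. y i j) * (v i)\<^sup>2) - (\<Sum>i<N. \<Sum>j<N. y i j * v i * v j)"
proof -
  have "(\<Sum>i<N. \<Sum>j<N. y i j * (v i - v j)\<^sup>2)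
      = (\<Sum>i<N. \<Sum>j<N. y i j * (v i)\<^sup>2) + (\<Sum>i<N. \<Sum>j<N. y i j * (v j)\<^sup>2) - 2 * (\<Sum>i<N. \<Sum>j<N. y i j * v i * v j)"
    by (simp add: power2_diff algebra_simps sum.distrib sum_subtractf sum_distrib_left)
  also have "(\<Sum>i<N. \<Sum>j<N. y i j * (v j)\<^sup>2) = (\<Sum>i<N. \<Sum>j<N. y i j * (v i)\<^sup>2)"
    by (subst sum.swap) (use assms in \<open>auto intro!: sum.cong\<close>)
  finally have "(\<Sum>i<N. \<Sum>j<N. y i j * (v i - v j)\<^sup>2)
      = 2 * (\<Sum>i<N. \<Sum>j<N. y i j * (v i)\<^sup>2) - 2 * (\<Sum>i<N. \<Sum>j<N. y i j * v i * v j)" by simp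
  moreover have "(\<Sum>i<N. (\<Sum>j<N. y i j) * (v i)\<^sup>2) = (\<Sum>i<N. \<Sum>j<N. y i j * (v i)\<^sup>2)"
    by (simp add: sum_distrib_right)
  ultimately show ?thesis by linarith
qed

text \<open>The fourth Schatten norm dominates the operator norm: |Y v|^2 pairs Y^T Y with v v^T,
  and Cauchy-Schwarz bounds it by the Frobenius norm of Y^T Y. A second Cauchy-Schwarz passes from
  |Y v| to the bilinear form. The hypothesis is a polynomial in the entries, so its expectation can
  be computed.\<close>

lemma bilinear_bound:
  fixes v :: "nat \<Rightarrow> real" and y :: "nat \<Rightarrow> nat \<Rightarrow> real"
  assumes B: "(\<Sum>j<N. \<Sum>k<N. (\<Sum>i<N. y i j * y i k)\<^sup>2) \<le> s ^ 4" and s: "s \<ge> 0"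
  shows "\<bar>\<Sum>i<N. \<Sum>j<N. y i j * v i * v j\<bar> \<le> s * (\<Sum>i<N. (v i)\<^sup>2)"
proof -
  define V where "V = (\<Sum>i<N. (v i)\<^sup>2)"
  have V0: "V \<ge> 0" by (simp add: V_def sum_nonneg)
  define R where "R = (\<Sum>i<N. (\<Sum>j<N. y i j * v j)\<^sup>2)"
  have R0: "R \<ge> 0" by (simp add: R_def sum_nonneg)
  have "R = (\<Sum>i<N. \<Sum>j<N. \<Sum>k<N. y i j * y i k * (v j * v k))"
    unfolding R_def power2_eq_square sum_product by (intro sum.cong) (auto simp: mult_ac)
  also have "\<dots> = (\<Sum>j<N. \<Sum>k<N. \<Sum>i<N. y i j * y i k * (v j * v k))"
    by (subst sum.swap, rule sum.cong[OF refl], rule sum.swap)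
  also have "\<dots> = (\<Sum>(j, k)\<in>{..<N} \<times> {..<N}. (\<Sum>i<N. y i j * y i k) * (v j * v k))"
    by (simp only: sum.cartesian_product[symmetric] sum_distrib_right prod.case)
  finally have R: "R = (\<Sum>p\<in>{..<N} \<times> {..<N}. (\<Sum>i<N. y i (fst p) * y i (snd p)) * (v (fst p) * v (snd p)))"
    by (simp add: case_prod_unfold)
  have "R\<^sup>2 \<le> (\<Sum>p\<in>{..<N} \<times> {..<N}. (\<Sum>i<N. y i (fst p) * y i (snd p))\<^sup>2)
           * (\<Sum>p\<in>{..<N} \<times> {..<N}. (v (fst p) * v (snd p))\<^sup>2)"
    unfolding R by (rule Cauchy_Schwarz_ineq_sum)
  also have "(\<Sum>p\<in>{..<N} \<times> {..<N}. (v (fst p) * v (snd p))\<^sup>2) = V\<^sup>2"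
    unfolding V_def power2_eq_square sum_product by (simp add: sum.cartesian_product case_prod_unfold mult_ac)
  also have "(\<Sum>p\<in>{..<N} \<times> {..<N}. (\<Sum>i<N. y i (fst p) * y i (snd p))\<^sup>2) * V\<^sup>2 \<le> s ^ 4 * V\<^sup>2"
    using B by (intro mult_right_mono) (auto simp: sum.cartesian_product case_prod_unfold)
  also have "s ^ 4 * V\<^sup>2 = (s\<^sup>2 * V)\<^sup>2" by (simp add: power_mult_distrib flip: power_mult)
  finally have R': "R \<le> s\<^sup>2 * V"
    using V0 by (rule_tac power2_le_imp_le) auto
  have "(\<Sum>i<N. \<Sum>j<N. y i j * v i * v j) = (\<Sum>i<N. v i * (\<Sum>j<N. y i j * v j))"
    by (simp add: sum_distrib_left mult_ac)
  then have "(\<Sum>i<N. \<Sum>j<N. y i j * v i * v j)\<^sup>2 \<le> V * R"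
    unfolding V_def R_def by (simp only: Cauchy_Schwarz_ineq_sum)
  also have "\<dots> \<le> V * (s\<^sup>2 * V)" using R' V0 by (intro mult_left_mono)
  also have "\<dots> = (s * V)\<^sup>2" by (simp add: power2_eq_square)
  finally have "\<bar>\<Sum>i<N. \<Sum>j<N. y i j * v i * v j\<bar> \<le> \<bar>s * V\<bar>"
    by (simp add: abs_le_square_iff)
  then show ?thesis using s V0 by (simp add: V_def)
qed

section \<open>Moments of sums of centred Bernoulli variables\<close>

lemma integrable_bernoulli_prod [simp]:
  fixes f :: "_ \<Rightarrow> real"
  shows "finite I \<Longrightarrow> integrable (measure_pmf (bernoulli_prod I p)) f"
  by (intro integrable_measure_pmf_finite finite_subset[OF set_bernoulli_prod]) auto

text \<open>Invariance of \<open>g\<close> under updates at \<open>e\<close> expresses that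
  \<open>g\<close> does not depend on that coordinate. Once \<open>e\<close> is split off from the
  product law, the centred factor has mean 0 whatever the other coordinates are.\<close>

lemma expectation_centered_mult:
  fixes g :: "_ \<Rightarrow> real"
  assumes I: "finite I" "e \<in> I" "0 \<le> q e" "q e \<le> 1" and g: "\<And>\<omega> b. g (fun_upd \<omega> e b) = g \<omega>"
  shows "measure_pmf.expectation (bernoulli_prod I q) (\<lambda>\<omega>. (of_bool (\<omega> e) - q e) * g \<omega>) = 0"
proof -
  define M where "M = Pi_pmf (I - {e}) False (\<lambda>e. bernoulli_pmf (q e))"
  have M: "bernoulli_prod I q = bernoulli_pmf (q e) \<bind> (\<lambda>y. map_pmf (\<lambda>f. fun_upd f e y) M)"
    unfolding bernoulli_prod_def M_def map_pmf_def
    using Pi_pmf_insert'[of "I - {e}" e False "\<lambda>e. bernoulli_pmf (q e)"] I by (simp add: insert_absorb)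
  have finM: "finite (set_pmf M)"
    using I unfolding M_def
    by (intro finite_subset[OF set_bernoulli_prod[of "I - {e}" q, unfolded bernoulli_prod_def]]) auto
  have "measure_pmf.expectation (bernoulli_prod I q) (\<lambda>\<omega>. (of_bool (\<omega> e) - q e) * g \<omega>)
      = (\<Sum>y\<in>UNIV. pmf (bernoulli_pmf (q e)) y *\<^sub>R measure_pmf.expectation (map_pmf (\<lambda>f. fun_upd f e y) M)
           (\<lambda>\<omega>. (of_bool (\<omega> e) - q e) * g \<omega>))"
    unfolding M using finM by (intro pmf_expectation_bind) auto
  also have "\<dots> = (\<Sum>y\<in>UNIV. pmf (bernoulli_pmf (q e)) y * ((of_bool y - q e) * measure_pmf.expectation M g))"
    by (simp add: g)
  also have "\<dots> = 0" using I by (simp add: UNIV_bool algebra_simps)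
  finally show ?thesis .
qed

lemma second_moment_orthogonal:
  fixes X :: "'k \<Rightarrow> ('a \<Rightarrow> bool) \<Rightarrow> real"
  assumes I: "finite I" and T: "finite T" and X1: "\<And>k \<omega>. k \<in> T \<Longrightarrow> \<bar>X k \<omega>\<bar> \<le> 1"
    and orth: "\<And>k l. k \<in> T \<Longrightarrow> l \<in> T \<Longrightarrow> k \<noteq> l \<Longrightarrow>
       measure_pmf.expectation (bernoulli_prod I q) (\<lambda>\<omega>. X k \<omega> * X l \<omega>) = 0"
  shows "measure_pmf.expectation (bernoulli_prod I q) (\<lambda>\<omega>. (\<Sum>k\<in>T. X k \<omega>)\<^sup>2) \<le> real (card T)"
proof -
  let ?E = "measure_pmf.expectation (bernoulli_prod I q)"
  have "?E (\<lambda>\<omega>. (\<Sum>k\<in>T. X k \<omega>)\<^sup>2) = (\<Sum>k\<in>T. \<Sum>l\<in>T. ?E (\<lambda>\<omega>. X k \<omega> * X l \<omega>))"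
    unfolding power2_eq_square sum_product using I by (simp add: Bochner_Integration.integral_sum)
  also have "\<dots> = (\<Sum>k\<in>T. ?E (\<lambda>\<omega>. X k \<omega> * X k \<omega>))"
  proof (intro sum.cong refl)
    fix k assume "k \<in> T"
    then show "(\<Sum>l\<in>T. ?E (\<lambda>\<omega>. X k \<omega> * X l \<omega>)) = ?E (\<lambda>\<omega>. X k \<omega> * X k \<omega>)"
      using T orth by (subst sum.remove[of _ k]) (auto intro!: sum.neutral)
  qed
  also have "\<dots> \<le> (\<Sum>k\<in>T. 1)"
  proof (intro sum_mono)
    fix k assume k: "k \<in> T"
    have "X k \<omega> * X k \<omega> \<le> 1" for \<omega>
      using X1[OF k, of \<omega>] unfolding power2_eq_square[symmetric] by (simp add: abs_square_le_1)
    then have "?E (\<lambda>\<omega>. X k \<omega> * X k \<omega>) \<le> ?E (\<lambda>\<omega>. 1)"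
      using I by (intro integral_mono) auto
    then show "?E (\<lambda>\<omega>. X k \<omega> * X k \<omega>) \<le> 1" by simp
  qed
  finally show ?thesis by simp
qed

text \<open>Induction on \<open>T\<close>, adding one centred variable Y to the sum S. In (Y + S)^4
  the term Y S^3 vanishes because Y is centred, and S Y^3 because every summand of S is. With n =
  card T there remain 3 n^2 + 6 n + 1, which is at most 3 (n + 1)^2.\<close>

lemma fourth_moment_centered:
  assumes I: "finite I" and T: "T \<subseteq> I" and q: "\<And>e. e \<in> I \<Longrightarrow> 0 \<le> q e \<and> q e \<le> 1"
  shows "measure_pmf.expectation (bernoulli_prod I q) (\<lambda>\<omega>. (\<Sum>e\<in>T. of_bool (\<omega> e) - q e) ^ 4)
     \<le> 3 * (real (card T))\<^sup>2"
  using finite_subset[OF T I] T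
proof (induction rule: finite_induct)
  case (insert e T)
  let ?E = "measure_pmf.expectation (bernoulli_prod I q)"
  define Y where "Y e \<omega> = of_bool (\<omega> e) - q e" for e \<omega>
  define S where "S \<omega> = (\<Sum>e\<in>T. Y e \<omega>)" for \<omega>
  have Y1: "\<bar>Y e \<omega>\<bar> \<le> 1" if "e \<in> I" for e \<omega>
    using q[OF that] by (auto simp: Y_def)
  have Yupd: "Y e' (fun_upd \<omega> e b) = Y e' \<omega>" if "e' \<noteq> e" for e e' \<omega> b
    using that by (simp add: Y_def)
  have Supd: "S (fun_upd \<omega> e b) = S \<omega>" for \<omega> b
    unfolding S_def using insert by (intro sum.cong) (auto simp: Y_def)
  have e: "e \<in> I" and TI: "T \<subseteq> I" and finT: "finite T" and eT: "e \<notin> T" using insert by auto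
  have Z1: "?E (\<lambda>\<omega>. Y e \<omega> * S \<omega> ^ 3) = 0"
    unfolding Y_def using I e q[OF e] by (intro expectation_centered_mult) (auto simp: Supd)
  have Z3: "?E (\<lambda>\<omega>. S \<omega> * Y e \<omega> ^ 3) = 0"
  proof -
    have "?E (\<lambda>\<omega>. Y e' \<omega> * Y e \<omega> ^ 3) = 0" if "e' \<in> T" for e'
      unfolding Y_def[of e'] using I that TI q[of e'] eT
      by (intro expectation_centered_mult) (auto simp: Y_def)
    then show ?thesis
      unfolding S_def sum_distrib_right using I by (simp add: Bochner_Integration.integral_sum)
  qed
  have "?E (\<lambda>\<omega>. (S \<omega>)\<^sup>2) \<le> real (card T)"
    unfolding S_def
  proof (rule second_moment_orthogonal[OF I finT])
    fix k l assume kl: "k \<in> T" "l \<in> T" "k \<noteq> l"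
    show "?E (\<lambda>\<omega>. Y k \<omega> * Y l \<omega>) = 0"
      unfolding Y_def[of k] using I kl TI q[of k]
      by (intro expectation_centered_mult) (auto simp: Y_def)
  qed (use Y1 TI in auto)
  moreover have "?E (\<lambda>\<omega>. (S \<omega>)\<^sup>2 * (Y e \<omega>)\<^sup>2) \<le> ?E (\<lambda>\<omega>. (S \<omega>)\<^sup>2)"
  proof (intro integral_mono)
    fix \<omega>
    have "(S \<omega>)\<^sup>2 * (Y e \<omega>)\<^sup>2 \<le> (S \<omega>)\<^sup>2 * 1"
      using Y1[OF e, of \<omega>] by (intro mult_left_mono) (auto simp: abs_square_le_1)
    then show "(S \<omega>)\<^sup>2 * (Y e \<omega>)\<^sup>2 \<le> (S \<omega>)\<^sup>2" by simp
  qed (use I in auto)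
  ultimately have Z2: "?E (\<lambda>\<omega>. (S \<omega>)\<^sup>2 * (Y e \<omega>)\<^sup>2) \<le> real (card T)" by simp
  have "?E (\<lambda>\<omega>. (Y e \<omega>) ^ 4) \<le> ?E (\<lambda>\<omega>. 1)"
  proof (intro integral_mono)
    fix \<omega>
    have "\<bar>Y e \<omega>\<bar> ^ 4 \<le> 1" using Y1[OF e, of \<omega>] by (intro power_le_one) auto
    then show "(Y e \<omega>) ^ 4 \<le> 1" by simp
  qed (use I in auto)
  then have Z4: "?E (\<lambda>\<omega>. (Y e \<omega>) ^ 4) \<le> 1" by simp
  have Z0: "?E (\<lambda>\<omega>. (S \<omega>) ^ 4) \<le> 3 * (real (card T))\<^sup>2"
    unfolding S_def Y_def using insert by auto
  have "(\<Sum>e\<in>insert e T. of_bool (\<omega> e) - q e) ^ 4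
      = S \<omega> ^ 4 + 4 * (Y e \<omega> * S \<omega> ^ 3) + 6 * ((S \<omega>)\<^sup>2 * (Y e \<omega>)\<^sup>2) + 4 * (S \<omega> * Y e \<omega> ^ 3) + Y e \<omega> ^ 4" for \<omega>
  proof -
    have "(\<Sum>e\<in>insert e T. of_bool (\<omega> e) - q e) = Y e \<omega> + S \<omega>"
      unfolding S_def Y_def using finT eT by simp
    moreover have "(y + s) ^ 4 = s ^ 4 + 4 * (y * s ^ 3) + 6 * (s\<^sup>2 * y\<^sup>2) + 4 * (s * y ^ 3) + y ^ 4" for y s :: real
      by (simp add: algebra_simps power2_eq_square power3_eq_cube power4_eq_xxxx)
    ultimately show ?thesis by simp
  qed
  then have "?E (\<lambda>\<omega>. (\<Sum>e\<in>insert e T. of_bool (\<omega> e) - q e) ^ 4)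
      = ?E (\<lambda>\<omega>. S \<omega> ^ 4) + 4 * ?E (\<lambda>\<omega>. Y e \<omega> * S \<omega> ^ 3) + 6 * ?E (\<lambda>\<omega>. (S \<omega>)\<^sup>2 * (Y e \<omega>)\<^sup>2)
        + 4 * ?E (\<lambda>\<omega>. S \<omega> * Y e \<omega> ^ 3) + ?E (\<lambda>\<omega>. Y e \<omega> ^ 4)"
    using I by simp
  also have "\<dots> \<le> 3 * (real (card T))\<^sup>2 + 6 * real (card T) + 1"
    using Z0 Z1 Z2 Z3 Z4 by simp
  also have "\<dots> \<le> 3 * (real (card (insert e T)))\<^sup>2"
    using finT eT by (simp add: power2_eq_square algebra_simps)
  finally show ?case .
qed simp

text \<open>The noise is the Laplacian of the centred edges: a diagonal part with row sums
  \<open>D\<close> and a bilinear part controlled by \<open>bilinear_bound\<close>. Each part may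
  use up \<open>t * N\<close>, whence \<open>2 * t * N\<close>. Both are dominated through one
  nonnegative statistic \<open>W\<close> of mean O(N^3), and Markov's inequality at level (t N)^4
  gives a failure probability of order 1/N.\<close>

lemma form_concentration:
  assumes q: "\<And>e. e \<in> pairs N \<Longrightarrow> 0 \<le> q e \<and> q e \<le> 1" and t: "t > 0" and N: "N \<ge> 1"
    and form: "\<And>v. (\<Sum>(i, j)\<in>pairs N. q (i, j) * (v i - v j)\<^sup>2) \<le> \<gamma> * (\<Sum>i<N. (v i)\<^sup>2)"
  shows "measure_pmf.prob (bernoulli_prod (pairs N) q)
     {\<omega>. \<forall>v. (\<Sum>(i, j)\<in>pairs N. of_bool (\<omega> (i, j)) * (v i - v j)\<^sup>2) \<le> (\<gamma> + 2 * t * N) * (\<Sum>i<N. (v i)\<^sup>2)}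
     \<ge> 1 - 5 / (t ^ 4 * N)"
proof -
  let ?M = "bernoulli_prod (pairs N) q"
  let ?E = "measure_pmf.expectation ?M"
  let ?K = "{\<omega>. \<forall>v. (\<Sum>(i, j)\<in>pairs N. of_bool (\<omega> (i, j)) * (v i - v j)\<^sup>2) \<le> (\<gamma> + 2 * t * N) * (\<Sum>i<N. (v i)\<^sup>2)}"
  define Y where "Y e \<omega> = of_bool (\<omega> e) - q e" for e and \<omega> :: "nat \<times> nat \<Rightarrow> bool"
  define y where "y \<omega> i j = (if i = j then 0 else Y (edge i j) \<omega>)" for \<omega> i j
  have ysym: "y \<omega> i j = y \<omega> j i" for \<omega> i j by (auto simp: y_def edge_commute)
  have Y1: "\<bar>Y e \<omega>\<bar> \<le> 1" if "e \<in> pairs N" for e \<omega>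
    using q[OF that] by (auto simp: Y_def)
  have y1: "\<bar>y \<omega> i j\<bar> \<le> 1" if "i < N" "j < N" for \<omega> i j
    using that Y1 edge_in_pairs by (auto simp: y_def)
  define D where "D \<omega> i = (\<Sum>j<N. y \<omega> i j)" for \<omega> i
  define B where "B \<omega> j k = (\<Sum>i<N. y \<omega> i j * y \<omega> i k)" for \<omega> j k
  define W where "W \<omega> = (\<Sum>i<N. D \<omega> i ^ 4) + (\<Sum>j<N. \<Sum>k<N. (B \<omega> j k)\<^sup>2)" for \<omega>
  have ED: "?E (\<lambda>\<omega>. D \<omega> i ^ 4) \<le> 3 * (real N)\<^sup>2" if i: "i < N" for i
  proof -
    have D: "D \<omega> i = (\<Sum>e\<in>edge i ` ({..<N} - {i}). of_bool (\<omega> e) - q e)" for \<omega>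
    proof -
      have "D \<omega> i = (\<Sum>j\<in>{..<N} - {i}. y \<omega> i j)"
        unfolding D_def by (intro sum.mono_neutral_right) (auto simp: y_def)
      also have "\<dots> = (\<Sum>j\<in>{..<N} - {i}. Y (edge i j) \<omega>)"
        by (intro sum.cong) (auto simp: y_def)
      also have "\<dots> = (\<Sum>e\<in>edge i ` ({..<N} - {i}). Y e \<omega>)"
        by (subst sum.reindex) (auto simp: inj_on_def edge_eq_iff)
      finally show ?thesis by (simp add: Y_def)
    qed
    have "?E (\<lambda>\<omega>. D \<omega> i ^ 4) \<le> 3 * (real (card (edge i ` ({..<N} - {i}))))\<^sup>2"
      unfolding D using i q by (intro fourth_moment_centered) (auto intro: edge_in_pairs)
    also have "card (edge i ` ({..<N} - {i})) \<le> N"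
      by (rule order.trans[OF card_image_le]) (auto intro: order.trans[OF card_Diff1_le])
    then have "3 * (real (card (edge i ` ({..<N} - {i}))))\<^sup>2 \<le> 3 * (real N)\<^sup>2"
      by (intro mult_left_mono power_mono) auto
    finally show ?thesis .
  qed
  have EB: "?E (\<lambda>\<omega>. (B \<omega> j k)\<^sup>2) \<le> real N" if jk: "j < N" "k < N" "j \<noteq> k" for j k
  proof -
    have "?E (\<lambda>\<omega>. (B \<omega> j k)\<^sup>2) \<le> real (card {..<N})"
      unfolding B_def
    proof (rule second_moment_orthogonal)
      show "\<bar>y \<omega> i j * y \<omega> i k\<bar> \<le> 1" if "i \<in> {..<N}" for i \<omega>
        using y1[of i j \<omega>] y1[of i k \<omega>] that jk by (auto simp: abs_mult intro: mult_le_one)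
      fix i l assume il: "i \<in> {..<N}" "l \<in> {..<N}" "i \<noteq> l"
      \<comment> \<open>If i and l both differ from j and k, the edge between i and j occurs exactly
        once among the four factors, and its centring kills the expectation. Any coincidence brings
        in a diagonal entry of \<open>y\<close>, which is 0.\<close>
      show "?E (\<lambda>\<omega>. y \<omega> i j * y \<omega> i k * (y \<omega> l j * y \<omega> l k)) = 0"
      proof (cases "i = j \<or> i = k \<or> l = j \<or> l = k")
        case True
        then show ?thesis by (auto simp: y_def)
      next
        case False
        have "?E (\<lambda>\<omega>. (of_bool (\<omega> (edge i j)) - q (edge i j)) * (y \<omega> i k * (y \<omega> l j * y \<omega> l k))) = 0"
          using False il jk q[OF edge_in_pairs[of i N j]] edge_in_pairs[of i N j]
          by (intro expectation_centered_mult) (auto simp: y_def Y_def edge_eq_iff)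
        then show ?thesis using False by (simp add: y_def Y_def mult.assoc)
      qed
    qed auto
    then show ?thesis by simp
  qed
  have EB': "?E (\<lambda>\<omega>. (B \<omega> j j)\<^sup>2) \<le> (real N)\<^sup>2" if "j < N" for j
  proof -
    have "\<bar>B \<omega> j j\<bar> \<le> real N" for \<omega>
    proof -
      have "\<bar>B \<omega> j j\<bar> \<le> (\<Sum>i<N. 1)"
        unfolding B_def
      proof (intro order.trans[OF sum_abs] sum_mono)
        fix i assume "i \<in> {..<N}"
        then show "\<bar>y \<omega> i j * y \<omega> i j\<bar> \<le> 1"
          using y1[of i j \<omega>] that unfolding abs_mult by (intro mult_le_one) auto
      qed
      then show ?thesis by simp
    qed
    then have "?E (\<lambda>\<omega>. (B \<omega> j j)\<^sup>2) \<le> ?E (\<lambda>\<omega>. (real N)\<^sup>2)"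
      by (intro integral_mono) (auto simp: abs_le_square_iff[symmetric])
    then show ?thesis by simp
  qed
  have "?E W = (\<Sum>i<N. ?E (\<lambda>\<omega>. D \<omega> i ^ 4)) + (\<Sum>j<N. \<Sum>k<N. ?E (\<lambda>\<omega>. (B \<omega> j k)\<^sup>2))"
    unfolding W_def by (simp add: Bochner_Integration.integral_sum)
  \<comment> \<open>Origin of the 5: the rows give 3 N^3, the N^2 entries of \<open>B\<close> give
    N^3 at N each, and the N diagonal entries of \<open>B\<close> give another N^3, since they are
    sums of squares without cancellation.\<close>
  also have "\<dots> \<le> (\<Sum>i<N. 3 * (real N)\<^sup>2) + (\<Sum>j<N. \<Sum>k<N. real N + (if j = k then (real N)\<^sup>2 else 0))"
    using ED EB EB' by (intro add_mono sum_mono) (auto intro: add_increasing)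
  also have "\<dots> = 5 * real N ^ 3"
    by (simp add: sum.distrib power2_eq_square power3_eq_cube)
  finally have EW: "?E W \<le> 5 * real N ^ 3" .
  have W0: "W \<omega> \<ge> 0" for \<omega> unfolding W_def by (intro add_nonneg_nonneg sum_nonneg) auto
  have good: "\<omega> \<in> ?K" if W: "W \<omega> < (t * N) ^ 4" for \<omega>
  proof (intro CollectI allI)
    fix v :: "nat \<Rightarrow> real"
    have tN: "t * N \<ge> 0" using t by simp
    have "(\<Sum>i<N. D \<omega> i ^ 4) \<ge> 0" "(\<Sum>j<N. \<Sum>k<N. (B \<omega> j k)\<^sup>2) \<ge> 0" by (auto intro!: sum_nonneg)
    then have D4: "(\<Sum>i<N. D \<omega> i ^ 4) \<le> (t * N) ^ 4" and B4: "(\<Sum>j<N. \<Sum>k<N. (B \<omega> j k)\<^sup>2) \<le> (t * N) ^ 4"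
      using W by (auto simp: W_def)
    have D: "D \<omega> i \<le> t * N" if "i < N" for i
    proof -
      have "D \<omega> i ^ 4 \<le> (\<Sum>i<N. D \<omega> i ^ 4)" using that by (intro member_le_sum) auto
      then have "\<bar>D \<omega> i\<bar> ^ 4 \<le> (t * N) ^ 4" using D4 by simp
      then have "\<bar>D \<omega> i\<bar> \<le> t * N" using tN by (subst (asm) power_mono_iff) auto 
      then show ?thesis by simp
    qed
    have "(\<Sum>(i, j)\<in>pairs N. of_bool (\<omega> (i, j)) * (v i - v j)\<^sup>2)
        = (\<Sum>(i, j)\<in>pairs N. q (i, j) * (v i - v j)\<^sup>2) + (\<Sum>(i, j)\<in>pairs N. Y (i, j) \<omega> * (v i - v j)\<^sup>2)"
      by (simp add: Y_def case_prod_unfold algebra_simps flip: sum.distrib)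
    also have "(\<Sum>(i, j)\<in>pairs N. Y (i, j) \<omega> * (v i - v j)\<^sup>2) = (\<Sum>i<N. \<Sum>j<N. Y (edge i j) \<omega> * (v i - v j)\<^sup>2) / 2"
      by (rule sum_pairs_edge[of "\<lambda>e. Y e \<omega>"])
    also have "(\<Sum>i<N. \<Sum>j<N. Y (edge i j) \<omega> * (v i - v j)\<^sup>2) = (\<Sum>i<N. \<Sum>j<N. y \<omega> i j * (v i - v j)\<^sup>2)"
      by (intro sum.cong) (auto simp: y_def)
    also have "(\<Sum>i<N. \<Sum>j<N. y \<omega> i j * (v i - v j)\<^sup>2) / 2
       = (\<Sum>i<N. D \<omega> i * (v i)\<^sup>2) - (\<Sum>i<N. \<Sum>j<N. y \<omega> i j * v i * v j)"
      unfolding D_def by (rule symmetric_form_expand) (rule ysym)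
    also have "(\<Sum>i<N. D \<omega> i * (v i)\<^sup>2) \<le> (\<Sum>i<N. (t * N) * (v i)\<^sup>2)"
      using D by (intro sum_mono mult_right_mono) auto
    also have "(\<Sum>i<N. (t * N) * (v i)\<^sup>2) = t * N * (\<Sum>i<N. (v i)\<^sup>2)"
      by (simp add: sum_distrib_left)
    finally have "(\<Sum>(i, j)\<in>pairs N. of_bool (\<omega> (i, j)) * (v i - v j)\<^sup>2)
      \<le> (\<Sum>(i, j)\<in>pairs N. q (i, j) * (v i - v j)\<^sup>2) + t * N * (\<Sum>i<N. (v i)\<^sup>2) + \<bar>\<Sum>i<N. \<Sum>j<N. y \<omega> i j * v i * v j\<bar>"
      by linarith
    also have "\<bar>\<Sum>i<N. \<Sum>j<N. y \<omega> i j * v i * v j\<bar> \<le> t * N * (\<Sum>i<N. (v i)\<^sup>2)"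
      using B4 tN unfolding B_def by (rule bilinear_bound)
    finally show "(\<Sum>(i, j)\<in>pairs N. of_bool (\<omega> (i, j)) * (v i - v j)\<^sup>2) \<le> (\<gamma> + 2 * t * N) * (\<Sum>i<N. (v i)\<^sup>2)"
      using form[of v] by (simp add: algebra_simps)
  qed
  have tN4: "(t * N) ^ 4 > 0" using t N by simp
  have "measure_pmf.prob ?M {\<omega> \<in> space (measure_pmf ?M). (t * N) ^ 4 \<le> W \<omega>} \<le> ?E W / (t * N) ^ 4"
    using W0 tN4 by (intro integral_Markov_inequality_measure) auto
  also have "\<dots> \<le> (5 * real N ^ 3) / (t * N) ^ 4"
    using EW tN4 by (intro divide_right_mono) auto
  also have "\<dots> = 5 / (t ^ 4 * N)"
    using t N by (simp add: field_simps power_mult_distrib eval_nat_numeral)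
  finally have "measure_pmf.prob ?M (UNIV - {\<omega>. (t * N) ^ 4 \<le> W \<omega>}) \<ge> 1 - 5 / (t ^ 4 * N)"
    using measure_pmf.prob_compl[of "{\<omega>. (t * N) ^ 4 \<le> W \<omega>}" ?M]
    by (simp only: space_measure_pmf) simp
  also have "measure_pmf.prob ?M (UNIV - {\<omega>. (t * N) ^ 4 \<le> W \<omega>}) \<le> measure_pmf.prob ?M ?K"
    using good by (intro measure_pmf.finite_measure_mono) (auto simp: not_le)
  finally show ?thesis .
qed


section \<open>The largest eigenvalue as a maximal quadratic form\<close>

definition qform :: "nat \<Rightarrow> (nat \<Rightarrow> nat \<Rightarrow> real) \<Rightarrow> (nat \<Rightarrow> real) \<Rightarrow> real" where
  "qform N a v = (\<Sum>i<N. \<Sum>j<N. a i j * v i * v j)"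

text \<open>Vectors are functions on all naturals here. Vanishing from \<open>N\<close> on confines
  the sphere to a product of compact intervals and singletons, so that Tychonoff's theorem
  applies.\<close>

lemma compact_sphere_nat:
  "compact {v :: nat \<Rightarrow> real. (\<forall>i. N \<le> i \<longrightarrow> v i = 0) \<and> (\<Sum>i<N. (v i)\<^sup>2) = 1}" (is "compact ?S")
proof -
  define B where "B = PiE (UNIV :: nat set) (\<lambda>i. if i < N then {-1..1::real} else {0})"
  have "compactin (product_topology (\<lambda>i. euclidean) UNIV) B"
    unfolding B_def by (subst compactin_PiE) auto
  then have B: "compact B"
    by (simp add: euclidean_product_topology)
  have "?S \<subseteq> B"
  proof
    fix v assume v: "v \<in> ?S"
    have "v i \<in> {-1..1}" if "i < N" for i
    proof -
      have "(v i)\<^sup>2 \<le> (\<Sum>i<N. (v i)\<^sup>2)" using that by (intro member_le_sum) auto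
      then have "(v i)\<^sup>2 \<le> 1" using v by simp
      then have "\<bar>v i\<bar> \<le> 1" by (simp add: abs_square_le_1)
      then show ?thesis by (simp add: abs_le_iff)
    qed
    then show "v \<in> B" using v by (auto simp: B_def)
  qed
  moreover have "closed ?S"
  proof -
    have "closed {v :: nat \<Rightarrow> real. N \<le> i \<longrightarrow> v i = 0}" for i
      by (cases "N \<le> i") (auto intro!: closed_Collect_eq continuous_intros)
    then have "closed (\<Inter>i. {v :: nat \<Rightarrow> real. N \<le> i \<longrightarrow> v i = 0})" by auto
    moreover have "closed {v :: nat \<Rightarrow> real. (\<Sum>i<N. (v i)\<^sup>2) = 1}"
      by (intro closed_Collect_eq continuous_intros continuous_on_product_coordinates)
    ultimately have "closed ((\<Inter>i. {v :: nat \<Rightarrow> real. N \<le> i \<longrightarrow> v i = 0}) \<inter> {v. (\<Sum>i<N. (v i)\<^sup>2) = 1})"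
      by (rule closed_Int)
    also have "(\<Inter>i. {v :: nat \<Rightarrow> real. N \<le> i \<longrightarrow> v i = 0}) \<inter> {v. (\<Sum>i<N. (v i)\<^sup>2) = 1} = ?S" by auto
    finally show ?thesis .
  qed
  ultimately show ?thesis
    using compact_Int_closed[OF B, of ?S] by (simp add: Int_absorb1)
qed

text \<open>First-order condition for a minimum at 0. The trial point \<open>- b / (c + 1)\<close>
  makes the quadratic negative unless \<open>b\<close> is 0; the shift by 1 in its denominator
  covers the case \<open>c = 0\<close>.\<close>

lemma linear_coeff_zero:
  fixes b c :: real
  assumes "\<And>t. 2 * t * b + t\<^sup>2 * c \<ge> 0" "c \<ge> 0"
  shows "b = 0"
proof -
  have "2 * (- b / (c + 1)) * b + (- b / (c + 1))\<^sup>2 * c \<ge> 0" by (rule assms)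
  also have "2 * (- b / (c + 1)) * b + (- b / (c + 1))\<^sup>2 * c = - (b\<^sup>2 * (c + 2)) / (c + 1)\<^sup>2"
  proof -
    have "c + 1 > 0" using assms(2) by simp
    then show ?thesis by (simp add: divide_simps power2_eq_square) (simp add: algebra_simps)
  qed
  finally have "b\<^sup>2 * (c + 2) \<le> 0"
    using assms(2) by (simp add: divide_le_0_iff zero_le_divide_iff)
  then show ?thesis using assms(2) by (simp add: mult_le_0_iff)
qed

lemma qform_add:
  assumes "\<And>i j. i < N \<Longrightarrow> j < N \<Longrightarrow> a i j = a j i"
  shows "qform N a (\<lambda>i. v i + t * w i)
       = qform N a v + 2 * t * (\<Sum>i<N. \<Sum>j<N. a i j * v j * w i) + t\<^sup>2 * qform N a w"
proof -
  have "qform N a (\<lambda>i. v i + t * w i) = qform N a v + t * (\<Sum>i<N. \<Sum>j<N. a i j * v j * w i)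
     + t * (\<Sum>i<N. \<Sum>j<N. a i j * w j * v i) + t\<^sup>2 * qform N a w"
    unfolding qform_def power2_eq_square sum_distrib_left sum.distrib[symmetric]
    by (intro sum.cong refl) (simp add: algebra_simps)
  also have "(\<Sum>i<N. \<Sum>j<N. a i j * w j * v i) = (\<Sum>i<N. \<Sum>j<N. a i j * v j * w i)"
    by (subst sum.swap) (use assms in \<open>auto intro!: sum.cong\<close>)
  finally show ?thesis by simp
qed

text \<open>Variational construction: \<open>k\<close> is the maximum of the form on the compact
  unit sphere and \<open>v\<close> is a maximizer. Homogeneity extends the inequality from the
  sphere to all vectors, and stationarity at \<open>v\<close> is the eigenvalue equation.\<close>

lemma symmetric_top_eigenpair:
  fixes a :: "nat \<Rightarrow> nat \<Rightarrow> real"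
  assumes sym: "\<And>i j. i < N \<Longrightarrow> j < N \<Longrightarrow> a i j = a j i" and N: "N \<ge> 1"
  obtains k v where "(\<Sum>i<N. (v i)\<^sup>2) = 1" "\<And>i. i < N \<Longrightarrow> (\<Sum>j<N. a i j * v j) = k * v i"
    "\<And>w. qform N a w \<le> k * (\<Sum>i<N. (w i)\<^sup>2)"
proof -
  define S where "S = {v :: nat \<Rightarrow> real. (\<forall>i. N \<le> i \<longrightarrow> v i = 0) \<and> (\<Sum>i<N. (v i)\<^sup>2) = 1}"
  have S_iff: "v \<in> S \<longleftrightarrow> (\<forall>i. N \<le> i \<longrightarrow> v i = 0) \<and> (\<Sum>i<N. (v i)\<^sup>2) = 1" for v
    by (simp add: S_def)
  have "(\<lambda>i. if i = 0 then 1 else 0) \<in> S"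
  proof -
    have "(\<Sum>i<N. (if i = 0 then 1 else 0 :: real)\<^sup>2) = (\<Sum>i<N. if i = 0 then 1 else 0)"
      by (intro sum.cong) auto
    then show ?thesis using N by (auto simp: S_iff)
  qed
  then have "S \<noteq> {}" by blast
  moreover have "continuous_on S (qform N a)"
    unfolding qform_def
    by (intro continuous_intros) (auto intro: continuous_on_product_coordinates continuous_on_subset)
  ultimately obtain v where v: "v \<in> S" and max: "\<And>w. w \<in> S \<Longrightarrow> qform N a w \<le> qform N a v"
    using continuous_attains_sup[of S "qform N a"] compact_sphere_nat[of N, folded S_def] by blast
  define k where "k = qform N a v"
  have v1: "(\<Sum>i<N. (v i)\<^sup>2) = 1" using v by (simp add: S_iff)
  have top: "qform N a w \<le> k * (\<Sum>i<N. (w i)\<^sup>2)" for w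
  proof (cases "(\<Sum>i<N. (w i)\<^sup>2) = 0")
    case True
    then have "w i = 0" if "i < N" for i
      using that by (simp add: sum_nonneg_eq_0_iff)
    then show ?thesis by (simp add: qform_def)
  next
    case False
    define n where "n = sqrt (\<Sum>i<N. (w i)\<^sup>2)"
    have n: "n > 0" "n\<^sup>2 = (\<Sum>i<N. (w i)\<^sup>2)"
      using False by (auto simp: n_def sum_nonneg order.not_eq_order_implies_strict)
    define u where "u i = (if i < N then w i / n else 0)" for i
    have "(\<Sum>i<N. (u i)\<^sup>2) = (\<Sum>i<N. (w i)\<^sup>2) / n\<^sup>2"
      unfolding u_def sum_divide_distrib by (intro sum.cong) (auto simp: power_divide)
    then have "u \<in> S" using n by (auto simp: u_def S_iff)
    then have "qform N a u \<le> k" unfolding k_def by (rule max)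
    moreover have "qform N a u = qform N a w / n\<^sup>2"
      unfolding qform_def u_def sum_divide_distrib by (intro sum.cong) (auto simp: power2_eq_square)
    ultimately show ?thesis unfolding n(2)[symmetric] using n(1) by (simp add: pos_divide_le_eq)
  qed
  have "(\<Sum>j<N. a i j * v j) = k * v i" if i: "i < N" for i
  proof -
    define w where "w = (\<lambda>j. if j = i then 1 else 0 :: real)"
    define b where "b = k * v i - (\<Sum>j<N. a i j * v j)"
    have sel: "(\<Sum>j<N. f j * w j) = f i" for f
      using i by (simp add: w_def if_distrib cong: if_cong)
    \<comment> \<open>Moving \<open>v\<close> by \<open>t\<close> along the i-th unit vector keeps
      the form below \<open>k\<close> times the squared norm. Both sides agree at
      \<open>t = 0\<close>, so the linear coefficient of their difference has to vanish; it is
      \<open>2 * b\<close>.\<close>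
    have "b = 0"
    proof (rule linear_coeff_zero)
      fix t
      have sq: "(\<Sum>j<N. (v j + t * w j)\<^sup>2) = 1 + 2 * t * v i + t\<^sup>2 * (\<Sum>j<N. (w j)\<^sup>2)"
      proof -
        have "(\<Sum>j<N. (v j + t * w j)\<^sup>2) = (\<Sum>j<N. (v j)\<^sup>2) + 2 * t * (\<Sum>j<N. v j * w j) + t\<^sup>2 * (\<Sum>j<N. (w j)\<^sup>2)"
          unfolding sum_distrib_left sum.distrib[symmetric]
          by (intro sum.cong refl) (simp add: power2_eq_square algebra_simps)
        then show ?thesis by (simp add: v1 sel)
      qed
      have "(\<Sum>i<N. \<Sum>j<N. a i j * v j * w i) = (\<Sum>j<N. a i j * v j)"
        using sel[of "\<lambda>i. \<Sum>j<N. a i j * v j"] by (simp add: sum_distrib_right)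
      then have "k + 2 * t * (\<Sum>j<N. a i j * v j) + t\<^sup>2 * qform N a w
          \<le> k * (1 + 2 * t * v i + t\<^sup>2 * (\<Sum>j<N. (w j)\<^sup>2))"
        using top[of "\<lambda>i. v i + t * w i"] qform_add[of N a v t w, OF sym] unfolding sq by (simp add: k_def)
      then show "0 \<le> 2 * t * b + t\<^sup>2 * (k * (\<Sum>j<N. (w j)\<^sup>2) - qform N a w)"
        by (simp add: b_def algebra_simps)
    qed (use top[of w] in simp)
    then show ?thesis by (simp add: b_def)
  qed
  with v1 top show ?thesis by (intro that)
qed

lemma eigenvalue_mat_iff:
  fixes a :: "nat \<Rightarrow> nat \<Rightarrow> real"
  shows "eigenvalue (mat N N (\<lambda>(i, j). a i j)) k \<longleftrightarrow>
     (\<exists>v. (\<exists>i<N. v i \<noteq> 0) \<and> (\<forall>i<N. (\<Sum>j<N. a i j * v j) = k * v i))"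
proof
  assume "eigenvalue (mat N N (\<lambda>(i, j). a i j)) k"
  then obtain x where x: "x \<in> carrier_vec N" "x \<noteq> 0\<^sub>v N" and
    eq: "mat N N (\<lambda>(i, j). a i j) *\<^sub>v x = k \<cdot>\<^sub>v x"
    by (auto simp: eigenvalue_def eigenvector_def)
  have "\<exists>i<N. x $ i \<noteq> 0" using x by (auto intro!: eq_vecI)
  moreover have "(\<Sum>j<N. a i j * x $ j) = k * x $ i" if "i < N" for i
  proof -
    have "(mat N N (\<lambda>(i, j). a i j) *\<^sub>v x) $ i = (k \<cdot>\<^sub>v x) $ i" by (simp only: eq)
    then show ?thesis
      using that x by (simp add: scalar_prod_def atLeast0LessThan)
  qed
  ultimately show "\<exists>v. (\<exists>i<N. v i \<noteq> 0) \<and> (\<forall>i<N. (\<Sum>j<N. a i j * v j) = k * v i)"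
    by (intro exI[of _ "\<lambda>i. x $ i"]) auto
next
  assume "\<exists>v. (\<exists>i<N. v i \<noteq> 0) \<and> (\<forall>i<N. (\<Sum>j<N. a i j * v j) = k * v i)"
  then obtain v i where v: "i < N" "v i \<noteq> 0" "\<And>i. i < N \<Longrightarrow> (\<Sum>j<N. a i j * v j) = k * v i" by blast
  have "vec N v $ i \<noteq> 0\<^sub>v N $ i" using v by simp
  then have "vec N v \<noteq> 0\<^sub>v N" by auto
  moreover have "mat N N (\<lambda>(i, j). a i j) *\<^sub>v vec N v = k \<cdot>\<^sub>v vec N v"
    using v(3) by (intro eq_vecI) (auto simp: scalar_prod_def atLeast0LessThan)
  ultimately have "eigenvector (mat N N (\<lambda>(i, j). a i j)) (vec N v) k"
    by (simp add: eigenvector_def)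
  then show "eigenvalue (mat N N (\<lambda>(i, j). a i j)) k"
    unfolding eigenvalue_def by blast
qed

text \<open>The maximal Rayleigh quotient lies in the spectrum and dominates every eigenvalue, so it
  is the \<open>Max\<close>. The right-hand side is a family of conditions linear in
  \<open>a\<close>, and only this form of the eigenvalue bound is used afterwards.\<close>

lemma largest_eigenvalue_le_iff:
  fixes a :: "nat \<Rightarrow> nat \<Rightarrow> real"
  assumes sym: "\<And>i j. i < N \<Longrightarrow> j < N \<Longrightarrow> a i j = a j i" and N: "N \<ge> 1"
  shows "largest_eigenvalue (mat N N (\<lambda>(i, j). a i j)) \<le> c \<longleftrightarrow> (\<forall>w. qform N a w \<le> c * (\<Sum>i<N. (w i)\<^sup>2))"
proof -
  let ?A = "mat N N (\<lambda>(i, j). a i j)"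
  obtain k v where v1: "(\<Sum>i<N. (v i)\<^sup>2) = 1" and ev: "\<And>i. i < N \<Longrightarrow> (\<Sum>j<N. a i j * v j) = k * v i"
    and top: "\<And>w. qform N a w \<le> k * (\<Sum>i<N. (w i)\<^sup>2)"
    by (rule symmetric_top_eigenpair[of N a, OF sym N], assumption+) (rule that)
  have "\<exists>i<N. v i \<noteq> 0"
  proof (rule ccontr)
    assume "\<not> (\<exists>i<N. v i \<noteq> 0)"
    then have "(\<Sum>i<N. (v i)\<^sup>2) = 0" by (intro sum.neutral) auto
    then show False using v1 by simp
  qed
  then have k: "k \<in> spectrum ?A"
    unfolding spectrum_def using ev by (auto simp: eigenvalue_mat_iff)
  have fin: "finite (spectrum ?A)"
    by (rule card_finite_spectrum(1)[of _ N]) auto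
  have kmax: "l \<le> k" if "l \<in> spectrum ?A" for l
  proof -
    from that obtain w i where w: "i < N" "w i \<noteq> 0" and ew: "\<And>i. i < N \<Longrightarrow> (\<Sum>j<N. a i j * w j) = l * w i"
      unfolding spectrum_def by (auto simp: eigenvalue_mat_iff)
    have "qform N a w = (\<Sum>i<N. w i * (\<Sum>j<N. a i j * w j))"
      unfolding qform_def sum_distrib_left by (intro sum.cong) auto
    also have "\<dots> = (\<Sum>i<N. l * (w i)\<^sup>2)"
      by (intro sum.cong) (auto simp: ew power2_eq_square)
    also have "\<dots> = l * (\<Sum>i<N. (w i)\<^sup>2)" by (simp add: sum_distrib_left)
    finally have "l * (\<Sum>i<N. (w i)\<^sup>2) \<le> k * (\<Sum>i<N. (w i)\<^sup>2)" using top[of w] by simp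
    moreover have "(\<Sum>i<N. (w i)\<^sup>2) > 0" using w by (intro sum_pos2[of _ i]) auto
    ultimately show ?thesis by simp
  qed
  have "largest_eigenvalue ?A = k"
    unfolding largest_eigenvalue_def using fin k kmax by (intro Max_eqI) auto
  moreover have kc: "k \<le> c \<longleftrightarrow> (\<forall>w. qform N a w \<le> c * (\<Sum>i<N. (w i)\<^sup>2))"
  proof
    assume kc: "k \<le> c"
    show "\<forall>w. qform N a w \<le> c * (\<Sum>i<N. (w i)\<^sup>2)"
    proof
      fix w :: "nat \<Rightarrow> real"
      have "k * (\<Sum>i<N. (w i)\<^sup>2) \<le> c * (\<Sum>i<N. (w i)\<^sup>2)"
        using kc by (intro mult_right_mono sum_nonneg) auto
      with top[of w] show "qform N a w \<le> c * (\<Sum>i<N. (w i)\<^sup>2)" by linarith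
    qed
  next
    assume *: "\<forall>w. qform N a w \<le> c * (\<Sum>i<N. (w i)\<^sup>2)"
    have "qform N a v = (\<Sum>i<N. v i * (\<Sum>j<N. a i j * v j))"
      unfolding qform_def sum_distrib_left by (intro sum.cong) auto
    also have "\<dots> = (\<Sum>i<N. k * (v i)\<^sup>2)"
      by (intro sum.cong) (auto simp: ev power2_eq_square)
    also have "\<dots> = k * (\<Sum>i<N. (v i)\<^sup>2)" by (simp add: sum_distrib_left)
    finally show "k \<le> c" using *[rule_format, of v] v1 by simp
  qed
  ultimately show ?thesis by (simp only: kc)
qed

text \<open>Membership in \<open>configs (pairs N)\<close> rules out loops and reversed pairs, so
  every edge of the symmetrized relation stems from a single coin and the adjacency entries are read
  off by \<open>edge\<close>.\<close>

lemma largest_eigenvalue_laplacian_le_iff: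
  fixes \<omega> :: "nat \<times> nat \<Rightarrow> bool"
  assumes \<omega>: "\<omega> \<in> configs (pairs N)" and N: "N \<ge> 1"
  shows "largest_eigenvalue (laplacian_mat N (\<lambda>i j. \<omega> (i, j) \<or> \<omega> (j, i))) \<le> c \<longleftrightarrow>
     (\<forall>v. (\<Sum>(i, j)\<in>pairs N. of_bool (\<omega> (i, j)) * (v i - v j)\<^sup>2) \<le> c * (\<Sum>i<N. (v i)\<^sup>2))"
proof -
  define E where "E i j = (\<omega> (i, j) \<or> \<omega> (j, i))" for i j
  define x where "x i j = (of_bool (E i j) :: real)" for i j
  define a where "a i j = (if i = j then \<Sum>k<N. x i k else 0) - x i j" for i j
  have out: "\<not> \<omega> (i, j)" if "(i, j) \<notin> pairs N" for i j
    using \<omega> that by (auto simp: configs_def PiE_dflt_def)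
  have x_edge: "x i j = of_bool (\<omega> (edge i j))" for i j
    using out[of i j] out[of j i] by (auto simp: x_def E_def edge_def pairs_def min_def max_def)
  have xsym: "x i j = x j i" for i j by (simp add: x_edge edge_commute)
  have "laplacian_mat N E = mat N N (\<lambda>(i, j). a i j)"
    by (intro eq_matI) (auto simp: laplacian_mat_def degree_mat_def adjacency_mat_def a_def x_def
        Int_def lessThan_def sum.If_cases of_bool_def)
  moreover have "qform N a v = (\<Sum>(i, j)\<in>pairs N. of_bool (\<omega> (i, j)) * (v i - v j)\<^sup>2)" for v
  proof -
    have "(\<Sum>(i, j)\<in>pairs N. of_bool (\<omega> (i, j)) * (v i - v j)\<^sup>2) = (\<Sum>i<N. \<Sum>j<N. x i j * (v i - v j)\<^sup>2) / 2"
      unfolding x_edge by (rule sum_pairs_edge[of "\<lambda>e. of_bool (\<omega> e)"])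
    also have "\<dots> = (\<Sum>i<N. (\<Sum>j<N. x i j) * (v i)\<^sup>2) - (\<Sum>i<N. \<Sum>j<N. x i j * v i * v j)"
      by (rule symmetric_form_expand) (rule xsym)
    also have "(\<Sum>i<N. (\<Sum>j<N. x i j) * (v i)\<^sup>2) = (\<Sum>i<N. \<Sum>j<N. (if i = j then \<Sum>k<N. x i k else 0) * v i * v j)"
      by (intro sum.cong refl) (simp add: if_distrib[of "\<lambda>y. y * _ * _"] power2_eq_square cong: if_cong)
    finally show ?thesis
      unfolding qform_def a_def by (simp add: left_diff_distrib sum_subtractf)
  qed
  moreover have "a i j = a j i" for i j by (auto simp: a_def xsym)
  ultimately show ?thesis
    using largest_eigenvalue_le_iff[of N a c] N unfolding E_def[abs_def] by simp
qed

lemma prob_laplacian_law: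
  assumes N: "N \<ge> 1"
  shows "measure_pmf.prob (laplacian_law N r) {x. x / real N \<le> \<beta>} =
     measure_pmf.prob (bernoulli_prod (pairs N) (\<lambda>(i, j). r (real i / real N, real j / real N)))
       {\<omega>. \<forall>v. (\<Sum>(i, j)\<in>pairs N. of_bool (\<omega> (i, j)) * (v i - v j)\<^sup>2) \<le> \<beta> * N * (\<Sum>i<N. (v i)\<^sup>2)}"
proof -
  let ?M = "bernoulli_prod (pairs N) (\<lambda>(i, j). r (real i / real N, real j / real N))"
  have "bernoulli_pmf (case e of (i, j) \<Rightarrow> r (real i / real N, real j / real N))
      = (case e of (i, j) \<Rightarrow> bernoulli_pmf (r (real i / real N, real j / real N)))" for e :: "nat \<times> nat"
    by (cases e) simp
  then have er: "er_graph N r = map_pmf (\<lambda>\<omega> i j. \<omega> (i, j) \<or> \<omega> (j, i)) ?M"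
    unfolding er_graph_def bernoulli_prod_def pairs_def by simp
  show ?thesis
    unfolding laplacian_law_def er map_pmf_comp measure_map_pmf
  proof (rule measure_pmf.finite_measure_eq_AE)
    show "AE \<omega> in measure_pmf ?M.
       (\<omega> \<in> (\<lambda>\<omega>. largest_eigenvalue (laplacian_mat N (\<lambda>i j. \<omega> (i, j) \<or> \<omega> (j, i)))) -` {x. x / real N \<le> \<beta>}) =
       (\<omega> \<in> {\<omega>. \<forall>v. (\<Sum>(i, j)\<in>pairs N. of_bool (\<omega> (i, j)) * (v i - v j)\<^sup>2) \<le> \<beta> * N * (\<Sum>i<N. (v i)\<^sup>2)})"
      unfolding AE_measure_pmf_iff
    proof
      fix \<omega> assume "\<omega> \<in> set_pmf ?M"
      then have \<omega>: "\<omega> \<in> configs (pairs N)" using set_bernoulli_prod[OF finite_pairs] by blast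
      show "(\<omega> \<in> (\<lambda>\<omega>. largest_eigenvalue (laplacian_mat N (\<lambda>i j. \<omega> (i, j) \<or> \<omega> (j, i)))) -` {x. x / real N \<le> \<beta>}) =
       (\<omega> \<in> {\<omega>. \<forall>v. (\<Sum>(i, j)\<in>pairs N. of_bool (\<omega> (i, j)) * (v i - v j)\<^sup>2) \<le> \<beta> * N * (\<Sum>i<N. (v i)\<^sup>2)})"
        using N largest_eigenvalue_laplacian_le_iff[OF \<omega> N, of "\<beta> * N"]
        by (simp add: pos_divide_le_eq)
    qed
  qed auto
qed


section \<open>The unit square as a completed product space\<close>

abbreviation square_prod :: "(real \<times> real) measure" where
  "square_prod \<equiv> unit_leb \<Otimes>\<^sub>M unit_leb"

lemma sets_lebesgue_Times:
  fixes A B :: "real set"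
  assumes A: "A \<in> sets lebesgue" and B: "B \<in> sets lebesgue"
  shows "A \<times> B \<in> sets lebesgue"
    and "emeasure lebesgue (A \<times> B) = emeasure lebesgue A * emeasure lebesgue B"
proof -
  from A obtain A0 NA NA' where A0: "A = A0 \<union> NA" "NA \<subseteq> NA'" "NA' \<in> null_sets lborel" "A0 \<in> sets lborel"
    by (rule sets_completionE)
  from B obtain B0 NB NB' where B0: "B = B0 \<union> NB" "NB \<subseteq> NB'" "NB' \<in> null_sets lborel" "B0 \<in> sets lborel"
    by (rule sets_completionE)
  define Z where "Z = NA' \<times> UNIV \<union> UNIV \<times> NB'"
  have NA': "NA' \<in> sets borel" "emeasure lborel NA' = 0" and NB': "NB' \<in> sets borel" "emeasure lborel NB' = 0"
    using A0(3) B0(3) by auto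
  have prod: "emeasure lborel (S \<times> T) = emeasure lborel S * emeasure lborel T"
    if "S \<in> sets borel" "T \<in> sets borel" for S T :: "real set"
    using lborel.emeasure_pair_measure_Times[of S lborel T] that by (simp add: lborel_prod)
  have Sx: "S \<times> T \<in> sets borel" if "S \<in> sets borel" "T \<in> sets borel" for S T :: "real set"
    using that by (intro borel_Times)
  have "NA' \<times> (UNIV :: real set) \<in> null_sets lborel" "(UNIV :: real set) \<times> NB' \<in> null_sets lborel"
    using NA' NB' by (auto simp: null_sets_def prod Sx)
  then have Z: "Z \<in> null_sets lborel"
    unfolding Z_def by (rule null_sets.Un)
  have eq: "A \<times> B = A0 \<times> B0 \<union> (A \<times> B \<inter> Z)" and sub: "A \<times> B \<inter> Z \<subseteq> Z"
    using A0 B0 by (auto simp: Z_def)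
  have AB0: "A0 \<times> B0 \<in> sets lborel" using A0 B0 Sx by simp
  show S: "A \<times> B \<in> sets lebesgue"
    using eq sub Z AB0 by (rule sets_completionI)
  have null: "A \<times> B \<inter> Z \<in> null_sets lebesgue"
    by (rule null_sets_completion_subset[OF sub null_sets_completionI[OF Z]])
  have nullA: "NA \<in> null_sets lebesgue" and nullB: "NB \<in> null_sets lebesgue"
    using null_sets_completion_subset[OF A0(2) null_sets_completionI[OF A0(3)]]
      null_sets_completion_subset[OF B0(2) null_sets_completionI[OF B0(3)]] by auto
  have "emeasure lebesgue (A \<times> B) = emeasure lebesgue (A0 \<times> B0)"
    using AB0 null by (subst eq, subst emeasure_Un_null_set) auto
  also have "\<dots> = emeasure lborel A0 * emeasure lborel B0"
    using AB0 A0 B0 prod by simp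
  also have "emeasure lborel A0 = emeasure lebesgue A"
    using A0 nullA by (simp add: emeasure_Un_null_set)
  also have "emeasure lborel B0 = emeasure lebesgue B"
    using B0 nullB by (simp add: emeasure_Un_null_set)
  finally show "emeasure lebesgue (A \<times> B) = emeasure lebesgue A * emeasure lebesgue B" .
qed

lemma unit_set_lebesgue [simp]: "{0..1::real} \<in> sets lebesgue" "unit_square \<in> sets lebesgue"
  by (auto intro: sets_lebesgue_Times)

lemma prob_space_unit_leb: "prob_space unit_leb"
  by (rule prob_spaceI) (simp add: emeasure_restrict_space)

interpretation unit_leb: prob_space unit_leb
  by (rule prob_space_unit_leb)

lemma measure_unit_interval [simp]: "measure unit_leb {0..1} = 1"
  using unit_leb.prob_space by simp

interpretation square_prod: pair_prob_space unit_leb unit_leb ..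

lemma sets_unit_leb_iff: "A \<in> sets unit_leb \<longleftrightarrow> A \<subseteq> {0..1} \<and> A \<in> sets lebesgue"
  by (auto simp: sets_restrict_space_iff)

lemma emeasure_unit_leb: "A \<in> sets unit_leb \<Longrightarrow> emeasure unit_leb A = emeasure lebesgue A"
  by (auto simp: emeasure_restrict_space sets_unit_leb_iff)

lemma id_measurable_square: "(\<lambda>p. p) \<in> measurable square_leb square_prod"
proof -
  have "fst \<in> measurable square_leb unit_leb"
  proof (rule measurableI)
    fix A assume A: "A \<in> sets unit_leb"
    then have "fst -` A \<inter> space square_leb = A \<times> {0..1}" by (auto simp: sets_unit_leb_iff)
    then show "fst -` A \<inter> space square_leb \<in> sets square_leb"
      using A sets_lebesgue_Times(1)[of A "{0..1}"] by (auto simp: sets_unit_leb_iff sets_restrict_space_iff)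
  qed auto
  moreover have "snd \<in> measurable square_leb unit_leb"
  proof (rule measurableI)
    fix A assume A: "A \<in> sets unit_leb"
    then have "snd -` A \<inter> space square_leb = {0..1} \<times> A" by (auto simp: sets_unit_leb_iff)
    then show "snd -` A \<inter> space square_leb \<in> sets square_leb"
      using A sets_lebesgue_Times(1)[of "{0..1}" A] by (auto simp: sets_unit_leb_iff sets_restrict_space_iff)
  qed auto
  ultimately have "(\<lambda>p. (fst p, snd p)) \<in> measurable square_leb square_prod"
    by (rule measurable_Pair)
  then show ?thesis by simp
qed

lemma square_prod_eq_distr: "square_prod = distr square_leb square_prod (\<lambda>p. p)"
proof (rule pair_measure_eqI)
  fix A B assume AB: "A \<in> sets unit_leb" "B \<in> sets unit_leb"
  then have "emeasure (distr square_leb square_prod (\<lambda>p. p)) (A \<times> B) = emeasure square_leb (A \<times> B)"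
    by (subst emeasure_distr[OF id_measurable_square])
       (auto simp: sets_unit_leb_iff intro!: arg_cong2[where f = emeasure])
  also have "\<dots> = emeasure lebesgue (A \<times> B)"
    using AB by (subst emeasure_restrict_space) (auto simp: sets_unit_leb_iff)
  also have "\<dots> = emeasure unit_leb A * emeasure unit_leb B"
    using AB by (simp add: sets_lebesgue_Times sets_unit_leb_iff emeasure_restrict_space del: emeasure_completion)
  finally show "emeasure unit_leb A * emeasure unit_leb B = emeasure (distr square_leb square_prod (\<lambda>p. p)) (A \<times> B)" ..
qed (auto intro: unit_leb.sigma_finite_measure_axioms)

lemma space_square_prod: "space square_prod = unit_square"
  by (simp add: space_pair_measure)

lemma square_prod_sets:
  assumes "E \<in> sets square_prod"
  shows "E \<in> sets square_leb" "emeasure square_prod E = emeasure square_leb E"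
proof -
  have E: "E \<subseteq> unit_square" using sets.sets_into_space[OF assms] by (simp add: space_square_prod)
  then have vim: "(\<lambda>p. p) -` E \<inter> space square_leb = E" by auto
  show "E \<in> sets square_leb"
    using measurable_sets[OF id_measurable_square assms] vim by simp
  show "emeasure square_prod E = emeasure square_leb E"
    by (subst square_prod_eq_distr, subst emeasure_distr[OF id_measurable_square assms]) (simp only: vim)
qed

lemma borel_square_prod:
  assumes "S \<in> sets borel"
  shows "S \<inter> unit_square \<in> sets square_prod"
proof -
  have id1: "(\<lambda>x. x) \<in> measurable unit_leb borel"
    by (intro measurable_restrict_space1 measurable_completion) simp
  have "(\<lambda>p. (fst p, snd p)) \<in> measurable square_prod (borel \<Otimes>\<^sub>M borel)"
    by (intro measurable_Pair measurable_compose[OF measurable_fst id1] measurable_compose[OF measurable_snd id1])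
  then have "(\<lambda>p. p) \<in> measurable square_prod borel" by (simp add: borel_prod)
  from measurable_sets[OF this assms] show ?thesis by (simp add: space_square_prod Int_def)
qed

text \<open>Fubini's theorem lives on the product sigma-algebra, graphons on the larger Lebesgue
  sigma-algebra of the square. The two measures agree on rectangles and therefore on product sets;
  Borel subsets of the square are product sets, and null sets correspond. Every graphon thus has an
  almost everywhere equal version that is product measurable.\<close>

theorem square_leb_eq_completion: "square_leb = completion square_prod"
proof (rule measure_eqI)
  show sets: "sets square_leb = sets (completion square_prod)"
  proof (intro equalityI subsetI)
    fix A assume "A \<in> sets square_leb"
    then have A: "A \<subseteq> unit_square" "A \<in> sets lebesgue" by (auto simp: sets_restrict_space_iff)
    from A(2) obtain S N N' where S: "A = S \<union> N" "N \<subseteq> N'" "N' \<in> null_sets lborel" "S \<in> sets lborel"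
      by (rule sets_completionE)
    have N': "N' \<inter> unit_square \<in> sets square_prod" using S(3) by (intro borel_square_prod) auto
    have "emeasure square_prod (N' \<inter> unit_square) = emeasure lebesgue (N' \<inter> unit_square)"
      using square_prod_sets[OF N'] by (simp add: emeasure_restrict_space)
    also have "\<dots> = 0"
    proof -
      have "N' \<in> null_sets lebesgue" using S(3) by (rule null_sets_completionI)
      then have "N' \<inter> unit_square \<in> null_sets lebesgue"
        by (rule null_sets_completion_subset[rotated]) auto
      then show ?thesis by auto
    qed
    finally have "N' \<inter> unit_square \<in> null_sets square_prod" using N' by auto
    moreover have "A = (S \<inter> unit_square) \<union> N" using S A by auto
    moreover have "N \<subseteq> N' \<inter> unit_square" using S A by auto
    moreover have "S \<inter> unit_square \<in> sets square_prod" using S by (intro borel_square_prod) auto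
    ultimately show "A \<in> sets (completion square_prod)" by (intro sets_completionI)
  next
    fix A assume "A \<in> sets (completion square_prod)"
    then obtain S N N' where S: "A = S \<union> N" "N \<subseteq> N'" "N' \<in> null_sets square_prod" "S \<in> sets square_prod"
      by (rule sets_completionE)
    have "N' \<in> null_sets square_leb"
      using S(3) square_prod_sets[of N'] by (auto simp: null_sets_def)
    then have "N \<in> null_sets lebesgue" "N \<subseteq> unit_square"
      using S(2) null_sets_completion_subset[of N N'] by (auto simp: null_sets_restrict_space)
    then have "N \<in> sets square_leb" by (auto simp: sets_restrict_space_iff)
    then show "A \<in> sets square_leb"
      using S square_prod_sets[of S] by auto
  qed
  fix A assume "A \<in> sets square_leb"
  then have A: "A \<in> sets (completion square_prod)" using sets by simp
  then obtain S N N' where S: "A = S \<union> N" "N \<subseteq> N'" "N' \<in> null_sets square_prod" "S \<in> sets square_prod"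
    by (rule sets_completionE)
  have N: "N \<in> null_sets (completion square_prod)"
    by (rule null_sets_completion_subset[OF S(2) null_sets_completionI[OF S(3)]])
  have N2: "N' \<in> null_sets square_leb"
    using S(3) square_prod_sets[of N'] by (auto simp: null_sets_def)
  moreover have "N \<in> sets square_leb" using N sets by auto
  ultimately have N3: "N \<in> null_sets square_leb" using S(2) by (intro null_sets_subset[OF N2])
  have "emeasure square_leb A = emeasure square_leb S"
    unfolding S(1) using N3 S(4) square_prod_sets by (intro emeasure_Un_null_set) auto
  also have "\<dots> = emeasure square_prod S" using S(4) square_prod_sets by simp
  also have "\<dots> = emeasure (completion square_prod) S" using S(4) by simp
  also have "\<dots> = emeasure (completion square_prod) A"
    unfolding S(1) using N S(4) by (intro emeasure_Un_null_set[symmetric]) auto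
  finally show "emeasure square_leb A = emeasure (completion square_prod) A" .
qed

lemma AE_square_leb_iff: "(AE p in square_leb. P p) \<longleftrightarrow> (AE p in square_prod. P p)"
  unfolding square_leb_eq_completion by (rule AE_completion_iff)

lemma integral_square_leb:
  fixes f :: "_ \<Rightarrow> real"
  assumes "f \<in> borel_measurable square_prod"
  shows "integral\<^sup>L square_leb f = integral\<^sup>L square_prod f"
    and "integrable square_leb f \<longleftrightarrow> integrable square_prod f"
  unfolding square_leb_eq_completion using assms by (rule integral_completion, rule integrable_completion)

lemma borel_measurable_square_lebI: "f \<in> borel_measurable square_prod \<Longrightarrow> f \<in> borel_measurable square_leb"
  unfolding square_leb_eq_completion by (rule measurable_completion)

lemma ex_borel_measurable_square_prod:
  fixes h :: "_ \<Rightarrow> real"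
  assumes "h \<in> borel_measurable square_leb"
  obtains h0 where "h0 \<in> borel_measurable square_prod" "AE p in square_leb. h p = h0 p"
  using completion_ex_borel_measurable_real[OF assms[unfolded square_leb_eq_completion]]
  by (elim bexE) (rule that, simp_all only: AE_square_leb_iff)

lemma prob_space_square_leb: "prob_space square_leb"
  by (rule prob_spaceI)
     (use square_prod_sets(2)[of unit_square] square_prod.P.emeasure_space_1 sets.top[of square_prod]
      in \<open>simp add: space_square_prod\<close>)

interpretation square_leb: prob_space square_leb
  by (rule prob_space_square_leb)

lemma measure_unit_square [simp]: "measure square_leb unit_square = 1"
  using square_leb.prob_space by simp

lemma fst_measurable_square [measurable]: "fst \<in> measurable square_leb unit_leb"
  using measurable_compose[OF id_measurable_square measurable_fst] by simp

lemma snd_measurable_square [measurable]: "snd \<in> measurable square_leb unit_leb"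
  using measurable_compose[OF id_measurable_square measurable_snd] by simp

text \<open>A map that preserves the product measure pulls null sets back to null sets, so it stays
  measurable and measure preserving after completion. The two instances are the exchange of
  coordinates and a map of the interval acting on both coordinates.\<close>

lemma square_leb_preserving:
  assumes m: "T \<in> measurable square_prod square_prod" and d: "distr square_prod square_prod T = square_prod"
  shows "T \<in> measurable square_leb square_leb" "distr square_leb square_leb T = square_leb"
proof -
  have m': "T \<in> measurable (completion square_prod) square_prod" using m by (rule measurable_completion)
  have d': "distr (completion square_prod) square_prod T = square_prod"
    using distr_completion[OF m] d by simp
  show "T \<in> measurable square_leb square_leb"
    unfolding square_leb_eq_completion
    using m' by (rule completion.measurable_completion2) (simp add: d')
  show "distr square_leb square_leb T = square_leb"
    unfolding square_leb_eq_completion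
    using completion.completion_distr_eq[OF m'] d' by simp
qed

lemma swap_square_leb:
  "(\<lambda>p. (snd p, fst p)) \<in> measurable square_leb square_leb"
  "distr square_leb square_leb (\<lambda>p. (snd p, fst p)) = square_leb"
proof -
  have "distr square_prod square_prod (\<lambda>p. (snd p, fst p)) = square_prod"
    using square_prod.distr_pair_swap by (simp add: case_prod_unfold)
  moreover have "(\<lambda>p. (snd p, fst p)) \<in> measurable square_prod square_prod"
    by measurable
  ultimately show "(\<lambda>p. (snd p, fst p)) \<in> measurable square_leb square_leb"
    "distr square_leb square_leb (\<lambda>p. (snd p, fst p)) = square_leb"
    by (rule square_leb_preserving[rotated])+
qed

lemma integral_square_swap:
  fixes f :: "_ \<Rightarrow> real"
  assumes "f \<in> borel_measurable square_leb"
  shows "integral\<^sup>L square_leb f = (LINT p|square_leb. f (snd p, fst p))"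
  using integral_distr[OF swap_square_leb(1) assms] by (simp add: swap_square_leb(2))

definition mp_maps :: "(real \<Rightarrow> real) set" where
  "mp_maps = {\<phi>. \<phi> \<in> measurable unit_leb unit_leb \<and> distr unit_leb unit_leb \<phi> = unit_leb}"

lemma mp_bijections_subset: "\<phi> \<in> mp_bijections \<Longrightarrow> \<phi> \<in> mp_maps"
  by (simp add: mp_maps_def mp_bijections_def)

lemma id_mp_bijection: "(\<lambda>x. x) \<in> mp_bijections"
  by (auto simp: mp_bijections_def bij_betw_def)

lemma mp_square:
  assumes "\<phi> \<in> mp_maps"
  shows "(\<lambda>(x, y). (\<phi> x, \<phi> y)) \<in> measurable square_leb square_leb"
    and "distr square_leb square_leb (\<lambda>(x, y). (\<phi> x, \<phi> y)) = square_leb"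
proof -
  have m: "\<phi> \<in> measurable unit_leb unit_leb" and d: "distr unit_leb unit_leb \<phi> = unit_leb"
    using assms by (auto simp: mp_maps_def)
  have "distr square_prod square_prod (\<lambda>(x, y). (\<phi> x, \<phi> y)) = square_prod"
    using pair_measure_distr[OF m m] d unit_leb.sigma_finite_measure_axioms by simp
  moreover have "(\<lambda>(x, y). (\<phi> x, \<phi> y)) \<in> measurable square_prod square_prod"
    using m by measurable
  ultimately show "(\<lambda>(x, y). (\<phi> x, \<phi> y)) \<in> measurable square_leb square_leb"
    "distr square_leb square_leb (\<lambda>(x, y). (\<phi> x, \<phi> y)) = square_leb"
    by (rule square_leb_preserving[rotated])+
qed

lemma rearrange_eq: "rearrange h \<phi> p = h (case p of (x, y) \<Rightarrow> (\<phi> x, \<phi> y))"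
  by (simp add: rearrange_def case_prod_unfold)

lemma integral_mp_square:
  fixes f :: "_ \<Rightarrow> real"
  assumes "\<phi> \<in> mp_maps" "f \<in> borel_measurable square_leb"
  shows "(LINT p|square_leb. f (case p of (x, y) \<Rightarrow> (\<phi> x, \<phi> y))) = integral\<^sup>L square_leb f"
  using integral_distr[OF mp_square(1)[OF assms(1)] assms(2)] by (simp add: mp_square(2)[OF assms(1)])

lemma rearrange_measurable:
  assumes "\<phi> \<in> mp_maps" "h \<in> borel_measurable square_leb"
  shows "rearrange h \<phi> \<in> borel_measurable square_leb"
  unfolding rearrange_eq[abs_def] by (rule measurable_compose[OF mp_square(1)[OF assms(1)] assms(2)])

lemma mp_maps_range: "\<phi> \<in> mp_maps \<Longrightarrow> x \<in> {0..1} \<Longrightarrow> \<phi> x \<in> {0..1}"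
  using measurable_space[of \<phi> unit_leb unit_leb x] by (simp add: mp_maps_def)

lemma rearrange_graphon:
  assumes "\<phi> \<in> mp_maps" "h \<in> graphons"
  shows "rearrange h \<phi> \<in> graphons"
  using assms rearrange_measurable[of \<phi> h] mp_maps_range[OF assms(1)]
  by (auto simp: graphons_def rearrange_def)

lemma complete_unit_leb: "complete_measure unit_leb"
proof
  fix A B :: "real set" assume "B \<subseteq> A" "A \<in> null_sets unit_leb"
  then have "B \<in> null_sets lebesgue" "B \<subseteq> {0..1}"
    using null_sets_completion_subset[of B A] by (auto simp: null_sets_restrict_space)
  then show "B \<in> sets unit_leb" by (auto simp: sets_unit_leb_iff)
qed

text \<open>Needed for the image of a function under the Laplacian operator, which Fubini's theorem
  identifies only almost everywhere with a measurable function.\<close>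

lemma (in complete_measure) measurable_AE_eq:
  fixes f g :: "'a \<Rightarrow> real"
  assumes g: "g \<in> borel_measurable M" and eq: "AE x in M. f x = g x"
  shows "f \<in> borel_measurable M"
proof (rule measurableI)
  fix S :: "real set" assume S: "S \<in> sets borel"
  have "AE x in M. x \<in> f -` S \<inter> space M \<longleftrightarrow> x \<in> g -` S \<inter> space M"
    using eq by eventually_elim simp
  then show "f -` S \<inter> space M \<in> sets M"
    using in_sets_AE[of "g -` S \<inter> space M" "f -` S \<inter> space M"] measurable_sets[OF g S]
    by (simp add: eq_commute)
qed simp


section \<open>The norm of the Laplacian operator\<close>

lemma integral_prod_mult:
  fixes f g :: "real \<Rightarrow> real"
  assumes f: "integrable unit_leb f" and g: "integrable unit_leb g"
  shows "integrable square_leb (\<lambda>p. f (fst p) * g (snd p))"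
    and "(LINT p|square_leb. f (fst p) * g (snd p)) = integral\<^sup>L unit_leb f * integral\<^sup>L unit_leb g"
proof -
  have [measurable]: "f \<in> borel_measurable unit_leb" "g \<in> borel_measurable unit_leb" using f g by auto
  have m: "(\<lambda>p. f (fst p) * g (snd p)) \<in> borel_measurable square_prod" by measurable
  have int: "integrable square_prod (\<lambda>p. f (fst p) * g (snd p))"
  proof (rule square_prod.Fubini_integrable[OF m])
    have "integrable unit_leb (\<lambda>x. \<bar>f x\<bar> * (LINT y|unit_leb. \<bar>g y\<bar>))"
      using f by simp
    then show "integrable unit_leb (\<lambda>x. LINT y|unit_leb. norm (f (fst (x, y)) * g (snd (x, y))))"
      by (simp add: abs_mult del: integrable_mult_left_iff)
    show "AE x in unit_leb. integrable unit_leb (\<lambda>y. f (fst (x, y)) * g (snd (x, y)))"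
      using g by simp
  qed
  then show "integrable square_leb (\<lambda>p. f (fst p) * g (snd p))" by (simp add: integral_square_leb(2)[OF m])
  show "(LINT p|square_leb. f (fst p) * g (snd p)) = integral\<^sup>L unit_leb f * integral\<^sup>L unit_leb g"
    unfolding integral_square_leb(1)[OF m] square_prod.integral_fst'[OF int, symmetric] by simp
qed

lemma L2_fun_measurable: "u \<in> L2_fun \<Longrightarrow> u \<in> borel_measurable unit_leb"
  by (simp add: L2_fun_def)

lemma L2_fun_mult_integrable:
  assumes u: "u \<in> L2_fun" and w: "w \<in> L2_fun"
  shows "integrable unit_leb (\<lambda>x. u x * w x)"
proof (rule Bochner_Integration.integrable_bound[of _ "\<lambda>x. (u x)\<^sup>2 + (w x)\<^sup>2"])
  have "\<bar>a * b\<bar> \<le> a\<^sup>2 + b\<^sup>2" for a b :: real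
  proof -
    have "2 * \<bar>a\<bar> * \<bar>b\<bar> \<le> a\<^sup>2 + b\<^sup>2" using sum_squares_bound[of "\<bar>a\<bar>" "\<bar>b\<bar>"] by simp
    moreover have "0 \<le> \<bar>a\<bar> * \<bar>b\<bar>" by simp
    ultimately show ?thesis unfolding abs_mult by linarith
  qed
  then show "AE x in unit_leb. norm (u x * w x) \<le> norm ((u x)\<^sup>2 + (w x)\<^sup>2)" by simp
qed (use u w in \<open>auto simp: L2_fun_def\<close>)

lemma L2_fun_const: "(\<lambda>x. c) \<in> L2_fun"
  by (simp add: L2_fun_def)

lemma L2_fun_integrable: "u \<in> L2_fun \<Longrightarrow> integrable unit_leb u"
  using L2_fun_mult_integrable[of u "\<lambda>x. 1"] L2_fun_const by simp

lemma L2_fun_scale: "u \<in> L2_fun \<Longrightarrow> (\<lambda>x. c * u x) \<in> L2_fun"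
  by (auto simp: L2_fun_def power_mult_distrib)

lemma L2_norm_sq: "(L2_norm u)\<^sup>2 = (LINT x|unit_leb. (u x)\<^sup>2)"
  by (simp add: L2_norm_def Bochner_Integration.integral_nonneg)

lemma L2_norm_nonneg: "0 \<le> L2_norm u"
  by (simp add: L2_norm_def Bochner_Integration.integral_nonneg)

lemma graphon_measurable: "h \<in> graphons \<Longrightarrow> h \<in> borel_measurable square_leb"
  by (simp add: graphons_def)

lemma graphon_bounds: "h \<in> graphons \<Longrightarrow> p \<in> unit_square \<Longrightarrow> 0 \<le> h p \<and> h p \<le> 1"
  by (auto simp: graphons_def)

lemma graphon_sym: "h \<in> graphons \<Longrightarrow> x \<in> {0..1} \<Longrightarrow> y \<in> {0..1} \<Longrightarrow> h (x, y) = h (y, x)"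
  by (auto simp: graphons_def)

lemma borel_measurable_fst_square [measurable (raw)]:
  "u \<in> borel_measurable unit_leb \<Longrightarrow> (\<lambda>p. u (fst p)) \<in> borel_measurable square_leb"
  by (rule measurable_compose[OF fst_measurable_square])

lemma borel_measurable_snd_square [measurable (raw)]:
  "u \<in> borel_measurable unit_leb \<Longrightarrow> (\<lambda>p. u (snd p)) \<in> borel_measurable square_leb"
  by (rule measurable_compose[OF snd_measurable_square])

text \<open>Twice the inner product of \<open>u\<close> with \<open>laplacian_op h u\<close>,
  symmetrized over the two coordinates (see \<open>laplacian_op_inner\<close>). In this shape it is
  visibly nonnegative and monotone in \<open>h\<close>.\<close>

definition lap_form :: "(real \<times> real \<Rightarrow> real) \<Rightarrow> (real \<Rightarrow> real) \<Rightarrow> real" where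
  "lap_form h u = (LINT p|square_leb. h p * (u (fst p) - u (snd p))\<^sup>2)"

lemma integrable_graphon_mult:
  assumes h: "h \<in> graphons" and f: "integrable square_leb f"
  shows "integrable square_leb (\<lambda>p. h p * f p)"
proof (rule Bochner_Integration.integrable_bound[OF f])
  show "AE p in square_leb. norm (h p * f p) \<le> norm (f p)"
  proof (rule AE_I2)
    fix p assume "p \<in> space square_leb"
    then have "0 \<le> h p \<and> h p \<le> 1" using graphon_bounds[OF h] by simp
    then show "norm (h p * f p) \<le> norm (f p)" by (simp add: abs_mult mult_left_le_one_le)
  qed
qed (use graphon_measurable[OF h] f in measurable)

lemma L2_difference_integrable:
  assumes u: "u \<in> L2_fun" and w: "w \<in> L2_fun"
  shows "integrable square_leb (\<lambda>p. (u (fst p) - u (snd p)) * w (fst p))"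
    and "integrable square_leb (\<lambda>p. (u (fst p) - u (snd p)) * w (snd p))"
    and "integrable square_leb (\<lambda>p. (u (fst p) - u (snd p)) * (w (fst p) - w (snd p)))"
proof -
  note uw = L2_fun_mult_integrable[OF u w] and ui = L2_fun_integrable[OF u] and wi = L2_fun_integrable[OF w]
  show a: "integrable square_leb (\<lambda>p. (u (fst p) - u (snd p)) * w (fst p))"
    using Bochner_Integration.integrable_diff[OF integral_prod_mult(1)[OF uw, of "\<lambda>_. 1"] integral_prod_mult(1)[OF wi ui]]
    by (simp add: left_diff_distrib mult.commute[of "w _"])
  show b: "integrable square_leb (\<lambda>p. (u (fst p) - u (snd p)) * w (snd p))"
    using Bochner_Integration.integrable_diff[OF integral_prod_mult(1)[OF ui wi] integral_prod_mult(1)[OF _ uw, of "\<lambda>_. 1"]]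
    by (simp add: left_diff_distrib)
  show "integrable square_leb (\<lambda>p. (u (fst p) - u (snd p)) * (w (fst p) - w (snd p)))"
    using Bochner_Integration.integrable_diff[OF a b] by (simp add: algebra_simps)
qed

lemma lap_form_integrable:
  assumes "h \<in> graphons" "u \<in> L2_fun"
  shows "integrable square_leb (\<lambda>p. h p * (u (fst p) - u (snd p))\<^sup>2)"
  using integrable_graphon_mult[OF assms(1) L2_difference_integrable(3)[OF assms(2) assms(2)]]
  by (simp add: power2_eq_square)

lemma integral_diff_squared_le:
  assumes u: "u \<in> L2_fun"
  shows "(LINT p|square_leb. (u (fst p) - u (snd p))\<^sup>2) \<le> 4 * (LINT x|unit_leb. (u x)\<^sup>2)"
    and "integrable square_leb (\<lambda>p. 2 * (u (fst p))\<^sup>2 + 2 * (u (snd p))\<^sup>2)"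
proof -
  have u2: "integrable unit_leb (\<lambda>x. (u x)\<^sup>2)" using u by (simp add: L2_fun_def)
  have c: "integrable unit_leb (\<lambda>_. 1 :: real)" by simp
  have a: "integrable square_leb (\<lambda>p. (u (fst p))\<^sup>2)" "(LINT p|square_leb. (u (fst p))\<^sup>2) = (LINT x|unit_leb. (u x)\<^sup>2)"
    using integral_prod_mult[OF u2 c] by simp_all
  have b: "integrable square_leb (\<lambda>p. (u (snd p))\<^sup>2)" "(LINT p|square_leb. (u (snd p))\<^sup>2) = (LINT x|unit_leb. (u x)\<^sup>2)"
    using integral_prod_mult[OF c u2] by simp_all
  show i: "integrable square_leb (\<lambda>p. 2 * (u (fst p))\<^sup>2 + 2 * (u (snd p))\<^sup>2)" using a b by simp
  have "(LINT p|square_leb. (u (fst p) - u (snd p))\<^sup>2) \<le> (LINT p|square_leb. 2 * (u (fst p))\<^sup>2 + 2 * (u (snd p))\<^sup>2)"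
  proof (rule integral_mono)
    show "integrable square_leb (\<lambda>p. (u (fst p) - u (snd p))\<^sup>2)"
      using L2_difference_integrable(3)[OF u u] by (simp add: power2_eq_square)
    show "(u (fst p) - u (snd p))\<^sup>2 \<le> 2 * (u (fst p))\<^sup>2 + 2 * (u (snd p))\<^sup>2" for p
      using zero_le_power2[of "u (fst p) + u (snd p)"] by (simp add: power2_eq_square algebra_simps)
  qed (rule i)
  also have "\<dots> = 4 * (LINT x|unit_leb. (u x)\<^sup>2)" using a b by simp
  finally show "(LINT p|square_leb. (u (fst p) - u (snd p))\<^sup>2) \<le> 4 * (LINT x|unit_leb. (u x)\<^sup>2)" .
qed

text \<open>All three facts rest on a product-measurable version \<open>h0\<close> of
  \<open>h\<close>: the operator \<open>T0\<close> built from it is measurable by Fubini and agrees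
  almost everywhere with the one built from \<open>h\<close>.\<close>

lemma laplacian_op_props:
  assumes h: "h \<in> graphons" and u: "u \<in> L2_fun"
  shows laplacian_op_L2: "laplacian_op h u \<in> L2_fun"
    and laplacian_op_bound: "(LINT x|unit_leb. (laplacian_op h u x)\<^sup>2) \<le> 4 * (LINT x|unit_leb. (u x)\<^sup>2)"
    and laplacian_op_inner: "\<And>w. w \<in> L2_fun \<Longrightarrow> (LINT x|unit_leb. w x * laplacian_op h u x)
       = (LINT p|square_leb. h p * ((u (fst p) - u (snd p)) * (w (fst p) - w (snd p)))) / 2"
proof -
  interpret cU: complete_measure unit_leb by (rule complete_unit_leb)
  have [measurable]: "u \<in> borel_measurable unit_leb" using u by (rule L2_fun_measurable)
  have [measurable]: "h \<in> borel_measurable square_leb" using h by (rule graphon_measurable)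
  obtain h1 where h1 [measurable]: "h1 \<in> borel_measurable square_prod" and h1_eq: "AE p in square_leb. h p = h1 p"
    by (rule ex_borel_measurable_square_prod[OF graphon_measurable[OF h]])
  \<comment> \<open>Clipping makes the bounds 0 and 1 hold at every point, so that the pointwise
    estimates of \<open>T0\<close> carry no exceptional null sets.\<close>
  define h0 where "h0 p = max 0 (min 1 (h1 p))" for p
  have h0 [measurable]: "h0 \<in> borel_measurable square_prod" unfolding h0_def by measurable
  have h0_bd: "0 \<le> h0 p" "h0 p \<le> 1" for p by (auto simp: h0_def)
  have h_eq: "AE p in square_leb. h p = h0 p"
    using h1_eq AE_space
  proof eventually_elim
    case (elim p)
    then have "0 \<le> h p \<and> h p \<le> 1" using graphon_bounds[OF h, of p] by (simp only: space_restrict_space) simp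
    then show ?case using elim(1) by (simp add: h0_def)
  qed
  define T0 where "T0 x = (LINT y|unit_leb. h0 (x, y) * (u x - u y))" for x
  have T0 [measurable]: "T0 \<in> borel_measurable unit_leb" unfolding T0_def by measurable
  have "AE x in unit_leb. AE y in unit_leb. h (x, y) = h0 (x, y)"
    using h_eq unfolding AE_square_leb_iff by (rule square_prod.AE_pair)
  then have T_eq: "AE x in unit_leb. laplacian_op h u x = T0 x"
    using AE_space
  proof eventually_elim
    case (elim x)
    have m: "(\<lambda>y. h0 (x, y) * (u x - u y)) \<in> borel_measurable unit_leb"
      using elim(2) by measurable
    have eq: "AE y in unit_leb. h (x, y) * (u x - u y) = h0 (x, y) * (u x - u y)"
      using elim(1) by eventually_elim simp
    show ?case
      unfolding laplacian_op_def T0_def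
      by (rule integral_cong_AE[OF cU.measurable_AE_eq[OF m eq] m eq])
  qed
  have Tm [measurable]: "laplacian_op h u \<in> borel_measurable unit_leb"
    by (rule cU.measurable_AE_eq[OF T0 T_eq])
  have u2: "integrable unit_leb (\<lambda>x. (u x)\<^sup>2)" using u by (simp add: L2_fun_def)
  have ui: "integrable unit_leb (\<lambda>x. \<bar>u x\<bar>)" using L2_fun_integrable[OF u] by simp
  define U1 U2 where "U1 = (LINT x|unit_leb. \<bar>u x\<bar>)" and "U2 = (LINT x|unit_leb. (u x)\<^sup>2)"
  \<comment> \<open>The variance of \<open>\<bar>u x\<bar>\<close> under the probability measure
    \<open>unit_leb\<close> is nonnegative.\<close>
  have U12: "U1\<^sup>2 \<le> U2"
  proof -
    have "0 \<le> (LINT x|unit_leb. (\<bar>u x\<bar> - U1)\<^sup>2)" by (rule Bochner_Integration.integral_nonneg) simp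
    also have "\<dots> = (LINT x|unit_leb. (u x)\<^sup>2 - 2 * U1 * \<bar>u x\<bar> + U1\<^sup>2)"
      by (simp add: power2_diff mult_ac add.commute add_diff_eq)
    also have "\<dots> = U2 - 2 * U1 * U1 + U1\<^sup>2"
      using u2 ui unit_leb.prob_space by (simp add: U1_def U2_def)
    finally show ?thesis by (simp add: power2_eq_square)
  qed
  have T0_bd: "(T0 x)\<^sup>2 \<le> 2 * (u x)\<^sup>2 + 2 * U2" if x: "x \<in> space unit_leb" for x
  proof -
    have m: "(\<lambda>y. h0 (x, y) * (u x - u y)) \<in> borel_measurable unit_leb"
      using x by measurable
    have pw: "\<bar>h0 (x, y) * (u x - u y)\<bar> \<le> \<bar>u x\<bar> + \<bar>u y\<bar>" for y
    proof -
      have "\<bar>h0 (x, y) * (u x - u y)\<bar> \<le> 1 * \<bar>u x - u y\<bar>"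
        using h0_bd[of "(x, y)"] unfolding abs_mult by (intro mult_right_mono) auto
      also have "\<dots> \<le> \<bar>u x\<bar> + \<bar>u y\<bar>" using abs_triangle_ineq4[of "u x" "u y"] by simp
      finally show ?thesis .
    qed
    have i2: "integrable unit_leb (\<lambda>y. \<bar>u x\<bar> + \<bar>u y\<bar>)" using ui by simp
    have i1: "integrable unit_leb (\<lambda>y. h0 (x, y) * (u x - u y))"
      using pw by (intro Bochner_Integration.integrable_bound[OF i2 m]) auto
    have "\<bar>T0 x\<bar> \<le> (LINT y|unit_leb. \<bar>h0 (x, y) * (u x - u y)\<bar>)"
      unfolding T0_def using integral_abs_bound by simp
    also have "\<dots> \<le> (LINT y|unit_leb. \<bar>u x\<bar> + \<bar>u y\<bar>)"
      using i1 i2 pw by (intro integral_mono) auto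
    also have "\<dots> = \<bar>u x\<bar> + U1" using ui unit_leb.prob_space by (simp add: U1_def)
    finally have "\<bar>T0 x\<bar>\<^sup>2 \<le> (\<bar>u x\<bar> + U1)\<^sup>2" by (intro power_mono) auto
    also have "\<dots> \<le> 2 * (u x)\<^sup>2 + 2 * U1\<^sup>2"
      using zero_le_power2[of "\<bar>u x\<bar> - U1"] by (simp add: power2_sum power2_diff)
    finally show ?thesis using U12 by simp
  qed
  have b2: "integrable unit_leb (\<lambda>x. 2 * (u x)\<^sup>2 + 2 * U2)" using u2 by simp
  have T02: "integrable unit_leb (\<lambda>x. (T0 x)\<^sup>2)"
    by (rule Bochner_Integration.integrable_bound[OF b2]) (use T0_bd in \<open>auto simp: U2_def\<close>)
  have T2eq: "AE x in unit_leb. (laplacian_op h u x)\<^sup>2 = (T0 x)\<^sup>2"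
    using T_eq by eventually_elim simp
  have "integrable unit_leb (\<lambda>x. (laplacian_op h u x)\<^sup>2)"
    using T02 by (subst integrable_cong_AE[OF _ _ T2eq]) auto
  then show L2: "laplacian_op h u \<in> L2_fun" by (simp add: L2_fun_def Tm)
  have "(LINT x|unit_leb. (laplacian_op h u x)\<^sup>2) = (LINT x|unit_leb. (T0 x)\<^sup>2)"
    by (rule integral_cong_AE[OF _ _ T2eq]) auto
  also have "\<dots> \<le> (LINT x|unit_leb. 2 * (u x)\<^sup>2 + 2 * U2)"
    using T0_bd by (intro integral_mono[OF T02 b2]) auto
  also have "\<dots> = 4 * U2" using u2 unit_leb.prob_space by (simp add: U2_def)
  finally show "(LINT x|unit_leb. (laplacian_op h u x)\<^sup>2) \<le> 4 * (LINT x|unit_leb. (u x)\<^sup>2)"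
    by (simp add: U2_def)
  show "(LINT x|unit_leb. w x * laplacian_op h u x)
       = (LINT p|square_leb. h p * ((u (fst p) - u (snd p)) * (w (fst p) - w (snd p)))) / 2"
    if w: "w \<in> L2_fun" for w
  proof -
    have [measurable]: "w \<in> borel_measurable unit_leb" using w by (rule L2_fun_measurable)
    let ?H = "\<lambda>p. h0 p * ((u (fst p) - u (snd p)) * w (fst p))"
    let ?F = "\<lambda>p. h p * ((u (fst p) - u (snd p)) * w (fst p))"
    let ?G = "\<lambda>p. h p * ((u (fst p) - u (snd p)) * w (snd p))"
    have F: "integrable square_leb ?F" and G: "integrable square_leb ?G"
      using integrable_graphon_mult[OF h] L2_difference_integrable[OF u w] by auto
    have F0m: "?H \<in> borel_measurable square_prod" by measurable
    have Feq: "AE p in square_leb. ?F p = ?H p" using h_eq by eventually_elim simp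
    have F0: "integrable square_leb ?H"
      by (rule integrable_cong_AE_imp[OF F borel_measurable_square_lebI[OF F0m] Feq])
    have "AE x in unit_leb. w x * laplacian_op h u x = w x * T0 x"
      using T_eq by eventually_elim simp
    then have "(LINT x|unit_leb. w x * laplacian_op h u x) = (LINT x|unit_leb. w x * T0 x)"
      by (rule integral_cong_AE[rotated 2]) measurable
    moreover have "w x * T0 x = (LINT y|unit_leb. h0 (x, y) * ((u x - u y) * w x))" for x
      unfolding T0_def by (subst Bochner_Integration.integral_mult_right_zero[symmetric]) (simp add: mult_ac)
    moreover have "(LINT x|unit_leb. LINT y|unit_leb. h0 (x, y) * ((u x - u y) * w x)) = integral\<^sup>L square_prod ?H"
      using square_prod.integral_fst'[OF F0[unfolded integral_square_leb(2)[OF F0m]]] by simp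
    moreover have "integral\<^sup>L square_prod ?H = integral\<^sup>L square_leb ?H"
      by (rule integral_square_leb(1)[OF F0m, symmetric])
    moreover have "integral\<^sup>L square_leb ?H = integral\<^sup>L square_leb ?F"
    proof (rule integral_cong_AE[OF borel_measurable_square_lebI[OF F0m]])
      show "AE p in square_leb. ?H p = ?F p" using Feq by eventually_elim (rule sym)
    qed measurable
    ultimately have 1: "(LINT x|unit_leb. w x * laplacian_op h u x) = integral\<^sup>L square_leb ?F"
      by (simp only:)
    have "integral\<^sup>L square_leb ?F = (LINT p|square_leb. ?F (snd p, fst p))"
      by (rule integral_square_swap) measurable
    moreover have "(LINT p|square_leb. ?F (snd p, fst p)) = (LINT p|square_leb. - ?G p)"
    proof (rule Bochner_Integration.integral_cong[OF refl])
      fix p assume "p \<in> space square_leb"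
      then have "h (snd p, fst p) = h p"
        using graphon_sym[OF h, of "fst p" "snd p"] by auto
      then show "?F (snd p, fst p) = - ?G p" by (simp add: algebra_simps)
    qed
    \<comment> \<open>Average with the image under exchange of the coordinates: by symmetry of
      \<open>h\<close> the exchanged integrand is \<open>- ?G\<close>, so the factor
      \<open>w (fst p)\<close> turns into a difference of values of \<open>w\<close>.\<close>
    ultimately have "2 * integral\<^sup>L square_leb ?F = integral\<^sup>L square_leb ?F - integral\<^sup>L square_leb ?G"
      by simp
    also have "\<dots> = (LINT p|square_leb. ?F p - ?G p)" using F G by simp
    also have "\<dots> = (LINT p|square_leb. h p * ((u (fst p) - u (snd p)) * (w (fst p) - w (snd p))))"
      by (simp only: right_diff_distrib)
    finally show ?thesis using 1 by simp
  qed
qed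

text \<open>For a positive semidefinite self-adjoint operator the quadratic form already determines
  the norm. Cauchy-Schwarz for the form, in its additive version, is applied to \<open>u\<close> and
  its image \<open>w\<close>; with \<open>n\<close> the norm of \<open>w\<close> it yields n^2 \<le>
  \<beta> n.\<close>

lemma laplacian_norm_le:
  assumes h: "h \<in> graphons" and \<beta>: "\<beta> \<ge> 0"
    and form: "\<And>u. u \<in> L2_fun \<Longrightarrow> lap_form h u \<le> 2 * \<beta> * (LINT x|unit_leb. (u x)\<^sup>2)"
  shows "laplacian_norm h \<le> \<beta>"
  unfolding laplacian_norm_def L2_opnorm_def
proof (rule cSUP_least)
  show "{u \<in> L2_fun. L2_norm u \<le> 1} \<noteq> {}"
    using L2_fun_const[of 0] by (auto simp: L2_norm_def intro!: exI[of _ "\<lambda>_. 0"])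
  fix u assume "u \<in> {u \<in> L2_fun. L2_norm u \<le> 1}"
  then have u: "u \<in> L2_fun" and u1: "L2_norm u \<le> 1" by auto
  define w where "w = laplacian_op h u"
  have w: "w \<in> L2_fun" unfolding w_def by (rule laplacian_op_L2[OF h u])
  define n where "n = L2_norm w"
  have "n \<le> \<beta>"
  proof (cases "n = 0")
    case False
    then have n: "n > 0" using L2_norm_nonneg[of w] by (simp add: n_def)
    have fi: "integrable square_leb (\<lambda>p. h p * (f (fst p) - f (snd p))\<^sup>2)" if "f \<in> L2_fun" for f
      by (rule lap_form_integrable[OF h that])
    have "n\<^sup>2 = (LINT x|unit_leb. w x * laplacian_op h u x)"
      unfolding n_def L2_norm_sq by (simp add: w_def power2_eq_square)
    also have "\<dots> = (LINT p|square_leb. h p * ((u (fst p) - u (snd p)) * (w (fst p) - w (snd p)))) / 2"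
      by (rule laplacian_op_inner[OF h u w])
    also have "\<dots> \<le> (LINT p|square_leb. n / 2 * (h p * (u (fst p) - u (snd p))\<^sup>2)
         + 1 / (2 * n) * (h p * (w (fst p) - w (snd p))\<^sup>2)) / 2"
    proof (intro divide_right_mono integral_mono)
      show "integrable square_leb (\<lambda>p. h p * ((u (fst p) - u (snd p)) * (w (fst p) - w (snd p))))"
        by (rule integrable_graphon_mult[OF h L2_difference_integrable(3)[OF u w]])
      show "integrable square_leb (\<lambda>p. n / 2 * (h p * (u (fst p) - u (snd p))\<^sup>2)
         + 1 / (2 * n) * (h p * (w (fst p) - w (snd p))\<^sup>2))"
        using fi[OF u] fi[OF w] by (intro Bochner_Integration.integrable_add integrable_mult_right)
      fix p assume "p \<in> space square_leb"
      then have hp: "0 \<le> h p" using graphon_bounds[OF h] by simp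
      \<comment> \<open>The weights \<open>n\<close> and \<open>1 / n\<close> compensate for the
        sizes of the two vectors, \<open>u\<close> of norm at most 1 and \<open>w\<close> of norm
        \<open>n\<close>, so that both terms end up with the same bound.\<close>
      have "a * b \<le> n / 2 * a\<^sup>2 + 1 / (2 * n) * b\<^sup>2" for a b :: real
      proof -
        have "0 \<le> (n * a - b)\<^sup>2 / (2 * n)" using n by simp
        also have "\<dots> = n / 2 * a\<^sup>2 + 1 / (2 * n) * b\<^sup>2 - a * b"
          using n by (simp add: field_simps power2_eq_square)
        finally show ?thesis by simp
      qed
      from mult_left_mono[OF this[of "u (fst p) - u (snd p)" "w (fst p) - w (snd p)"] hp]
      show "h p * ((u (fst p) - u (snd p)) * (w (fst p) - w (snd p)))
         \<le> n / 2 * (h p * (u (fst p) - u (snd p))\<^sup>2) + 1 / (2 * n) * (h p * (w (fst p) - w (snd p))\<^sup>2)"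
        by (simp only: distrib_left mult.left_commute[of "h p"])
    qed simp
    also have "\<dots> = (n / 2 * lap_form h u + 1 / (2 * n) * lap_form h w) / 2"
      using fi[OF u] fi[OF w] by (simp add: lap_form_def)
    also have "\<dots> \<le> (n / 2 * (2 * \<beta> * 1) + 1 / (2 * n) * (2 * \<beta> * n\<^sup>2)) / 2"
    proof (intro divide_right_mono add_mono mult_left_mono)
      have "(LINT x|unit_leb. (u x)\<^sup>2) \<le> 1"
        using u1 L2_norm_nonneg[of u] unfolding L2_norm_sq[symmetric] by (simp add: power_le_one)
      then have "2 * \<beta> * (LINT x|unit_leb. (u x)\<^sup>2) \<le> 2 * \<beta> * 1" using \<beta> by (intro mult_left_mono) auto
      then show "lap_form h u \<le> 2 * \<beta> * 1" using form[OF u] by simp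
      show "lap_form h w \<le> 2 * \<beta> * n\<^sup>2" using form[OF w] by (simp add: n_def L2_norm_sq)
    qed (use n in auto)
    also have "\<dots> = \<beta> * n" using n by (simp add: field_simps power2_eq_square)
    finally show ?thesis using n by (simp add: power2_eq_square)
  qed (use \<beta> in simp)
  then show "L2_norm (laplacian_op h u) \<le> \<beta>" by (simp add: n_def w_def)
qed

lemma laplacian_norm_upper:
  assumes h: "h \<in> graphons" and u: "u \<in> L2_fun" "L2_norm u \<le> 1"
  shows "L2_norm (laplacian_op h u) \<le> laplacian_norm h"
  unfolding laplacian_norm_def L2_opnorm_def
proof (rule cSUP_upper)
  \<comment> \<open>The a priori bound 2 is what makes the supremum in \<open>L2_opnorm\<close> a
    genuine one; for an unbounded set of reals \<open>Sup\<close> has no useful value.\<close>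
  show "bdd_above ((\<lambda>u. L2_norm (laplacian_op h u)) ` {u \<in> L2_fun. L2_norm u \<le> 1})"
  proof (rule bdd_aboveI2)
    fix u assume "u \<in> {u \<in> L2_fun. L2_norm u \<le> 1}"
    then have u: "u \<in> L2_fun" and u1: "L2_norm u \<le> 1" by auto
    have "(L2_norm (laplacian_op h u))\<^sup>2 \<le> 4 * (L2_norm u)\<^sup>2"
      unfolding L2_norm_sq by (rule laplacian_op_bound[OF h u])
    also have "\<dots> \<le> 2\<^sup>2" using u1 L2_norm_nonneg[of u] by (simp add: power_le_one)
    finally show "L2_norm (laplacian_op h u) \<le> 2" by (rule power2_le_imp_le) simp
  qed
qed (use u in simp)

lemma laplacian_norm_nonneg:
  assumes "h \<in> graphons" shows "0 \<le> laplacian_norm h"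
  using laplacian_norm_upper[OF assms L2_fun_const[of 0]] L2_norm_nonneg[of "laplacian_op h (\<lambda>_. 0)"]
  by (simp add: L2_norm_def[of "\<lambda>_. 0"])

lemma lap_form_le_norm:
  assumes h: "h \<in> graphons" and u: "u \<in> L2_fun"
  shows "lap_form h u \<le> 2 * laplacian_norm h * (LINT x|unit_leb. (u x)\<^sup>2)"
proof (cases "L2_norm u = 0")
  case True
  then have "(LINT x|unit_leb. (u x)\<^sup>2) = 0" using L2_norm_sq[of u] by simp
  moreover have "lap_form h u \<le> (LINT p|square_leb. (u (fst p) - u (snd p))\<^sup>2)"
    unfolding lap_form_def
  proof (rule integral_mono[OF lap_form_integrable[OF h u]])
    show "integrable square_leb (\<lambda>p. (u (fst p) - u (snd p))\<^sup>2)"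
      using L2_difference_integrable(3)[OF u u] by (simp add: power2_eq_square)
    fix p assume "p \<in> space square_leb"
    then show "h p * (u (fst p) - u (snd p))\<^sup>2 \<le> (u (fst p) - u (snd p))\<^sup>2"
      using graphon_bounds[OF h, of p] by (intro mult_left_le_one_le) auto
  qed
  ultimately show ?thesis using integral_diff_squared_le(1)[OF u] by simp
next
  case False
  define c where "c = L2_norm u"
  have c: "c > 0" using False L2_norm_nonneg[of u] by (simp add: c_def)
  define v where "v x = 1 / c * u x" for x
  have v: "v \<in> L2_fun" unfolding v_def by (rule L2_fun_scale[OF u])
  have v2: "(LINT x|unit_leb. (v x)\<^sup>2) = 1"
  proof -
    have "(LINT x|unit_leb. (v x)\<^sup>2) = (LINT x|unit_leb. (1 / c)\<^sup>2 * (u x)\<^sup>2)"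
      by (simp only: v_def power_mult_distrib)
    also have "\<dots> = (1 / c)\<^sup>2 * c\<^sup>2" by (simp add: L2_norm_sq c_def)
    finally show ?thesis using c by (simp add: power_divide)
  qed
  then have v1: "L2_norm v \<le> 1" by (simp add: L2_norm_def)
  define w where "w = laplacian_op h v"
  have w: "w \<in> L2_fun" unfolding w_def by (rule laplacian_op_L2[OF h v])
  have wn: "L2_norm w \<le> laplacian_norm h" unfolding w_def by (rule laplacian_norm_upper[OF h v v1])
  \<comment> \<open>The additive Cauchy-Schwarz inequality divides by its weight, and the norm
    itself may be 0. So the weight is \<open>l\<close>, the norm plus an arbitrary positive
    \<open>e\<close>.\<close>
  have "lap_form h v / 2 \<le> laplacian_norm h"
  proof (rule field_le_epsilon)
    fix e :: real assume e: "e > 0"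
    define l where "l = laplacian_norm h + e"
    have l: "l > 0" "L2_norm w \<le> l" using e wn laplacian_norm_nonneg[OF h] by (auto simp: l_def)
    have "lap_form h v / 2 = (LINT x|unit_leb. v x * w x)"
      using laplacian_op_inner[OF h v v] by (simp add: w_def lap_form_def power2_eq_square)
    also have "\<dots> \<le> (LINT x|unit_leb. l / 2 * (v x)\<^sup>2 + 1 / (2 * l) * (w x)\<^sup>2)"
    proof (rule integral_mono[OF L2_fun_mult_integrable[OF v w]])
      show "integrable unit_leb (\<lambda>x. l / 2 * (v x)\<^sup>2 + 1 / (2 * l) * (w x)\<^sup>2)"
        using v w by (intro Bochner_Integration.integrable_add integrable_mult_right) (auto simp: L2_fun_def)
      fix x
      have "0 \<le> (l * v x - w x)\<^sup>2 / (2 * l)" using l by simp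
      also have "\<dots> = l / 2 * (v x)\<^sup>2 + 1 / (2 * l) * (w x)\<^sup>2 - v x * w x"
        using l by (simp add: field_simps power2_eq_square)
      finally show "v x * w x \<le> l / 2 * (v x)\<^sup>2 + 1 / (2 * l) * (w x)\<^sup>2" by simp
    qed
    also have "\<dots> = l / 2 * (LINT x|unit_leb. (v x)\<^sup>2) + 1 / (2 * l) * (LINT x|unit_leb. (w x)\<^sup>2)"
      using v w by (subst Bochner_Integration.integral_add) (auto simp: L2_fun_def)
    also have "\<dots> = l / 2 + 1 / (2 * l) * (L2_norm w)\<^sup>2"
      using v2 by (simp add: L2_norm_sq)
    also have "\<dots> \<le> l / 2 + 1 / (2 * l) * l\<^sup>2"
      using l L2_norm_nonneg[of w] by (intro add_left_mono mult_left_mono power_mono) auto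
    also have "\<dots> = l" using l by (simp add: power2_eq_square)
    finally show "lap_form h v / 2 \<le> laplacian_norm h + e" by (simp add: l_def)
  qed
  moreover have "lap_form h v = lap_form h u / c\<^sup>2"
  proof -
    have "lap_form h v = (LINT p|square_leb. (h p * (u (fst p) - u (snd p))\<^sup>2) * (1 / c\<^sup>2))"
      unfolding lap_form_def v_def right_diff_distrib[symmetric] power_mult_distrib by (simp add: power_divide)
    then show ?thesis unfolding lap_form_def Bochner_Integration.integral_mult_left_zero by simp
  qed
  moreover have "(LINT x|unit_leb. (u x)\<^sup>2) = c\<^sup>2" by (simp add: c_def L2_norm_sq)
  ultimately show ?thesis using c by (simp add: field_simps)
qed


section \<open>Step graphons\<close>

text \<open>Disjointness and the masses force the parts to cover the interval up to a null set
  (\<open>AE_partition\<close>). Exact covering would exclude the half-open blocks, which miss the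
  point 1. Parts need not be intervals, so that preimages of blocks under rearrangements are
  included.\<close>

definition unit_partition :: "nat \<Rightarrow> (nat \<Rightarrow> real set) \<Rightarrow> bool" where
  "unit_partition N A \<longleftrightarrow> (\<forall>i<N. A i \<in> sets unit_leb \<and> measure unit_leb (A i) = 1 / N) \<and>
     disjoint_family_on A {..<N}"

definition cell :: "(nat \<Rightarrow> real set) \<Rightarrow> nat \<Rightarrow> nat \<Rightarrow> real \<times> real \<Rightarrow> real" where
  "cell A i j p = indicator (A i) (fst p) * indicator (A j) (snd p)"

definition step_graphon :: "nat \<Rightarrow> (nat \<Rightarrow> real set) \<Rightarrow> (nat \<Rightarrow> nat \<Rightarrow> real) \<Rightarrow> real \<times> real \<Rightarrow> real" where
  "step_graphon N A q p = (\<Sum>i<N. \<Sum>j<N. q i j * cell A i j p)"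

definition step_fun :: "nat \<Rightarrow> (nat \<Rightarrow> real set) \<Rightarrow> (nat \<Rightarrow> real) \<Rightarrow> real \<Rightarrow> real" where
  "step_fun N A v x = (\<Sum>i<N. v i * indicator (A i) x)"

lemma partition_sets: "unit_partition N A \<Longrightarrow> i < N \<Longrightarrow> A i \<in> sets unit_leb"
  by (simp add: unit_partition_def)

lemma partition_measure: "unit_partition N A \<Longrightarrow> i < N \<Longrightarrow> measure unit_leb (A i) = 1 / N"
  by (simp add: unit_partition_def)

lemma partition_unique:
  assumes "unit_partition N A" "i < N" "j < N" "x \<in> A i" "x \<in> A j"
  shows "i = j"
proof (rule ccontr)
  assume "i \<noteq> j"
  then have "A i \<inter> A j = {}"
    using assms(1-3) unfolding unit_partition_def by (intro disjoint_family_onD[of A "{..<N}"]) auto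
  then show False using assms by blast
qed

lemma partition_indicator:
  assumes "unit_partition N A" "i < N" "x \<in> A i" "j < N"
  shows "indicator (A j) x = (if j = i then 1 else 0 :: real)"
proof (cases "j = i")
  case False
  then have "x \<notin> A j" using partition_unique[OF assms(1,4,2) _ assms(3)] by blast
  then show ?thesis using False by simp
qed (use assms in simp)

lemma step_fun_value:
  assumes "unit_partition N A" "i < N" "x \<in> A i"
  shows "step_fun N A v x = v i"
proof -
  have "step_fun N A v x = (\<Sum>k<N. if k = i then v i else 0)"
    unfolding step_fun_def by (intro sum.cong refl) (simp add: partition_indicator[OF assms])
  then show ?thesis using assms(2) by simp
qed

lemma cell_value:
  assumes "unit_partition N A" "i < N" "j < N" "fst p \<in> A i" "snd p \<in> A j" "k < N" "l < N"
  shows "cell A k l p = (if k = i \<and> l = j then 1 else 0)"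
  unfolding cell_def partition_indicator[OF assms(1,2,4,6)] partition_indicator[OF assms(1,3,5,7)] by simp

lemma cell_zero_or_one: "cell A i j p = 0 \<or> cell A i j p = 1"
  by (auto simp: cell_def indicator_def)

lemma cell_eq_1: "cell A i j p \<noteq> 0 \<Longrightarrow> fst p \<in> A i \<and> snd p \<in> A j"
  by (auto simp: cell_def indicator_def split: if_splits)

lemma cell_nonneg: "0 \<le> cell A i j p"
  by (simp add: cell_def)

lemma step_graphon_value:
  assumes "unit_partition N A" "i < N" "j < N" "fst p \<in> A i" "snd p \<in> A j"
  shows "step_graphon N A q p = q i j"
proof -
  have "(\<Sum>l<N. q k l * cell A k l p) = (if k = i then q i j else 0)" if "k < N" for k
  proof -
    have "(\<Sum>l<N. q k l * cell A k l p) = (\<Sum>l<N. if l = j then (if k = i then q i j else 0) else 0)"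
      using that by (intro sum.cong refl) (auto simp: cell_value[OF assms])
    then show ?thesis using assms(3) by simp
  qed
  then have "step_graphon N A q p = (\<Sum>k<N. if k = i then q i j else 0)"
    unfolding step_graphon_def by (intro sum.cong) auto
  then show ?thesis using assms(2) by simp
qed

lemma step_graphon_cell:
  assumes "unit_partition N A" "i < N" "j < N"
  shows "step_graphon N A q p * cell A i j p = q i j * cell A i j p"
proof (cases "cell A i j p = 0")
  case False
  then have "fst p \<in> A i" "snd p \<in> A j" using cell_eq_1 by blast+
  then show ?thesis using step_graphon_value[OF assms, of p q] by simp
qed simp

lemma cell_measurable [measurable]:
  assumes "unit_partition N A" "i < N" "j < N"
  shows "cell A i j \<in> borel_measurable square_leb"
  unfolding cell_def[abs_def] using partition_sets[OF assms(1,2)] partition_sets[OF assms(1,3)] by measurable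

lemma step_graphon_measurable:
  assumes "unit_partition N A"
  shows "step_graphon N A q \<in> borel_measurable square_leb"
  unfolding step_graphon_def[abs_def] using cell_measurable[OF assms]
  by (intro borel_measurable_sum borel_measurable_times) auto

lemma integral_cell_mult:
  fixes a b :: "real \<Rightarrow> real"
  assumes A: "unit_partition N A" and ij: "i < N" "j < N"
    and a: "integrable unit_leb a" and b: "integrable unit_leb b"
  shows "integrable square_leb (\<lambda>p. cell A i j p * (a (fst p) * b (snd p)))"
    and "(LINT p|square_leb. cell A i j p * (a (fst p) * b (snd p)))
      = (LINT x|unit_leb. indicator (A i) x * a x) * (LINT x|unit_leb. indicator (A j) x * b x)"
proof -
  have ia: "integrable unit_leb (\<lambda>x. indicator (A i) x * a x)"
    using integrable_mult_indicator[OF partition_sets[OF A ij(1)] a] by simp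
  have ib: "integrable unit_leb (\<lambda>x. indicator (A j) x * b x)"
    using integrable_mult_indicator[OF partition_sets[OF A ij(2)] b] by simp
  have eq: "cell A i j p * (a (fst p) * b (snd p)) = (indicator (A i) (fst p) * a (fst p)) * (indicator (A j) (snd p) * b (snd p))" for p
    by (simp add: cell_def)
  show "integrable square_leb (\<lambda>p. cell A i j p * (a (fst p) * b (snd p)))"
    "(LINT p|square_leb. cell A i j p * (a (fst p) * b (snd p)))
      = (LINT x|unit_leb. indicator (A i) x * a x) * (LINT x|unit_leb. indicator (A j) x * b x)"
    unfolding eq using integral_prod_mult[OF ia ib] by auto
qed

lemma integral_indicator_partition:
  assumes "unit_partition N A" "i < N"
  shows "(LINT x|unit_leb. indicator (A i) x) = 1 / real N"
  using partition_sets[OF assms] partition_measure[OF assms] sets_unit_leb_iff[of "A i"]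
  by (simp add: Int_absorb2)

lemma integral_cell:
  assumes "unit_partition N A" "i < N" "j < N"
  shows "integrable square_leb (cell A i j)" "integral\<^sup>L square_leb (cell A i j) = 1 / (real N)\<^sup>2"
  using integral_cell_mult[OF assms, of "\<lambda>_. 1" "\<lambda>_. 1"]
    integral_indicator_partition[OF assms(1,2)] integral_indicator_partition[OF assms(1,3)]
  by (simp_all only: integrable_const mult_1_right) (simp_all add: power2_eq_square)

lemma AE_partition:
  assumes A: "unit_partition N A" and N: "N \<ge> 1"
  shows "AE x in unit_leb. \<exists>i<N. x \<in> A i"
proof -
  have "measure unit_leb (\<Union>i<N. A i) = (\<Sum>i<N. measure unit_leb (A i))"
    using A by (intro unit_leb.finite_measure_finite_Union) (auto simp: unit_partition_def)
  also have "\<dots> = 1" using A N by (simp add: partition_measure)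
  finally have "AE x in unit_leb. x \<in> (\<Union>i<N. A i)"
    using partition_sets[OF A] by (subst unit_leb.prob_eq_1[symmetric]) auto
  then show ?thesis by eventually_elim auto
qed

lemma AE_fst_square: "AE x in unit_leb. P x \<Longrightarrow> AE p in square_leb. P (fst p)"
  and AE_snd_square: "AE x in unit_leb. P x \<Longrightarrow> AE p in square_leb. P (snd p)"
proof -
  assume P: "AE x in unit_leb. P x"
  have "AE x in distr square_prod unit_leb fst. P x"
    using P by (simp only: unit_leb.distr_pair_fst)
  then have "AE p in square_prod. P (fst p)"
    by (rule AE_distrD[OF measurable_fst])
  then show fst: "AE p in square_leb. P (fst p)" by (simp add: AE_square_leb_iff)
  have "AE p in distr square_leb square_leb (\<lambda>p. (snd p, fst p)). P (fst p)"
    using fst by (simp only: swap_square_leb(2))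
  then have "AE p in square_leb. P (fst (snd p, fst p))"
    by (rule AE_distrD[OF swap_square_leb(1)])
  then show "AE p in square_leb. P (snd p)" by simp
qed

lemma AE_cell:
  assumes A: "unit_partition N A" and N: "N \<ge> 1"
  shows "AE p in square_leb. \<exists>i<N. \<exists>j<N. fst p \<in> A i \<and> snd p \<in> A j"
  using AE_fst_square[OF AE_partition[OF assms]] AE_snd_square[OF AE_partition[OF assms]]
  by eventually_elim auto

lemma integral_split_cells:
  fixes f :: "real \<times> real \<Rightarrow> real"
  assumes A: "unit_partition N A" and N: "N \<ge> 1" and f: "integrable square_leb f"
  shows "\<And>i j. i < N \<Longrightarrow> j < N \<Longrightarrow> integrable square_leb (\<lambda>p. f p * cell A i j p)"
    and "integral\<^sup>L square_leb f = (\<Sum>i<N. \<Sum>j<N. LINT p|square_leb. f p * cell A i j p)"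
proof -
  show i: "integrable square_leb (\<lambda>p. f p * cell A i j p)" if "i < N" "j < N" for i j
  proof (rule Bochner_Integration.integrable_bound[OF f])
    show "AE p in square_leb. norm (f p * cell A i j p) \<le> norm (f p)"
    proof (rule AE_I2)
      fix p show "norm (f p * cell A i j p) \<le> norm (f p)"
        using cell_zero_or_one[of A i j p] by (elim disjE) simp_all
    qed
  qed (use cell_measurable[OF A that] f in measurable)
  have "AE p in square_leb. f p = (\<Sum>i<N. \<Sum>j<N. f p * cell A i j p)"
    using AE_cell[OF A N]
  proof eventually_elim
    case (elim p)
    then obtain i j where ij: "i < N" "j < N" "fst p \<in> A i" "snd p \<in> A j" by blast
    have "(\<Sum>i<N. \<Sum>j<N. f p * cell A i j p) = step_graphon N A (\<lambda>_ _. f p) p"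
      by (simp add: step_graphon_def)
    then show ?case using step_graphon_value[OF A ij] by simp
  qed
  then have "integral\<^sup>L square_leb f = (LINT p|square_leb. (\<Sum>i<N. \<Sum>j<N. f p * cell A i j p))"
    using f cell_measurable[OF A]
    by (intro integral_cong_AE) (auto intro!: borel_measurable_sum borel_measurable_times)
  also have "\<dots> = (\<Sum>i<N. \<Sum>j<N. LINT p|square_leb. f p * cell A i j p)"
  proof -
    have "(LINT p|square_leb. (\<Sum>j<N. f p * cell A i j p)) = (\<Sum>j<N. LINT p|square_leb. f p * cell A i j p)"
      if "i < N" for i
      using i[OF that] by (intro Bochner_Integration.integral_sum) simp
    moreover have "(LINT p|square_leb. (\<Sum>i<N. \<Sum>j<N. f p * cell A i j p))
        = (\<Sum>i<N. LINT p|square_leb. (\<Sum>j<N. f p * cell A i j p))"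
      using i by (intro Bochner_Integration.integral_sum Bochner_Integration.integrable_sum) auto
    ultimately show ?thesis by simp
  qed
  finally show "integral\<^sup>L square_leb f = (\<Sum>i<N. \<Sum>j<N. LINT p|square_leb. f p * cell A i j p)" .
qed

lemma step_graphon_in_graphons:
  assumes A: "unit_partition N A" and q: "\<And>i j. i < N \<Longrightarrow> j < N \<Longrightarrow> 0 \<le> q i j \<and> q i j \<le> 1"
    and sym: "\<And>i j. i < N \<Longrightarrow> j < N \<Longrightarrow> q i j = q j i"
  shows "step_graphon N A q \<in> graphons"
proof -
  have "0 \<le> step_graphon N A q p \<and> step_graphon N A q p \<le> 1" for p
  proof (cases "\<exists>i<N. \<exists>j<N. fst p \<in> A i \<and> snd p \<in> A j")
    case True
    then obtain i j where ij: "i < N" "j < N" "fst p \<in> A i" "snd p \<in> A j" by blast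
    then show ?thesis using step_graphon_value[OF A ij] q[of i j] by simp
  next
    case False
    then have "step_graphon N A q p = 0"
      unfolding step_graphon_def by (intro sum.neutral ballI) (use cell_eq_1 in fastforce)
    then show ?thesis by simp
  qed
  moreover have "step_graphon N A q (x, y) = step_graphon N A q (y, x)" for x y
  proof -
    have "step_graphon N A q (x, y) = (\<Sum>j<N. \<Sum>i<N. q i j * cell A i j (x, y))"
      unfolding step_graphon_def by (rule sum.swap)
    also have "\<dots> = step_graphon N A q (y, x)"
      unfolding step_graphon_def using sym by (intro sum.cong) (auto simp: cell_def)
    finally show ?thesis .
  qed
  ultimately show ?thesis
    unfolding graphons_def using step_graphon_measurable[OF A] by (intro CollectI conjI ballI) blast+
qed

lemma step_fun_L2:
  assumes A: "unit_partition N A"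
  shows "step_fun N A v \<in> L2_fun"
    and "N \<ge> 1 \<Longrightarrow> (LINT x|unit_leb. (step_fun N A v x)\<^sup>2) = (\<Sum>i<N. (v i)\<^sup>2) / N"
proof -
  have sq: "(step_fun N A v x)\<^sup>2 = step_fun N A (\<lambda>i. (v i)\<^sup>2) x" for x
  proof (cases "\<exists>i<N. x \<in> A i")
    case True
    then obtain i where i: "i < N" "x \<in> A i" by blast
    show ?thesis by (simp only: step_fun_value[OF A i])
  next
    case False
    then have "step_fun N A w x = 0" for w
      unfolding step_fun_def by (intro sum.neutral) (auto simp: indicator_def)
    then show ?thesis by simp
  qed
  have i: "integrable unit_leb (\<lambda>x. w i * indicator (A i) x)" if "i < N" for i and w :: "nat \<Rightarrow> real"
    by (intro integrable_mult_right integrable_real_indicator partition_sets[OF A that])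
       (simp add: unit_leb.emeasure_finite less_top[symmetric])
  then have "integrable unit_leb (step_fun N A w)" for w
    unfolding step_fun_def[abs_def] by (intro Bochner_Integration.integrable_sum) auto
  then show "step_fun N A v \<in> L2_fun"
    unfolding L2_fun_def using sq by (auto dest: borel_measurable_integrable)
  show "(LINT x|unit_leb. (step_fun N A v x)\<^sup>2) = (\<Sum>i<N. (v i)\<^sup>2) / N" if "N \<ge> 1"
  proof -
    have "(LINT x|unit_leb. (step_fun N A v x)\<^sup>2) = (LINT x|unit_leb. (\<Sum>i<N. (v i)\<^sup>2 * indicator (A i) x))"
      unfolding sq by (simp only: step_fun_def)
    also have "\<dots> = (\<Sum>i<N. LINT x|unit_leb. (v i)\<^sup>2 * indicator (A i) x)"
      using i by (intro Bochner_Integration.integral_sum) auto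
    also have "\<dots> = (\<Sum>i<N. (v i)\<^sup>2 / N)"
      by (intro sum.cong refl) (simp only: Bochner_Integration.integral_mult_right_zero
          integral_indicator_partition[OF A] lessThan_iff mult_1_right times_divide_eq_right)
    finally show ?thesis by (simp add: sum_divide_distrib)
  qed
qed

text \<open>Step functions are test functions that see an arbitrary graphon only through its cell
  integrals, and those are the quantities that the cut distance controls.\<close>

lemma lap_form_step_fun:
  assumes A: "unit_partition N A" and N: "N \<ge> 1" and h: "h \<in> graphons"
  shows "lap_form h (step_fun N A v) = (\<Sum>i<N. \<Sum>j<N. (v i - v j)\<^sup>2 * (LINT p|square_leb. h p * cell A i j p))"
proof -
  let ?u = "step_fun N A v"
  have "lap_form h ?u = (\<Sum>i<N. \<Sum>j<N. LINT p|square_leb. (h p * (?u (fst p) - ?u (snd p))\<^sup>2) * cell A i j p)"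
    unfolding lap_form_def by (rule integral_split_cells[OF A N lap_form_integrable[OF h step_fun_L2(1)[OF A]]])
  also have "\<dots> = (\<Sum>i<N. \<Sum>j<N. (v i - v j)\<^sup>2 * (LINT p|square_leb. h p * cell A i j p))"
  proof (intro sum.cong refl)
    fix i j assume ij: "i \<in> {..<N}" "j \<in> {..<N}"
    have "(h p * (?u (fst p) - ?u (snd p))\<^sup>2) * cell A i j p = (v i - v j)\<^sup>2 * (h p * cell A i j p)" for p
      using cell_eq_1[of A i j p] step_fun_value[OF A, of i "fst p" v] step_fun_value[OF A, of j "snd p" v] ij
      by (cases "cell A i j p = 0") auto
    then show "(LINT p|square_leb. (h p * (?u (fst p) - ?u (snd p))\<^sup>2) * cell A i j p)
        = (v i - v j)\<^sup>2 * (LINT p|square_leb. h p * cell A i j p)"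
      by (simp only: Bochner_Integration.integral_mult_right_zero)
  qed
  finally show ?thesis .
qed

text \<open>
  On each part of the partition, \<open>u\<close> splits into its mean and a fluctuation. A step graphon acts on
  the means like the matrix \<open>q\<close>, and multiplies the fluctuations by the degrees.
\<close>

lemma lap_form_step_graphon_le:
  fixes q :: "nat \<Rightarrow> nat \<Rightarrow> real" and \<beta> \<gamma> :: real
  assumes A: "unit_partition N A" and N: "N \<ge> 1"
    and sym: "\<And>i j. i < N \<Longrightarrow> j < N \<Longrightarrow> q i j = q j i"
    and form: "\<And>v. (\<Sum>i<N. \<Sum>j<N. q i j * (v i - v j)\<^sup>2) \<le> 2 * N * \<beta> * (\<Sum>i<N. (v i)\<^sup>2)"
    and deg: "\<And>i. i < N \<Longrightarrow> (\<Sum>j<N. q i j) \<le> N * \<gamma>"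
    and \<gamma>: "0 \<le> \<gamma>" "\<beta> \<le> \<gamma>" and u: "u \<in> L2_fun"
  shows "lap_form (step_graphon N A q) u \<le> 2 * \<gamma> * (LINT x|unit_leb. (u x)\<^sup>2)"
proof -
  \<comment> \<open>\<open>m i\<close> is the integral over \<open>A i\<close> and not the average,
    which is \<open>N * m i\<close>. The squared fluctuation of \<open>u\<close> on
    \<open>A i\<close> therefore integrates to \<open>s i - N * (m i)\<^sup>2\<close>.\<close>
  define s m where "s i = (LINT x|unit_leb. indicator (A i) x * (u x)\<^sup>2)"
    and "m i = (LINT x|unit_leb. indicator (A i) x * u x)" for i
  have u2: "integrable unit_leb (\<lambda>x. (u x)\<^sup>2)" and ui: "integrable unit_leb u"
    using u L2_fun_integrable[OF u] by (auto simp: L2_fun_def)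
  have c1: "integrable unit_leb (\<lambda>_. 1 :: real)" by simp
  have iS: "integrable unit_leb (\<lambda>x. indicator (A i) x * (u x)\<^sup>2)"
    and im: "integrable unit_leb (\<lambda>x. indicator (A i) x * u x)" if "i < N" for i
    using integrable_mult_indicator[OF partition_sets[OF A that] u2]
      integrable_mult_indicator[OF partition_sets[OF A that] ui] by simp_all
  have one: "(LINT x|unit_leb. indicator (A i) x * 1) = 1 / real N" if "i < N" for i
    using integral_indicator_partition[OF A that] by simp
  have cellint: "(LINT p|square_leb. cell A i j p * (u (fst p) - u (snd p))\<^sup>2) = s i / N - 2 * m i * m j + s j / N"
    and celli: "integrable square_leb (\<lambda>p. cell A i j p * (u (fst p) - u (snd p))\<^sup>2)"
    if ij: "i < N" "j < N" for i j
  proof -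
    have eq: "cell A i j p * (u (fst p) - u (snd p))\<^sup>2 = cell A i j p * ((u (fst p))\<^sup>2 * 1)
        - 2 * (cell A i j p * (u (fst p) * u (snd p))) + cell A i j p * (1 * (u (snd p))\<^sup>2)" for p
      by (simp add: power2_eq_square algebra_simps)
    note i1 = integral_cell_mult[OF A ij u2 c1] and i2 = integral_cell_mult[OF A ij ui ui]
      and i3 = integral_cell_mult[OF A ij c1 u2]
    show "integrable square_leb (\<lambda>p. cell A i j p * (u (fst p) - u (snd p))\<^sup>2)"
      unfolding eq using i1(1) i2(1) i3(1)
      by (intro Bochner_Integration.integrable_add Bochner_Integration.integrable_diff integrable_mult_right)
    show "(LINT p|square_leb. cell A i j p * (u (fst p) - u (snd p))\<^sup>2) = s i / N - 2 * m i * m j + s j / N"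
      unfolding eq
        Bochner_Integration.integral_add[OF Bochner_Integration.integrable_diff[OF i1(1) integrable_mult_right[OF i2(1)]] i3(1)]
        Bochner_Integration.integral_diff[OF i1(1) integrable_mult_right[OF i2(1)]]
        Bochner_Integration.integral_mult_right_zero i1(2) i2(2) i3(2) one[OF ij(1)] one[OF ij(2)]
      by (simp add: s_def m_def)
  qed
  have "lap_form (step_graphon N A q) u = (LINT p|square_leb. (\<Sum>i<N. \<Sum>j<N. q i j * (cell A i j p * (u (fst p) - u (snd p))\<^sup>2)))"
    unfolding lap_form_def step_graphon_def by (simp add: sum_distrib_right mult.assoc)
  also have "\<dots> = (\<Sum>i<N. \<Sum>j<N. q i j * (s i / N - 2 * m i * m j + s j / N))"
  proof -
    have "(LINT p|square_leb. (\<Sum>j<N. q i j * (cell A i j p * (u (fst p) - u (snd p))\<^sup>2)))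
        = (\<Sum>j<N. q i j * (s i / N - 2 * m i * m j + s j / N))" if "i < N" for i
      using celli[OF that] cellint[OF that] by (subst Bochner_Integration.integral_sum) auto
    moreover have "(LINT p|square_leb. (\<Sum>i<N. \<Sum>j<N. q i j * (cell A i j p * (u (fst p) - u (snd p))\<^sup>2)))
        = (\<Sum>i<N. (LINT p|square_leb. (\<Sum>j<N. q i j * (cell A i j p * (u (fst p) - u (snd p))\<^sup>2))))"
      using celli by (intro Bochner_Integration.integral_sum Bochner_Integration.integrable_sum) auto
    ultimately show ?thesis by simp
  qed
  also have "\<dots> = 2 * ((\<Sum>i<N. (\<Sum>j<N. q i j) * s i / N) - (\<Sum>i<N. \<Sum>j<N. q i j * m i * m j))"
  proof -
    have "(\<Sum>i<N. \<Sum>j<N. q i j * (s i / N - 2 * m i * m j + s j / N))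
       = (\<Sum>i<N. \<Sum>j<N. q i j * s i / N) + (\<Sum>i<N. \<Sum>j<N. q i j * s j / N) - 2 * (\<Sum>i<N. \<Sum>j<N. q i j * m i * m j)"
      unfolding sum_distrib_left sum.distrib[symmetric] sum_subtractf[symmetric]
      by (intro sum.cong refl) (simp add: algebra_simps)
    also have "(\<Sum>i<N. \<Sum>j<N. q i j * s j / N) = (\<Sum>i<N. \<Sum>j<N. q i j * s i / N)"
      by (subst sum.swap) (use sym in \<open>auto intro!: sum.cong\<close>)
    also have "(\<Sum>i<N. \<Sum>j<N. q i j * s i / N) = (\<Sum>i<N. (\<Sum>j<N. q i j) * s i / N)"
      by (simp add: sum_distrib_right sum_divide_distrib)
    finally show ?thesis by simp
  qed
  also have "(\<Sum>i<N. \<Sum>j<N. q i j * m i * m j)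
      = (\<Sum>i<N. (\<Sum>j<N. q i j) * (m i)\<^sup>2) - (\<Sum>i<N. \<Sum>j<N. q i j * (m i - m j)\<^sup>2) / 2"
    using symmetric_form_expand[of N q m, OF sym] by linarith
  also have "(\<Sum>i<N. (\<Sum>j<N. q i j) * s i / N) -
      ((\<Sum>i<N. (\<Sum>j<N. q i j) * (m i)\<^sup>2) - (\<Sum>i<N. \<Sum>j<N. q i j * (m i - m j)\<^sup>2) / 2)
    = (\<Sum>i<N. (\<Sum>j<N. q i j) * ((s i - N * (m i)\<^sup>2) / N)) + (\<Sum>i<N. \<Sum>j<N. q i j * (m i - m j)\<^sup>2) / 2"
  proof -
    have "(\<Sum>i<N. (\<Sum>j<N. q i j) * s i / N) - (\<Sum>i<N. (\<Sum>j<N. q i j) * (m i)\<^sup>2)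
        = (\<Sum>i<N. (\<Sum>j<N. q i j) * ((s i - N * (m i)\<^sup>2) / N))"
      unfolding sum_subtractf[symmetric] using N by (intro sum.cong refl) (simp add: field_simps)
    then show ?thesis by linarith
  qed
  \<comment> \<open>The fluctuation energies are nonnegative, being integrals of squared deviations
    from the mean, so their weights, the degrees, may be replaced by the upper bound.\<close>
  also have "(\<Sum>i<N. (\<Sum>j<N. q i j) * ((s i - N * (m i)\<^sup>2) / N)) \<le> (\<Sum>i<N. (N * \<gamma>) * ((s i - N * (m i)\<^sup>2) / N))"
  proof (intro sum_mono mult_right_mono)
    fix i assume i: "i \<in> {..<N}"
    have iN: "i < N" using i by simp
    have "0 \<le> (LINT x|unit_leb. indicator (A i) x * (u x - N * m i)\<^sup>2)"
      by (rule Bochner_Integration.integral_nonneg) simp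
    also have "\<dots> = (LINT x|unit_leb. indicator (A i) x * (u x)\<^sup>2 - 2 * N * m i * (indicator (A i) x * u x)
        + (N * m i)\<^sup>2 * (indicator (A i) x * 1))"
      by (intro Bochner_Integration.integral_cong) (auto simp: power2_eq_square algebra_simps)
    also have "\<dots> = s i - 2 * N * m i * m i + (N * m i)\<^sup>2 * (1 / N)"
    proof -
      have i1: "integrable unit_leb (\<lambda>x. indicator (A i) x * 1 :: real)"
        using integrable_mult_indicator[OF partition_sets[OF A iN] c1] by simp
      show ?thesis
        unfolding Bochner_Integration.integral_add[OF Bochner_Integration.integrable_diff[OF iS[OF iN]
              integrable_mult_right[OF im[OF iN]]] integrable_mult_right[OF i1]]
          Bochner_Integration.integral_diff[OF iS[OF iN] integrable_mult_right[OF im[OF iN]]]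
          Bochner_Integration.integral_mult_right_zero one[OF iN]
        by (simp add: s_def m_def)
    qed
    also have "\<dots> = s i - N * (m i)\<^sup>2" using N by (simp add: power2_eq_square)
    finally show "0 \<le> (s i - N * (m i)\<^sup>2) / N" by simp
    show "(\<Sum>j<N. q i j) \<le> N * \<gamma>" using deg i by simp
  qed
  also have "(\<Sum>i<N. (N * \<gamma>) * ((s i - N * (m i)\<^sup>2) / N)) = \<gamma> * (\<Sum>i<N. s i) - N * \<gamma> * (\<Sum>i<N. (m i)\<^sup>2)"
    unfolding sum_distrib_left sum_subtractf[symmetric] using N by (intro sum.cong refl) (simp add: field_simps)
  \<comment> \<open>The matrix constraint at the vector \<open>m\<close>. Relaxing
    \<open>\<beta>\<close> to \<open>\<gamma>\<close> makes this bound cancel the negative term in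
    \<open>m\<close> left by the fluctuations, and the total mass of the square of \<open>u\<close>
    remains.\<close>
  also have "(\<Sum>i<N. \<Sum>j<N. q i j * (m i - m j)\<^sup>2) / 2 \<le> N * \<gamma> * (\<Sum>i<N. (m i)\<^sup>2)"
  proof -
    have "(\<Sum>i<N. \<Sum>j<N. q i j * (m i - m j)\<^sup>2) / 2 \<le> (2 * N * \<beta> * (\<Sum>i<N. (m i)\<^sup>2)) / 2"
      using form[of m] by (intro divide_right_mono) auto
    also have "\<dots> = \<beta> * (N * (\<Sum>i<N. (m i)\<^sup>2))" by simp
    also have "\<dots> \<le> \<gamma> * (N * (\<Sum>i<N. (m i)\<^sup>2))"
      using \<gamma> by (intro mult_right_mono mult_nonneg_nonneg sum_nonneg) auto
    finally show ?thesis by (simp add: mult_ac)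
  qed
  also have "(\<gamma> * (\<Sum>i<N. s i) - N * \<gamma> * (\<Sum>i<N. (m i)\<^sup>2)) + N * \<gamma> * (\<Sum>i<N. (m i)\<^sup>2) = \<gamma> * (\<Sum>i<N. s i)" by simp
  also have "(\<Sum>i<N. s i) \<le> (LINT x|unit_leb. (u x)\<^sup>2)"
  proof -
    have "(\<Sum>i<N. s i) = (LINT x|unit_leb. (\<Sum>i<N. indicator (A i) x * (u x)\<^sup>2))"
      unfolding s_def using iS by (intro Bochner_Integration.integral_sum[symmetric]) auto
    also have "\<dots> \<le> (LINT x|unit_leb. (u x)\<^sup>2)"
    proof (rule integral_mono[OF _ u2])
      show "integrable unit_leb (\<lambda>x. \<Sum>i<N. indicator (A i) x * (u x)\<^sup>2)"
        using iS by (intro Bochner_Integration.integrable_sum) auto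
      fix x
      show "(\<Sum>i<N. indicator (A i) x * (u x)\<^sup>2) \<le> (u x)\<^sup>2"
      proof (cases "\<exists>i<N. x \<in> A i")
        case True
        then obtain i where "i < N" "x \<in> A i" by blast
        from step_fun_value[OF A this, of "\<lambda>_. (u x)\<^sup>2"]
        have "(\<Sum>i<N. (u x)\<^sup>2 * indicator (A i) x) = (u x)\<^sup>2" by (simp only: step_fun_def)
        then show ?thesis by (simp only: mult.commute[of "(u x)\<^sup>2"] order_refl)
      next
        case False
        then have "(\<Sum>i<N. indicator (A i) x * (u x)\<^sup>2) = 0"
          by (intro sum.neutral) (auto simp: indicator_def)
        then show ?thesis by (simp only: zero_le_power2)
      qed
    qed
    finally show ?thesis .
  qed
  finally show ?thesis using \<gamma>(1) by (simp add: mult_left_mono)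
qed

text \<open>Test the form with the i-th unit vector. The form never sees diagonal entries, so the
  i-th one has to be added back; with a zero diagonal the degree bound is exact.\<close>

lemma degree_le_of_form:
  fixes q :: "nat \<Rightarrow> nat \<Rightarrow> real"
  assumes sym: "\<And>i j. i < N \<Longrightarrow> j < N \<Longrightarrow> q i j = q j i" and i: "i < N"
    and form: "\<And>v. (\<Sum>i<N. \<Sum>j<N. q i j * (v i - v j)\<^sup>2) \<le> 2 * N * \<beta> * (\<Sum>i<N. (v i)\<^sup>2)"
  shows "(\<Sum>j<N. q i j) \<le> N * \<beta> + q i i"
proof -
  define v where "v j = (if j = i then 1 else 0 :: real)" for j
  have v2: "(\<Sum>j<N. (v j)\<^sup>2) = 1"
    using i by (simp add: v_def if_distrib[of "\<lambda>x. x\<^sup>2"] cong: if_cong)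
  have sel: "(\<Sum>j<N. f j * v j) = f i" for f
    using i by (simp add: v_def if_distrib cong: if_cong)
  have vsq: "(v k)\<^sup>2 = v k" for k by (simp add: v_def)
  have "(\<Sum>k<N. \<Sum>j<N. q k j * (v k - v j)\<^sup>2) / 2
     = (\<Sum>k<N. (\<Sum>j<N. q k j) * (v k)\<^sup>2) - (\<Sum>k<N. \<Sum>j<N. q k j * v k * v j)"
    using sym by (rule symmetric_form_expand)
  also have "(\<Sum>k<N. (\<Sum>j<N. q k j) * (v k)\<^sup>2) = (\<Sum>j<N. q i j)"
    unfolding vsq by (rule sel)
  also have "(\<Sum>k<N. \<Sum>j<N. q k j * v k * v j) = q i i"
    by (simp add: sel)
  finally show ?thesis using form[of v] v2 by simp
qed


section \<open>Block averages\<close>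

lemma unit_partition_block:
  assumes N: "N \<ge> 1"
  shows "unit_partition N (block N)"
  unfolding unit_partition_def
proof (intro conjI allI impI)
  fix i assume i: "i < N"
  have Np: "real N > 0" using N by simp
  have "(real i + 1) / real N \<le> 1" using i Np by simp
  moreover have "0 \<le> real i / real N" by simp
  ultimately have "block N i \<subseteq> {0..1}"
    unfolding block_def by (meson atLeastLessThan_iff atLeastAtMost_iff less_le_trans less_imp_le order_trans subsetI)
  then show s: "block N i \<in> sets unit_leb" unfolding sets_unit_leb_iff by (simp add: block_def)
  have "emeasure unit_leb (block N i) = emeasure lebesgue (block N i)" by (rule emeasure_unit_leb[OF s])
  also have "\<dots> = ennreal ((real i + 1) / real N - real i / real N)"
    using Np by (simp add: block_def divide_right_mono)
  finally show "measure unit_leb (block N i) = 1 / real N"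
    using Np by (simp add: measure_def add_divide_distrib)
next
  show "disjoint_family_on (block N) {..<N}"
    unfolding disjoint_family_on_def
  proof (intro ballI impI)
    fix i j assume ij: "i \<in> {..<N}" "j \<in> {..<N}" "i \<noteq> j"
    have Np: "real N > 0" using N by simp
    show "block N i \<inter> block N j = {}"
    proof (rule ccontr)
      assume "block N i \<inter> block N j \<noteq> {}"
      then obtain x where "x \<in> block N i" "x \<in> block N j" by blast
      then have "real i \<le> x * real N" "x * real N < real i + 1" "real j \<le> x * real N" "x * real N < real j + 1"
        using Np by (auto simp: block_def field_simps)
      then have "real i < real j + 1" "real j < real i + 1" by linarith+
      then show False using ij(3) by linarith
    qed
  qed
qed

lemma unit_partition_vimage:
  assumes A: "unit_partition N A" and \<phi>: "\<phi> \<in> mp_maps"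
  shows "unit_partition N (\<lambda>i. \<phi> -` A i \<inter> {0..1})"
  unfolding unit_partition_def
proof (intro conjI allI impI)
  have m: "\<phi> \<in> measurable unit_leb unit_leb" and d: "distr unit_leb unit_leb \<phi> = unit_leb"
    using \<phi> by (auto simp: mp_maps_def)
  fix i assume i: "i < N"
  note s = partition_sets[OF A i]
  show "\<phi> -` A i \<inter> {0..1} \<in> sets unit_leb" using measurable_sets[OF m s] by simp
  have "measure (distr unit_leb unit_leb \<phi>) (A i) = measure unit_leb (\<phi> -` A i \<inter> space unit_leb)"
    by (rule measure_distr[OF m s])
  then show "measure unit_leb (\<phi> -` A i \<inter> {0..1}) = 1 / real N"
    using partition_measure[OF A i] by (simp add: d)
next
  show "disjoint_family_on (\<lambda>i. \<phi> -` A i \<inter> {0..1}) {..<N}"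
    unfolding disjoint_family_on_def
  proof (intro ballI impI)
    fix i j assume "i \<in> {..<N}" "j \<in> {..<N}" "i \<noteq> j"
    then have "A i \<inter> A j = {}"
      using A unfolding unit_partition_def by (intro disjoint_family_onD[of A "{..<N}"]) auto
    then show "(\<phi> -` A i \<inter> {0..1}) \<inter> (\<phi> -` A j \<inter> {0..1}) = {}" by blast
  qed
qed

lemma cell_vimage:
  assumes "p \<in> unit_square"
  shows "cell (\<lambda>i. \<phi> -` A i \<inter> {0..1}) i j p = cell A i j (case p of (x, y) \<Rightarrow> (\<phi> x, \<phi> y))"
  using assms by (cases p) (simp add: cell_def indicator_def)

lemma step_graphon_vimage:
  assumes "p \<in> unit_square"
  shows "step_graphon N (\<lambda>i. \<phi> -` A i \<inter> {0..1}) q p = step_graphon N A q (case p of (x, y) \<Rightarrow> (\<phi> x, \<phi> y))"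
  unfolding step_graphon_def cell_vimage[OF assms] ..

definition block_avg :: "nat \<Rightarrow> (real \<times> real \<Rightarrow> real) \<Rightarrow> nat \<Rightarrow> nat \<Rightarrow> real" where
  "block_avg N h i j = (real N)\<^sup>2 * (LINT p|square_leb. h p * cell (block N) i j p)"

lemma graphon_integrable:
  assumes "h \<in> graphons" shows "integrable square_leb h"
proof (rule square_leb.integrable_const_bound[of _ 1])
  show "AE p in square_leb. norm (h p) \<le> 1"
  proof (rule AE_I2)
    fix p assume "p \<in> space square_leb"
    then have "0 \<le> h p \<and> h p \<le> 1" using graphon_bounds[OF assms, of p] by (simp only: space_restrict_space) simp
    then show "norm (h p) \<le> 1" by simp
  qed
qed (rule graphon_measurable[OF assms])

lemma block_avg_bounds:
  assumes h: "h \<in> graphons" and N: "N \<ge> 1" and ij: "i < N" "j < N"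
  shows "0 \<le> block_avg N h i j \<and> block_avg N h i j \<le> 1"
proof -
  note A = unit_partition_block[OF N]
  have bd: "0 \<le> h p * cell (block N) i j p \<and> h p * cell (block N) i j p \<le> cell (block N) i j p"
    if "p \<in> space square_leb" for p
  proof -
    have "0 \<le> h p \<and> h p \<le> 1" using graphon_bounds[OF h, of p] that by (simp only: space_restrict_space) simp
    then show ?thesis using cell_nonneg[of "block N" i j p] by (simp add: mult_left_le_one_le)
  qed
  have "0 \<le> (LINT p|square_leb. h p * cell (block N) i j p)"
    using bd by (intro Bochner_Integration.integral_nonneg_AE AE_I2) blast
  moreover have "(LINT p|square_leb. h p * cell (block N) i j p) \<le> integral\<^sup>L square_leb (cell (block N) i j)"
    using bd by (intro integral_mono integral_split_cells(1)[OF A N graphon_integrable[OF h] ij] integral_cell(1)[OF A ij]) blast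
  ultimately show ?thesis
    using N unfolding block_avg_def integral_cell(2)[OF A ij] by (simp add: field_simps)
qed

lemma block_avg_sym:
  assumes h: "h \<in> graphons" and N: "N \<ge> 1" and ij: "i < N" "j < N"
  shows "block_avg N h i j = block_avg N h j i"
proof -
  have m: "(\<lambda>p. h p * cell (block N) i j p) \<in> borel_measurable square_leb"
    using graphon_measurable[OF h] cell_measurable[OF unit_partition_block[OF N] ij] by measurable
  have "(LINT p|square_leb. h p * cell (block N) i j p) = (LINT p|square_leb. h (snd p, fst p) * cell (block N) i j (snd p, fst p))"
    by (rule integral_square_swap[OF m])
  also have "\<dots> = (LINT p|square_leb. h p * cell (block N) j i p)"
  proof (rule Bochner_Integration.integral_cong[OF refl])
    fix p assume "p \<in> space square_leb"
    then have "h (snd p, fst p) = h p"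
      using graphon_sym[OF h, of "fst p" "snd p"] by auto
    then show "h (snd p, fst p) * cell (block N) i j (snd p, fst p) = h p * cell (block N) j i p"
      by (simp add: cell_def)
  qed
  finally show ?thesis by (simp add: block_avg_def)
qed

lemma integrable_step_graphon:
  assumes "unit_partition N A"
  shows "integrable square_leb (step_graphon N A q)"
  unfolding step_graphon_def[abs_def]
  by (intro Bochner_Integration.integrable_sum integrable_mult_right integral_cell(1)[OF assms]) auto

lemma step_graphon_diff:
  "step_graphon N A q p - step_graphon N A q' p = step_graphon N A (\<lambda>i j. q i j - q' i j) p"
  by (simp add: step_graphon_def left_diff_distrib sum_subtractf)

lemma integral_fun_step_graphon:
  fixes F :: "real \<Rightarrow> real"
  assumes A: "unit_partition N A" and N: "N \<ge> 1" and F: "integrable square_leb (\<lambda>p. F (step_graphon N A q p))"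
  shows "(LINT p|square_leb. F (step_graphon N A q p)) = (\<Sum>i<N. \<Sum>j<N. F (q i j)) / (real N)\<^sup>2"
proof -
  have "(LINT p|square_leb. F (step_graphon N A q p))
      = (\<Sum>i<N. \<Sum>j<N. LINT p|square_leb. F (step_graphon N A q p) * cell A i j p)"
    by (rule integral_split_cells(2)[OF A N F])
  also have "\<dots> = (\<Sum>i<N. \<Sum>j<N. F (q i j) / (real N)\<^sup>2)"
  proof (intro sum.cong refl)
    fix i j assume "i \<in> {..<N}" "j \<in> {..<N}"
    then have ij: "i < N" "j < N" by auto
    have "F (step_graphon N A q p) * cell A i j p = F (q i j) * cell A i j p" for p
      using step_graphon_value[OF A ij, of p q] cell_eq_1[of A i j p] by (cases "cell A i j p = 0") simp_all
    then show "(LINT p|square_leb. F (step_graphon N A q p) * cell A i j p) = F (q i j) / (real N)\<^sup>2"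
      by (simp only: Bochner_Integration.integral_mult_right_zero integral_cell(2)[OF A ij] times_divide_eq_right mult_1_right)
  qed
  finally show ?thesis by (simp add: sum_divide_distrib)
qed

text \<open>A step graphon over the same partition equals its own averages, so on each cell the left
  side is the modulus of an average of \<open>h - step_graphon N A q\<close>. Hence averaging
  \<open>h\<close> never moves it away from any step graphon that approximates it.\<close>

lemma averaging_L1_contraction:
  assumes A: "unit_partition N A" and N: "N \<ge> 1" and h: "integrable square_leb h"
    and avg: "\<And>i j. i < N \<Longrightarrow> j < N \<Longrightarrow> a i j = (real N)\<^sup>2 * (LINT p|square_leb. h p * cell A i j p)"
  shows "(LINT p|square_leb. \<bar>step_graphon N A a p - step_graphon N A q p\<bar>)
       \<le> (LINT p|square_leb. \<bar>h p - step_graphon N A q p\<bar>)"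
proof -
  let ?s = "step_graphon N A q"
  have s: "integrable square_leb ?s" by (rule integrable_step_graphon[OF A])
  have hs: "integrable square_leb (\<lambda>p. h p - ?s p)" using h s by simp
  have "(LINT p|square_leb. \<bar>step_graphon N A a p - ?s p\<bar>) = (\<Sum>i<N. \<Sum>j<N. \<bar>a i j - q i j\<bar>) / (real N)\<^sup>2"
    unfolding step_graphon_diff by (rule integral_fun_step_graphon[OF A N]) (intro integrable_abs integrable_step_graphon[OF A])
  also have "\<dots> = (\<Sum>i<N. \<Sum>j<N. \<bar>a i j - q i j\<bar> / (real N)\<^sup>2)" by (simp add: sum_divide_distrib)
  also have "\<dots> \<le> (\<Sum>i<N. \<Sum>j<N. LINT p|square_leb. \<bar>h p - ?s p\<bar> * cell A i j p)"
  proof (intro sum_mono)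
    fix i j assume "i \<in> {..<N}" "j \<in> {..<N}"
    then have ij: "i < N" "j < N" by auto
    have hi: "integrable square_leb (\<lambda>p. h p * cell A i j p)" by (rule integral_split_cells(1)[OF A N h ij])
    have ci: "integrable square_leb (\<lambda>p. q i j * cell A i j p)" by (intro integrable_mult_right integral_cell(1)[OF A ij])
    have eq: "(h p - ?s p) * cell A i j p = h p * cell A i j p - q i j * cell A i j p" for p
      using step_graphon_cell[OF A ij, of q p] by (simp add: left_diff_distrib)
    have "(LINT p|square_leb. (h p - ?s p) * cell A i j p) = (a i j - q i j) / (real N)\<^sup>2"
      unfolding eq Bochner_Integration.integral_diff[OF hi ci] using N
      by (simp add: avg[OF ij] integral_cell(2)[OF A ij] diff_divide_distrib)
    then have "\<bar>a i j - q i j\<bar> / (real N)\<^sup>2 = \<bar>LINT p|square_leb. (h p - ?s p) * cell A i j p\<bar>"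
      by (simp add: abs_divide)
    also have "\<dots> \<le> (LINT p|square_leb. \<bar>(h p - ?s p) * cell A i j p\<bar>)" by (rule integral_abs_bound)
    also have "\<dots> = (LINT p|square_leb. \<bar>h p - ?s p\<bar> * cell A i j p)"
      by (simp add: abs_mult cell_nonneg)
    finally show "\<bar>a i j - q i j\<bar> / (real N)\<^sup>2 \<le> (LINT p|square_leb. \<bar>h p - ?s p\<bar> * cell A i j p)" .
  qed
  also have "\<dots> = (LINT p|square_leb. \<bar>h p - ?s p\<bar>)"
    by (rule integral_split_cells(2)[OF A N, symmetric]) (rule integrable_abs[OF hs])
  finally show ?thesis .
qed

text \<open>A Lebesgue measurable function is almost everywhere a limit of continuous ones. Clipping
  these to the unit interval does not disturb the limit, because \<open>h\<close> has values there,
  and supplies the domination.\<close>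

lemma continuous_L1_approx:
  assumes h: "h \<in> graphons" and e: "e > 0"
  obtains c where "continuous_on UNIV c" "integrable square_leb c" "(LINT p|square_leb. \<bar>h p - c p\<bar>) < e"
proof -
  have "(\<lambda>p. if p \<in> unit_square then h p else 0) \<in> borel_measurable lebesgue"
    using graphon_measurable[OF h] by (subst borel_measurable_if) simp_all
  then have "(\<lambda>p. if p \<in> unit_square then h p else 0) measurable_on UNIV"
    by (rule lebesgue_measurable_imp_measurable_on_real) simp
  then obtain Z g where Zg: "negligible Z \<and> (\<forall>n. continuous_on UNIV (g n)) \<and>
      (\<forall>p. p \<notin> Z \<longrightarrow> (\<lambda>n. g n p) \<longlonglongrightarrow> (if p \<in> unit_square then h p else 0))"
    unfolding measurable_on_def by (simp only: UNIV_I if_True) (elim exE, rule that)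
  then have Z: "negligible Z" and g: "\<And>n. continuous_on UNIV (g n)" by simp_all
  have lim: "(\<lambda>n. g n p) \<longlonglongrightarrow> (if p \<in> unit_square then h p else 0)" if "p \<notin> Z" for p
    using conjunct2[OF conjunct2[OF Zg]] that by (simp only: simp_thms)
  define c where "c n p = max 0 (min 1 (g n p))" for n p
  have c: "continuous_on UNIV (c n)" for n
    unfolding c_def using g by (intro continuous_intros)
  have cm: "c n \<in> borel_measurable square_leb" for n
    using borel_measurable_continuous_onI[OF c[of n]]
    by (intro measurable_restrict_space1 measurable_completion) simp
  have cb: "\<bar>c n p\<bar> \<le> 1" for n p by (simp add: c_def)
  have ci: "integrable square_leb (c n)" for n
    using cb cm by (intro square_leb.integrable_const_bound[of _ 1]) simp_all
  have "AE p in lebesgue. p \<notin> Z"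
    using Z by (intro AE_not_in) (simp add: negligible_iff_null_sets)
  then have "AE p in square_leb. p \<notin> Z"
    by (subst AE_restrict_space_iff) (auto elim: eventually_mono)
  then have AElim: "AE p in square_leb. (\<lambda>n. \<bar>h p - c n p\<bar>) \<longlonglongrightarrow> 0"
    using AE_space
  proof eventually_elim
    case (elim p)
    have "0 \<le> h p \<and> h p \<le> 1" using graphon_bounds[OF h, of p] elim(2) by (simp only: space_restrict_space) simp
    then have hp: "max 0 (min 1 (h p)) = h p" by simp
    have "(\<lambda>n. g n p) \<longlonglongrightarrow> h p" using lim[OF elim(1)] elim(2) by simp
    then have "(\<lambda>n. c n p) \<longlonglongrightarrow> max 0 (min 1 (h p))"
      unfolding c_def by (intro tendsto_max tendsto_min tendsto_const)
    then have "(\<lambda>n. \<bar>h p - c n p\<bar>) \<longlonglongrightarrow> \<bar>h p - h p\<bar>"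
      unfolding hp by (intro tendsto_rabs tendsto_diff tendsto_const)
    then show ?case by simp
  qed
  have "(\<lambda>n. LINT p|square_leb. \<bar>h p - c n p\<bar>) \<longlonglongrightarrow> (LINT p|square_leb. 0)"
  proof (rule integral_dominated_convergence[where w = "\<lambda>p. \<bar>h p\<bar> + 1"])
    show "AE p in square_leb. norm \<bar>h p - c n p\<bar> \<le> \<bar>h p\<bar> + 1" for n
    proof (rule AE_I2)
      fix p show "norm \<bar>h p - c n p\<bar> \<le> \<bar>h p\<bar> + 1"
        using cb[of n p] abs_triangle_ineq4[of "h p" "c n p"] by simp
    qed
    show "integrable square_leb (\<lambda>p. \<bar>h p\<bar> + 1)" using graphon_integrable[OF h] by simp
    show "(\<lambda>p. \<bar>h p - c n p\<bar>) \<in> borel_measurable square_leb" for n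
      using graphon_measurable[OF h] cm[of n] by simp
  qed (use AElim in simp_all)
  then have "(\<lambda>n. LINT p|square_leb. \<bar>h p - c n p\<bar>) \<longlonglongrightarrow> 0" by simp
  then have "eventually (\<lambda>n. (LINT p|square_leb. \<bar>h p - c n p\<bar>) < e) sequentially"
    using e by (rule order_tendstoD(2))
  then obtain n where "(LINT p|square_leb. \<bar>h p - c n p\<bar>) < e"
    by (auto simp: eventually_sequentially)
  with c[of n] ci[of n] show ?thesis by (rule that)
qed

text \<open>Compare through the step function \<open>s\<close> that samples a continuous
  approximation \<open>c\<close> at the block corners. The distances from \<open>h\<close> to
  \<open>c\<close> and from \<open>c\<close> to \<open>s\<close> are at most e/6 each, and by
  \<open>averaging_L1_contraction\<close> the block averages are no farther from \<open>s\<close>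
  than \<open>h\<close> is. The total is below 2e/3.\<close>

lemma block_approx_L1:
  assumes h: "h \<in> graphons"
  shows "(\<lambda>N. LINT p|square_leb. \<bar>step_graphon N (block N) (block_avg N h) p - h p\<bar>) \<longlonglongrightarrow> 0"
proof (rule LIMSEQ_I)
  fix e :: real assume e: "e > 0"
  obtain c where c: "continuous_on UNIV c" "integrable square_leb c" "(LINT p|square_leb. \<bar>h p - c p\<bar>) < e / 6"
    using continuous_L1_approx[OF h, of "e / 6"] e by auto
  have "uniformly_continuous_on unit_square c"
    using c(1) by (intro compact_uniformly_continuous compact_Times) (auto intro: continuous_on_subset)
  then obtain d where d: "d > 0" "\<And>p p'. p \<in> unit_square \<Longrightarrow> p' \<in> unit_square \<Longrightarrow> dist p' p < d \<Longrightarrow> dist (c p') (c p) < e / 6"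
    using e unfolding uniformly_continuous_on_def by (metis divide_pos_pos zero_less_numeral)
  \<comment> \<open>A point of a block is less than 1/N away from the corner in each coordinate, so
    its distance to the corner is below 2/N.\<close>
  obtain M :: nat where M: "real M > 2 / d" "M \<ge> 1"
    using reals_Archimedean2[of "2 / d"] by (metis One_nat_def Suc_leI d(1) divide_pos_pos less_trans of_nat_0_less_iff zero_less_numeral)
  have "norm ((LINT p|square_leb. \<bar>step_graphon N (block N) (block_avg N h) p - h p\<bar>) - 0) < e" if NM: "N \<ge> M" for N
  proof -
    have N: "N \<ge> 1" using NM M by simp
    have Np: "real N > 0" using N by simp
    have Nd: "2 / real N < d"
    proof -
      have "2 / d < real N" using M(1) NM by linarith
      then show ?thesis using d(1) Np by (simp add: field_simps)
    qed
    note A = unit_partition_block[OF N]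
    define s where "s = step_graphon N (block N) (\<lambda>i j. c (real i / real N, real j / real N))"
    have si: "integrable square_leb s" unfolding s_def by (rule integrable_step_graphon[OF A])
    have hi: "integrable square_leb h" by (rule graphon_integrable[OF h])
    have "AE p in square_leb. \<bar>c p - s p\<bar> \<le> e / 6"
      using AE_cell[OF A N] AE_space
    proof eventually_elim
      case (elim p)
      then obtain i j where ij: "i < N" "j < N" "fst p \<in> block N i" "snd p \<in> block N j" by blast
      have sp: "s p = c (real i / real N, real j / real N)"
        unfolding s_def by (rule step_graphon_value[OF A ij])
      have "dist p (real i / real N, real j / real N) \<le> dist (fst p) (real i / real N) + dist (snd p) (real j / real N)"
        by (cases p) (simp add: dist_Pair_Pair sqrt_sum_squares_le_sum)
      also have "\<dots> < 2 / real N"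
        using ij(3,4) by (simp add: block_def dist_real_def add_divide_distrib)
      finally have "dist p (real i / real N, real j / real N) < d" using Nd by simp
      moreover have "(real i / real N, real j / real N) \<in> unit_square"
        using ij(1,2) Np by simp
      moreover have "p \<in> unit_square" using elim(2) by simp
      ultimately have "dist (c p) (c (real i / real N, real j / real N)) < e / 6" by (intro d(2))
      then show ?case by (simp add: sp dist_real_def)
    qed
    then have "(LINT p|square_leb. \<bar>c p - s p\<bar>) \<le> (LINT p|square_leb. e / 6)"
      using c(2) si by (intro integral_mono_AE) simp_all
    then have cs: "(LINT p|square_leb. \<bar>c p - s p\<bar>) \<le> e / 6"
      using square_leb.prob_space by simp
    have "(LINT p|square_leb. \<bar>h p - s p\<bar>) \<le> (LINT p|square_leb. \<bar>h p - c p\<bar> + \<bar>c p - s p\<bar>)"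
      using hi c(2) si by (intro integral_mono) auto
    also have "\<dots> = (LINT p|square_leb. \<bar>h p - c p\<bar>) + (LINT p|square_leb. \<bar>c p - s p\<bar>)"
      using hi c(2) si by simp
    finally have hs: "(LINT p|square_leb. \<bar>h p - s p\<bar>) < e / 3" using cs c(3) by simp
    let ?b = "step_graphon N (block N) (block_avg N h)"
    have bi: "integrable square_leb ?b" by (rule integrable_step_graphon[OF A])
    have bs: "(LINT p|square_leb. \<bar>?b p - s p\<bar>) \<le> (LINT p|square_leb. \<bar>h p - s p\<bar>)"
      unfolding s_def by (rule averaging_L1_contraction[OF A N hi]) (rule block_avg_def)
    have "(LINT p|square_leb. \<bar>?b p - h p\<bar>) \<le> (LINT p|square_leb. \<bar>?b p - s p\<bar> + \<bar>h p - s p\<bar>)"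
      using hi bi si by (intro integral_mono) auto
    also have "\<dots> = (LINT p|square_leb. \<bar>?b p - s p\<bar>) + (LINT p|square_leb. \<bar>h p - s p\<bar>)"
      using hi bi si by simp
    finally have "(LINT p|square_leb. \<bar>?b p - h p\<bar>) < e" using bs hs e by linarith
    moreover have "0 \<le> (LINT p|square_leb. \<bar>?b p - h p\<bar>)" by (rule Bochner_Integration.integral_nonneg) simp
    ultimately show ?thesis by simp
  qed
  then show "\<exists>no. \<forall>N\<ge>no. norm ((LINT p|square_leb. \<bar>step_graphon N (block N) (block_avg N h) p - h p\<bar>) - 0) < e"
    by blast
qed


section \<open>Laplacian norm and block averages\<close>

text \<open>The finite-dimensional form of \<open>laplacian_norm g \<le> \<beta>\<close>. In the
  factor \<open>2 * real N * \<beta>\<close> the 2 comes from summing over ordered pairs, and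
  \<open>N\<close> from cells of area 1/N^2 against parts of mass 1/N. For fixed \<open>N\<close>
  and \<open>v\<close> it involves finitely many cell integrals, so it passes to limits in the cut
  distance.\<close>

definition block_bound :: "real \<Rightarrow> (real \<times> real \<Rightarrow> real) \<Rightarrow> bool" where
  "block_bound \<beta> g \<longleftrightarrow> (\<forall>N\<ge>1. \<forall>v. (\<Sum>i<N. \<Sum>j<N. block_avg N g i j * (v i - v j)\<^sup>2) \<le> 2 * real N * \<beta> * (\<Sum>i<N. (v i)\<^sup>2))"

lemma cell_form_le:
  assumes h: "h \<in> graphons" and norm: "laplacian_norm h \<le> \<beta>" and A: "unit_partition N A" and N: "N \<ge> 1"
  shows "(\<Sum>i<N. \<Sum>j<N. (v i - v j)\<^sup>2 * (LINT p|square_leb. h p * cell A i j p)) \<le> 2 * \<beta> * ((\<Sum>i<N. (v i)\<^sup>2) / N)"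
proof -
  have "(\<Sum>i<N. \<Sum>j<N. (v i - v j)\<^sup>2 * (LINT p|square_leb. h p * cell A i j p)) = lap_form h (step_fun N A v)"
    by (rule lap_form_step_fun[OF A N h, symmetric])
  also have "\<dots> \<le> 2 * laplacian_norm h * (LINT x|unit_leb. (step_fun N A v x)\<^sup>2)"
    by (rule lap_form_le_norm[OF h step_fun_L2(1)[OF A]])
  also have "\<dots> \<le> 2 * \<beta> * ((\<Sum>i<N. (v i)\<^sup>2) / N)"
    unfolding step_fun_L2(2)[OF A N] using norm
    by (intro mult_right_mono divide_nonneg_nonneg sum_nonneg) auto
  finally show ?thesis .
qed

lemma block_bound_iff_cells:
  "block_bound \<beta> g \<longleftrightarrow> (\<forall>N\<ge>1. \<forall>v. (\<Sum>i<N. \<Sum>j<N. (v i - v j)\<^sup>2 * (LINT p|square_leb. g p * cell (block N) i j p))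
      \<le> 2 * \<beta> * ((\<Sum>i<N. (v i)\<^sup>2) / N))"
proof -
  have "(\<Sum>i<N. \<Sum>j<N. block_avg N g i j * (v i - v j)\<^sup>2) \<le> 2 * real N * \<beta> * (\<Sum>i<N. (v i)\<^sup>2) \<longleftrightarrow>
     (\<Sum>i<N. \<Sum>j<N. (v i - v j)\<^sup>2 * (LINT p|square_leb. g p * cell (block N) i j p)) \<le> 2 * \<beta> * ((\<Sum>i<N. (v i)\<^sup>2) / N)"
    if N: "N \<ge> 1" for N v
  proof -
    have N2: "(real N)\<^sup>2 > 0" using N by simp
    have 1: "(\<Sum>i<N. \<Sum>j<N. block_avg N g i j * (v i - v j)\<^sup>2)
      = (real N)\<^sup>2 * (\<Sum>i<N. \<Sum>j<N. (v i - v j)\<^sup>2 * (LINT p|square_leb. g p * cell (block N) i j p))"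
      unfolding block_avg_def sum_distrib_left by (intro sum.cong refl) simp
    have 2: "2 * real N * \<beta> * (\<Sum>i<N. (v i)\<^sup>2) = (real N)\<^sup>2 * (2 * \<beta> * ((\<Sum>i<N. (v i)\<^sup>2) / N))"
      using N by (simp add: power2_eq_square)
    show ?thesis unfolding 1 2 by (rule mult_le_cancel_left_pos[OF N2])
  qed
  then show ?thesis unfolding block_bound_def by blast
qed

lemma laplacian_norm_imp_block_bound:
  assumes "h \<in> graphons" "laplacian_norm h \<le> \<beta>"
  shows "block_bound \<beta> h"
  unfolding block_bound_iff_cells using cell_form_le[OF assms unit_partition_block] by blast

lemma integral_abs_rearrange:
  fixes f g :: "real \<times> real \<Rightarrow> real"
  assumes \<phi>: "\<phi> \<in> mp_maps" and f: "f \<in> borel_measurable square_leb" and g: "g \<in> borel_measurable square_leb"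
  shows "(LINT p|square_leb. \<bar>f (case p of (x, y) \<Rightarrow> (\<phi> x, \<phi> y)) - g (case p of (x, y) \<Rightarrow> (\<phi> x, \<phi> y))\<bar>)
       = (LINT p|square_leb. \<bar>f p - g p\<bar>)"
  using integral_mp_square[OF \<phi>, of "\<lambda>p. \<bar>f p - g p\<bar>"] f g by measurable

lemma vimage_block_approx_L1:
  assumes g: "g \<in> graphons" and \<phi>: "\<phi> \<in> mp_maps"
  shows "(\<lambda>N. LINT p|square_leb. \<bar>step_graphon N (\<lambda>i. \<phi> -` block N i \<inter> {0..1}) (block_avg N g) p - rearrange g \<phi> p\<bar>) \<longlonglongrightarrow> 0"
proof -
  have "(LINT p|square_leb. \<bar>step_graphon N (\<lambda>i. \<phi> -` block N i \<inter> {0..1}) (block_avg N g) p - rearrange g \<phi> p\<bar>)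
      = (LINT p|square_leb. \<bar>step_graphon N (block N) (block_avg N g) p - g p\<bar>)" if N: "N \<ge> 1" for N
  proof -
    note A = unit_partition_block[OF N]
    have "(LINT p|square_leb. \<bar>step_graphon N (\<lambda>i. \<phi> -` block N i \<inter> {0..1}) (block_avg N g) p - rearrange g \<phi> p\<bar>)
      = (LINT p|square_leb. \<bar>step_graphon N (block N) (block_avg N g) (case p of (x, y) \<Rightarrow> (\<phi> x, \<phi> y))
           - g (case p of (x, y) \<Rightarrow> (\<phi> x, \<phi> y))\<bar>)"
    proof (rule Bochner_Integration.integral_cong[OF refl])
      fix p assume "p \<in> space square_leb"
      then have p: "p \<in> unit_square" by simp
      show "\<bar>step_graphon N (\<lambda>i. \<phi> -` block N i \<inter> {0..1}) (block_avg N g) p - rearrange g \<phi> p\<bar>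
        = \<bar>step_graphon N (block N) (block_avg N g) (case p of (x, y) \<Rightarrow> (\<phi> x, \<phi> y)) - g (case p of (x, y) \<Rightarrow> (\<phi> x, \<phi> y))\<bar>"
        unfolding step_graphon_vimage[OF p] rearrange_eq ..
    qed
    also have "\<dots> = (LINT p|square_leb. \<bar>step_graphon N (block N) (block_avg N g) p - g p\<bar>)"
      by (rule integral_abs_rearrange[OF \<phi> step_graphon_measurable[OF A] graphon_measurable[OF g]])
    finally show ?thesis .
  qed
  then have "eventually (\<lambda>N. (LINT p|square_leb. \<bar>step_graphon N (block N) (block_avg N g) p - g p\<bar>) =
      (LINT p|square_leb. \<bar>step_graphon N (\<lambda>i. \<phi> -` block N i \<inter> {0..1}) (block_avg N g) p - rearrange g \<phi> p\<bar>)) sequentially"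
    by (intro eventually_sequentiallyI[of 1]) simp
  with block_approx_L1[OF g] show ?thesis by (rule Lim_transform_eventually)
qed

lemma lap_form_tendsto:
  assumes h: "\<And>n. h n \<in> graphons" and g: "g \<in> graphons" and u: "u \<in> L2_fun"
    and ae: "AE p in square_leb. (\<lambda>n. h n p) \<longlonglongrightarrow> g p"
  shows "(\<lambda>n. lap_form (h n) u) \<longlonglongrightarrow> lap_form g u"
  unfolding lap_form_def
proof (rule integral_dominated_convergence[where w = "\<lambda>p. 2 * (u (fst p))\<^sup>2 + 2 * (u (snd p))\<^sup>2"])
  have [measurable]: "u \<in> borel_measurable unit_leb" by (rule L2_fun_measurable[OF u])
  have [measurable]: "h n \<in> borel_measurable square_leb" "g \<in> borel_measurable square_leb" for n
    using h g by (auto intro: graphon_measurable)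
  show "(\<lambda>p. g p * (u (fst p) - u (snd p))\<^sup>2) \<in> borel_measurable square_leb"
    "(\<lambda>p. h n p * (u (fst p) - u (snd p))\<^sup>2) \<in> borel_measurable square_leb" for n
    by measurable
  show "integrable square_leb (\<lambda>p. 2 * (u (fst p))\<^sup>2 + 2 * (u (snd p))\<^sup>2)"
    by (rule integral_diff_squared_le(2)[OF u])
  show "AE p in square_leb. (\<lambda>n. h n p * (u (fst p) - u (snd p))\<^sup>2) \<longlonglongrightarrow> g p * (u (fst p) - u (snd p))\<^sup>2"
    using ae by eventually_elim (intro tendsto_mult tendsto_const)
  show "AE p in square_leb. norm (h n p * (u (fst p) - u (snd p))\<^sup>2) \<le> 2 * (u (fst p))\<^sup>2 + 2 * (u (snd p))\<^sup>2" for n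
  proof (rule AE_I2)
    fix p assume "p \<in> space square_leb"
    then have hp: "0 \<le> h n p \<and> h n p \<le> 1" using graphon_bounds[OF h, of p n] by (simp only: space_restrict_space) simp
    have "norm (h n p * (u (fst p) - u (snd p))\<^sup>2) = h n p * (u (fst p) - u (snd p))\<^sup>2" using hp by simp
    also have "\<dots> \<le> (u (fst p) - u (snd p))\<^sup>2" using hp by (intro mult_left_le_one_le) auto
    also have "\<dots> \<le> 2 * (u (fst p))\<^sup>2 + 2 * (u (snd p))\<^sup>2"
      using zero_le_power2[of "u (fst p) + u (snd p)"] by (simp add: power2_eq_square algebra_simps)
    finally show "norm (h n p * (u (fst p) - u (snd p))\<^sup>2) \<le> 2 * (u (fst p))\<^sup>2 + 2 * (u (snd p))\<^sup>2" .
  qed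
qed

text \<open>
  The rearranging map need not be invertible here: step graphons over the preimages of the blocks
  approximate the rearranged graphon, and their norm is controlled by the matrix of block averages.
\<close>

lemma block_bound_imp_laplacian_norm:
  assumes g: "g \<in> graphons" and \<phi>: "\<phi> \<in> mp_maps" and \<beta>: "\<beta> \<ge> 0" and bb: "block_bound \<beta> g"
  shows "laplacian_norm (rearrange g \<phi>) \<le> \<beta>"
proof (rule laplacian_norm_le[OF rearrange_graphon[OF \<phi> g] \<beta>])
  fix u assume u: "u \<in> L2_fun"
  define G where "G n = step_graphon (Suc n) (\<lambda>i. \<phi> -` block (Suc n) i \<inter> {0..1}) (block_avg (Suc n) g)" for n
  have A: "unit_partition (Suc n) (\<lambda>i. \<phi> -` block (Suc n) i \<inter> {0..1})" for n
    by (rule unit_partition_vimage[OF unit_partition_block \<phi>]) simp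
  have sym: "block_avg (Suc n) g i j = block_avg (Suc n) g j i" if "i < Suc n" "j < Suc n" for n i j
    by (rule block_avg_sym[OF g _ that]) simp
  have bd: "0 \<le> block_avg (Suc n) g i j \<and> block_avg (Suc n) g i j \<le> 1" if "i < Suc n" "j < Suc n" for n i j
    by (rule block_avg_bounds[OF g _ that]) simp
  have G: "G n \<in> graphons" for n
    unfolding G_def using bd sym by (rule step_graphon_in_graphons[OF A])
  have form: "(\<Sum>i<Suc n. \<Sum>j<Suc n. block_avg (Suc n) g i j * (v i - v j)\<^sup>2) \<le> 2 * real (Suc n) * \<beta> * (\<Sum>i<Suc n. (v i)\<^sup>2)" for n v
    using bb[unfolded block_bound_def, rule_format, of "Suc n" v] by simp
  define U where "U = (LINT x|unit_leb. (u x)\<^sup>2)"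
  \<comment> \<open>The degree bound of \<open>degree_le_of_form\<close> has an excess of one
    diagonal entry, at most 1; relative to the size \<open>Suc n\<close> of the matrix it costs
    \<open>1 / Suc n\<close>, which disappears in the limit.\<close>
  have GU: "lap_form (G n) u \<le> 2 * (\<beta> + 1 / Suc n) * U" for n
    unfolding G_def U_def
  proof (rule lap_form_step_graphon_le[OF A _ sym form])
    fix i assume i: "i < Suc n"
    have "(\<Sum>j<Suc n. block_avg (Suc n) g i j) \<le> Suc n * \<beta> + block_avg (Suc n) g i i"
      by (rule degree_le_of_form[OF sym i form])
    also have "\<dots> \<le> Suc n * \<beta> + 1" using bd[OF i i] by simp
    also have "\<dots> = real (Suc n) * (\<beta> + 1 / real (Suc n))" by (simp add: distrib_left)
    finally show "(\<Sum>j<Suc n. block_avg (Suc n) g i j) \<le> real (Suc n) * (\<beta> + 1 / real (Suc n))" .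
  qed (use \<beta> u in simp_all)
  have "(\<lambda>n. LINT p|square_leb. \<bar>G n p - rearrange g \<phi> p\<bar>) \<longlonglongrightarrow> 0"
    unfolding G_def by (rule LIMSEQ_Suc[OF vimage_block_approx_L1[OF g \<phi>]])
  moreover have "integrable square_leb (\<lambda>p. G n p - rearrange g \<phi> p)" for n
    by (intro Bochner_Integration.integrable_diff graphon_integrable G rearrange_graphon[OF \<phi> g])
  ultimately obtain s where s: "strict_mono s" and ae: "AE p in square_leb. (\<lambda>n. G (s n) p - rearrange g \<phi> p) \<longlonglongrightarrow> 0"
    using tendsto_L1_AE_subseq[of square_leb "\<lambda>n p. G n p - rearrange g \<phi> p"] by auto
  have "AE p in square_leb. (\<lambda>n. G (s n) p) \<longlonglongrightarrow> rearrange g \<phi> p"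
    using ae by eventually_elim (rule LIM_zero_cancel)
  then have lim: "(\<lambda>n. lap_form (G (s n)) u) \<longlonglongrightarrow> lap_form (rearrange g \<phi>) u"
    by (intro lap_form_tendsto G rearrange_graphon[OF \<phi> g] u)
  have "(\<lambda>n. 1 / real (Suc n)) \<longlonglongrightarrow> 0" by (rule LIMSEQ_Suc[OF lim_1_over_n])
  then have "(\<lambda>n. 1 / real (Suc (s n))) \<longlonglongrightarrow> 0"
    using LIMSEQ_subseq_LIMSEQ[OF _ s, of "\<lambda>n. 1 / real (Suc n)" 0] by (simp add: o_def)
  then have "(\<lambda>n. 2 * (\<beta> + 1 / Suc (s n)) * U) \<longlonglongrightarrow> 2 * (\<beta> + 0) * U"
    by (intro tendsto_intros)
  with lim have "lap_form (rearrange g \<phi>) u \<le> 2 * (\<beta> + 0) * U"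
    using GU by (rule_tac LIMSEQ_le) auto
  then show "lap_form (rearrange g \<phi>) u \<le> 2 * \<beta> * (LINT x|unit_leb. (u x)\<^sup>2)" by (simp add: U_def)
qed

lemma laplacian_norm_rearrange_le:
  assumes "h \<in> graphons" "\<phi> \<in> mp_maps" "laplacian_norm h \<le> \<beta>"
  shows "laplacian_norm (rearrange h \<phi>) \<le> \<beta>"
  using block_bound_imp_laplacian_norm[OF assms(1,2) _ laplacian_norm_imp_block_bound[OF assms(1,3)]]
    laplacian_norm_nonneg[OF assms(1)] assms(3) by simp

section \<open>Cut distance, cell integrals and minimizing rearrangements\<close>

lemma cut_distance_upper:
  assumes h: "h1 \<in> graphons" "h2 \<in> graphons" and S: "S \<in> sets unit_leb" "T \<in> sets unit_leb"
  shows "\<bar>LINT p|square_leb. (h1 p - h2 p) * (indicator S (fst p) * indicator T (snd p))\<bar> \<le> cut_distance h1 h2"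
proof -
  have eq: "(LINT p:S' \<times> T'|lebesgue. h1 p - h2 p)
      = (LINT p|square_leb. (h1 p - h2 p) * (indicator S' (fst p) * indicator T' (snd p)))"
    if ST: "S' \<in> sets unit_leb" "T' \<in> sets unit_leb" for S' T'
  proof -
    have sub: "S' \<times> T' \<subseteq> unit_square" using ST by (auto simp: sets_unit_leb_iff)
    have "(LINT p|square_leb. (h1 p - h2 p) * (indicator S' (fst p) * indicator T' (snd p)))
        = (LINT p|lebesgue. indicator unit_square p *\<^sub>R ((h1 p - h2 p) * (indicator S' (fst p) * indicator T' (snd p))))"
      by (subst integral_restrict_space) simp_all
    also have "\<dots> = (LINT p:S' \<times> T'|lebesgue. h1 p - h2 p)"
      unfolding set_lebesgue_integral_def using sub
      by (intro Bochner_Integration.integral_cong refl) (auto simp: indicator_def)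
    finally show ?thesis by simp
  qed
  have bdd: "\<bar>LINT p|square_leb. (h1 p - h2 p) * (indicator S' (fst p) * indicator T' (snd p))\<bar> \<le> 1"
    if ST: "S' \<in> sets unit_leb" "T' \<in> sets unit_leb" for S' T'
  proof -
    have m: "(\<lambda>p. (h1 p - h2 p) * (indicator S' (fst p) * indicator T' (snd p))) \<in> borel_measurable square_leb"
      using ST graphon_measurable[OF h(1)] graphon_measurable[OF h(2)] by measurable
    have b: "\<bar>(h1 p - h2 p) * (indicator S' (fst p) * indicator T' (snd p))\<bar> \<le> 1" if "p \<in> space square_leb" for p
    proof -
      have "p \<in> unit_square" using that by simp
      then have "\<bar>h1 p - h2 p\<bar> \<le> 1" using graphon_bounds[OF h(1), of p] graphon_bounds[OF h(2), of p] by linarith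
      then show ?thesis by (simp add: indicator_def)
    qed
    have i: "integrable square_leb (\<lambda>p. (h1 p - h2 p) * (indicator S' (fst p) * indicator T' (snd p)))"
      using b m by (intro square_leb.integrable_const_bound[of _ 1] AE_I2) simp_all
    have "\<bar>LINT p|square_leb. (h1 p - h2 p) * (indicator S' (fst p) * indicator T' (snd p))\<bar>
       \<le> (LINT p|square_leb. \<bar>(h1 p - h2 p) * (indicator S' (fst p) * indicator T' (snd p))\<bar>)"
      by (rule integral_abs_bound)
    also have "\<dots> \<le> (LINT p|square_leb. 1)"
      using b by (intro integral_mono integrable_abs i) simp_all
    finally show ?thesis by simp
  qed
  have "\<bar>LINT p:S \<times> T|lebesgue. h1 p - h2 p\<bar> \<le> cut_distance h1 h2"
    unfolding cut_distance_def
  proof (rule cSUP_upper2[of _ _ "(S, T)"])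
    show "bdd_above ((\<lambda>(S, T). \<bar>LINT p:S \<times> T|lebesgue. h1 p - h2 p\<bar>) ` (sets unit_leb \<times> sets unit_leb))"
    proof (rule bdd_aboveI2)
      fix x assume x: "x \<in> sets unit_leb \<times> sets unit_leb"
      obtain S' T' where "x = (S', T')" by (cases x)
      then show "(case x of (S, T) \<Rightarrow> \<bar>LINT p:S \<times> T|lebesgue. h1 p - h2 p\<bar>) \<le> 1"
        using x eq[of S' T'] bdd[of S' T'] by simp
    qed
  qed (use S in simp_all)
  then show ?thesis using eq[OF S] by simp
qed

lemma cell_cut_distance:
  assumes h: "h1 \<in> graphons" "h2 \<in> graphons" and A: "unit_partition N A" and N: "N \<ge> 1" and ij: "i < N" "j < N"
  shows "\<bar>(LINT p|square_leb. h1 p * cell A i j p) - (LINT p|square_leb. h2 p * cell A i j p)\<bar> \<le> cut_distance h1 h2"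
proof -
  have "(LINT p|square_leb. h1 p * cell A i j p) - (LINT p|square_leb. h2 p * cell A i j p)
      = (LINT p|square_leb. (h1 p - h2 p) * cell A i j p)"
    unfolding left_diff_distrib
    by (rule Bochner_Integration.integral_diff[symmetric])
       (rule integral_split_cells(1)[OF A N _ ij], rule graphon_integrable, rule h)+
  then show ?thesis
    using cut_distance_upper[OF h partition_sets[OF A ij(1)] partition_sets[OF A ij(2)]] by (simp add: cell_def)
qed

text \<open>The infimum in the cut-metric need not be attained, so vanishing of the metric yields
  only a sequence of bijections, here with cut distance below 1/(n + 1).\<close>

lemma cut_metric_zero_seq:
  assumes h: "h \<in> graphons" and g: "g \<in> graphons" and "cut_metric h g = 0"
  obtains \<phi> where "\<And>n. \<phi> n \<in> mp_bijections" "(\<lambda>n :: nat. cut_distance h (rearrange g (\<phi> n))) \<longlonglongrightarrow> 0"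
proof -
  have nn: "0 \<le> cut_distance h k" if "h \<in> graphons" "k \<in> graphons" for k
    using cut_distance_upper[OF that sets.empty_sets sets.empty_sets] by simp
  have ne: "mp_bijections \<noteq> {}" using id_mp_bijection by blast
  have "\<exists>\<phi>\<in>mp_bijections. cut_distance h (rearrange g \<phi>) < 1 / Suc n" for n
  proof -
    have "(INF \<phi>\<in>mp_bijections. cut_distance h (rearrange g \<phi>)) < 1 / Suc n"
      using assms(3) unfolding cut_metric_def by simp
    then show ?thesis
      by (subst (asm) cInf_less_iff) (use ne in \<open>auto intro!: bdd_belowI2[of _ 0] nn h rearrange_graphon g mp_bijections_subset\<close>)
  qed
  then obtain \<phi> where \<phi>: "\<And>n. \<phi> n \<in> mp_bijections" "\<And>n. cut_distance h (rearrange g (\<phi> n)) < 1 / Suc n"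
    by metis
  have "(\<lambda>n. cut_distance h (rearrange g (\<phi> n))) \<longlonglongrightarrow> 0"
  proof (rule tendsto_sandwich[of "\<lambda>_. 0" _ _ "\<lambda>n. 1 / real (Suc n)"])
    show "(\<lambda>n. 1 / real (Suc n)) \<longlonglongrightarrow> 0" by (rule LIMSEQ_Suc[OF lim_1_over_n])
    show "eventually (\<lambda>n. 0 \<le> cut_distance h (rearrange g (\<phi> n))) sequentially"
      by (intro always_eventually allI nn h rearrange_graphon g mp_bijections_subset \<phi>)
    show "eventually (\<lambda>n. cut_distance h (rearrange g (\<phi> n)) \<le> 1 / real (Suc n)) sequentially"
      using \<phi>(2) by (intro always_eventually allI less_imp_le)
  qed simp
  with \<phi>(1) show ?thesis by (rule that)
qed


section \<open>Cut-equivalent graphons\<close>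

lemma integral_rearrange_cell:
  assumes g: "g \<in> graphons" and \<phi>: "\<phi> \<in> mp_maps" and N: "N \<ge> 1" and ij: "i < N" "j < N"
  shows "(LINT p|square_leb. rearrange g \<phi> p * cell (\<lambda>i. \<phi> -` block N i \<inter> {0..1}) i j p)
       = (LINT p|square_leb. g p * cell (block N) i j p)"
proof -
  have m: "(\<lambda>p. g p * cell (block N) i j p) \<in> borel_measurable square_leb"
    using graphon_measurable[OF g] cell_measurable[OF unit_partition_block[OF N] ij] by measurable
  have "(LINT p|square_leb. rearrange g \<phi> p * cell (\<lambda>i. \<phi> -` block N i \<inter> {0..1}) i j p)
      = (LINT p|square_leb. g (case p of (x, y) \<Rightarrow> (\<phi> x, \<phi> y)) * cell (block N) i j (case p of (x, y) \<Rightarrow> (\<phi> x, \<phi> y)))"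
  proof (rule Bochner_Integration.integral_cong[OF refl])
    fix p assume "p \<in> space square_leb"
    then have "p \<in> unit_square" by simp
    then show "rearrange g \<phi> p * cell (\<lambda>i. \<phi> -` block N i \<inter> {0..1}) i j p
        = g (case p of (x, y) \<Rightarrow> (\<phi> x, \<phi> y)) * cell (block N) i j (case p of (x, y) \<Rightarrow> (\<phi> x, \<phi> y))"
      by (simp only: cell_vimage rearrange_eq)
  qed
  also have "\<dots> = (LINT p|square_leb. g p * cell (block N) i j p)"
    by (rule integral_mp_square[OF \<phi> m])
  finally show ?thesis .
qed

text \<open>The partition is pulled back by \<phi> instead of moving \<open>h\<close> by an inverse:
  the integral of \<open>g\<close> over a block cell is that of the rearranged \<open>g\<close> over
  the preimage cell, which is a rectangle and hence a test set for the cut distance to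
  \<open>h\<close>.\<close>

lemma rearranged_cell_cut_distance:
  assumes h: "h \<in> graphons" and g: "g \<in> graphons" and \<phi>: "\<phi> \<in> mp_maps" and N: "N \<ge> 1" and ij: "i < N" "j < N"
  shows "(LINT p|square_leb. g p * cell (block N) i j p)
    \<le> (LINT p|square_leb. h p * cell (\<lambda>i. \<phi> -` block N i \<inter> {0..1}) i j p) + cut_distance h (rearrange g \<phi>)"
  using cell_cut_distance[OF h rearrange_graphon[OF \<phi> g] unit_partition_vimage[OF unit_partition_block[OF N] \<phi>] N ij]
  unfolding integral_rearrange_cell[OF g \<phi> N ij] by linarith

text \<open>The constraint on \<open>h\<close> holds over every partition, hence over the preimages
  of the blocks under each rearrangement. Passing from \<open>h\<close> to \<open>g\<close> costs
  \<open>c\<close> times the cut distance, and \<open>c\<close> depends only on \<open>v\<close> and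
  \<open>N\<close>, so the cost tends to 0 along the sequence.\<close>

lemma cut_equivalent_block_bound:
  assumes h: "h \<in> graphons" and g: "g \<in> graphons" and 0: "cut_metric h g = 0" and norm: "laplacian_norm h \<le> \<beta>"
  shows "block_bound \<beta> g"
  unfolding block_bound_iff_cells
proof (intro allI impI)
  fix N :: nat and v :: "nat \<Rightarrow> real" assume N: "N \<ge> 1"
  obtain \<phi> where \<phi>: "\<And>n. \<phi> n \<in> mp_bijections" and lim: "(\<lambda>n :: nat. cut_distance h (rearrange g (\<phi> n))) \<longlonglongrightarrow> 0"
    by (rule cut_metric_zero_seq[OF h g 0]) (rule that)
  define c where "c = (\<Sum>i<N. \<Sum>j<N. (v i - v j)\<^sup>2)"
  define R where "R = 2 * \<beta> * ((\<Sum>i<N. (v i)\<^sup>2) / N)"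
  let ?L = "\<Sum>i<N. \<Sum>j<N. (v i - v j)\<^sup>2 * (LINT p|square_leb. g p * cell (block N) i j p)"
  have "?L \<le> R + c * cut_distance h (rearrange g (\<phi> n))" for n
  proof -
    let ?A = "\<lambda>i. \<phi> n -` block N i \<inter> {0..1}"
    have p: "\<phi> n \<in> mp_maps" by (rule mp_bijections_subset[OF \<phi>])
    have "?L \<le> (\<Sum>i<N. \<Sum>j<N. (v i - v j)\<^sup>2 * ((LINT p|square_leb. h p * cell ?A i j p) + cut_distance h (rearrange g (\<phi> n))))"
      by (intro sum_mono mult_left_mono rearranged_cell_cut_distance[OF h g p N]) auto
    also have "\<dots> = (\<Sum>i<N. \<Sum>j<N. (v i - v j)\<^sup>2 * (LINT p|square_leb. h p * cell ?A i j p)) + c * cut_distance h (rearrange g (\<phi> n))"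
      by (simp only: distrib_left sum.distrib c_def sum_distrib_right)
    also have "\<dots> \<le> R + c * cut_distance h (rearrange g (\<phi> n))"
      unfolding R_def using cell_form_le[OF h norm unit_partition_vimage[OF unit_partition_block[OF N] p] N, of v] by simp
    finally show ?thesis .
  qed
  moreover have "(\<lambda>n. R + c * cut_distance h (rearrange g (\<phi> n))) \<longlonglongrightarrow> R + c * 0"
    by (intro tendsto_intros lim)
  ultimately have "?L \<le> R + c * 0" by (intro LIMSEQ_le_const) auto
  then show "?L \<le> 2 * \<beta> * ((\<Sum>i<N. (v i)\<^sup>2) / N)" by (simp add: R_def)
qed

lemma graphon_mult_integrable:
  assumes "h \<in> graphons" "k \<in> graphons"
  shows "integrable square_leb (\<lambda>p. h p * k p)"
  by (rule integrable_graphon_mult[OF assms(1) graphon_integrable[OF assms(2)]])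

lemma integral_mult_step_graphon:
  assumes h: "h \<in> graphons" and A: "unit_partition N A" and N: "N \<ge> 1"
  shows "integrable square_leb (\<lambda>p. h p * step_graphon N A q p)"
    and "(LINT p|square_leb. h p * step_graphon N A q p) = (\<Sum>i<N. \<Sum>j<N. q i j * (LINT p|square_leb. h p * cell A i j p))"
proof -
  have i: "integrable square_leb (\<lambda>p. h p * cell A i j p)" if "i < N" "j < N" for i j
    by (rule integral_split_cells(1)[OF A N graphon_integrable[OF h] that])
  have eq: "h p * step_graphon N A q p = (\<Sum>i<N. \<Sum>j<N. q i j * (h p * cell A i j p))" for p
    unfolding step_graphon_def sum_distrib_left by (intro sum.cong refl) (rule mult.left_commute)
  have ii: "integrable square_leb (\<lambda>p. \<Sum>j<N. q i j * (h p * cell A i j p))" if "i < N" for i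
    using i[OF that] by (intro Bochner_Integration.integrable_sum integrable_mult_right) simp
  show "integrable square_leb (\<lambda>p. h p * step_graphon N A q p)"
    unfolding eq by (intro Bochner_Integration.integrable_sum integrable_mult_right i) simp_all
  have "(LINT p|square_leb. (\<Sum>j<N. q i j * (h p * cell A i j p))) = (\<Sum>j<N. q i j * (LINT p|square_leb. h p * cell A i j p))"
    if "i < N" for i
    using i[OF that] by (subst Bochner_Integration.integral_sum) simp_all
  moreover have "(LINT p|square_leb. (\<Sum>i<N. \<Sum>j<N. q i j * (h p * cell A i j p)))
     = (\<Sum>i<N. LINT p|square_leb. (\<Sum>j<N. q i j * (h p * cell A i j p)))"
    using ii by (intro Bochner_Integration.integral_sum) simp
  ultimately show "(LINT p|square_leb. h p * step_graphon N A q p) = (\<Sum>i<N. \<Sum>j<N. q i j * (LINT p|square_leb. h p * cell A i j p))"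
    unfolding eq by simp
qed

lemma abs_integral_mult_le:
  fixes f k :: "real \<times> real \<Rightarrow> real"
  assumes f: "f \<in> borel_measurable square_leb" "\<And>p. p \<in> unit_square \<Longrightarrow> \<bar>f p\<bar> \<le> 1"
    and k: "integrable square_leb k"
  shows "\<bar>LINT p|square_leb. f p * k p\<bar> \<le> (LINT p|square_leb. \<bar>k p\<bar>)" "integrable square_leb (\<lambda>p. f p * k p)"
proof -
  have b: "\<bar>f p * k p\<bar> \<le> \<bar>k p\<bar>" if "p \<in> space square_leb" for p
  proof -
    have "p \<in> unit_square" using that by simp
    then show ?thesis using f(2)[of p] by (simp add: abs_mult mult_left_le_one_le)
  qed
  have m: "(\<lambda>p. f p * k p) \<in> borel_measurable square_leb" using f(1) k by measurable
  show i: "integrable square_leb (\<lambda>p. f p * k p)"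
    using b by (intro Bochner_Integration.integrable_bound[OF k m] AE_I2) simp
  have "\<bar>LINT p|square_leb. f p * k p\<bar> \<le> (LINT p|square_leb. \<bar>f p * k p\<bar>)" by (rule integral_abs_bound)
  also have "\<dots> \<le> (LINT p|square_leb. \<bar>k p\<bar>)" using b i k by (intro integral_mono) auto
  finally show "\<bar>LINT p|square_leb. f p * k p\<bar> \<le> (LINT p|square_leb. \<bar>k p\<bar>)" .
qed

lemma graphon_abs_le_1: "h \<in> graphons \<Longrightarrow> p \<in> unit_square \<Longrightarrow> \<bar>h p\<bar> \<le> 1"
  using graphon_bounds[of h p] by simp

lemma graphon_diff_abs_le_1: "h \<in> graphons \<Longrightarrow> k \<in> graphons \<Longrightarrow> p \<in> unit_square \<Longrightarrow> \<bar>h p - k p\<bar> \<le> 1"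
  using graphon_bounds[of h p] graphon_bounds[of k p] by linarith

lemma block_avg_cell:
  assumes "N \<ge> 1"
  shows "(LINT p|square_leb. h p * cell (block N) i j p) = block_avg N h i j / (real N)\<^sup>2"
  using assms by (simp add: block_avg_def)

text \<open>Lower semicontinuity of the L^2 norm, made explicit. \<open>S N\<close> is the squared
  norm of the block averages of \<open>g\<close>, and also the pairing of \<open>g\<close> with
  them. Up to the cut distance it equals the pairing of \<open>h\<close> with the pulled-back step
  graphon, whose squared norm is again \<open>S N\<close>. This gives \<open>S N \<le> H\<close>,
  and \<open>S N\<close> approaches the squared norm of \<open>g\<close>.\<close>

lemma cut_equivalent_square_integral_le:
  assumes h: "h \<in> graphons" and g: "g \<in> graphons" and 0: "cut_metric h g = 0"
  shows "(LINT p|square_leb. g p * g p) \<le> (LINT p|square_leb. h p * h p)"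
proof -
  obtain \<phi> where \<phi>: "\<And>n. \<phi> n \<in> mp_bijections" and lim: "(\<lambda>n :: nat. cut_distance h (rearrange g (\<phi> n))) \<longlonglongrightarrow> 0"
    by (rule cut_metric_zero_seq[OF h g 0]) (rule that)
  define H where "H = (LINT p|square_leb. h p * h p)"
  define S where "S N = (\<Sum>i<N. \<Sum>j<N. (block_avg N g i j)\<^sup>2) / (real N)\<^sup>2" for N
  have SH: "S N \<le> H" if N: "N \<ge> 1" for N
  proof -
    note B = unit_partition_block[OF N]
    define c where "c = (\<Sum>i<N. \<Sum>j<N. block_avg N g i j)"
    have "S N \<le> H / 2 + S N / 2 + c * cut_distance h (rearrange g (\<phi> n))" for n
    proof -
      let ?A = "\<lambda>i. \<phi> n -` block N i \<inter> {0..1}"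
      have p: "\<phi> n \<in> mp_maps" by (rule mp_bijections_subset[OF \<phi>])
      note A = unit_partition_vimage[OF B p]
      let ?s = "step_graphon N ?A (block_avg N g)"
      have sg: "?s \<in> graphons"
        by (rule step_graphon_in_graphons[OF A block_avg_bounds[OF g N] block_avg_sym[OF g N]])
      have "S N = (\<Sum>i<N. \<Sum>j<N. block_avg N g i j * (LINT p|square_leb. g p * cell (block N) i j p))"
        unfolding S_def block_avg_cell[OF N] by (simp add: power2_eq_square sum_divide_distrib)
      also have "\<dots> \<le> (\<Sum>i<N. \<Sum>j<N. block_avg N g i j * ((LINT p|square_leb. h p * cell ?A i j p) + cut_distance h (rearrange g (\<phi> n))))"
        using block_avg_bounds[OF g N]
        by (intro sum_mono mult_left_mono rearranged_cell_cut_distance[OF h g p N]) auto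
      also have "\<dots> = (LINT p|square_leb. h p * ?s p) + c * cut_distance h (rearrange g (\<phi> n))"
        by (simp only: distrib_left sum.distrib c_def sum_distrib_right integral_mult_step_graphon(2)[OF h A N])
      \<comment> \<open>Cauchy-Schwarz in additive form; the half of \<open>S N\<close> that it
        produces is absorbed on the left once \<open>n\<close> has gone to infinity.\<close>
      also have "(LINT p|square_leb. h p * ?s p) \<le> (LINT p|square_leb. (h p * h p) / 2 + (?s p)\<^sup>2 / 2)"
      proof (intro integral_mono integral_mult_step_graphon(1)[OF h A N])
        show "integrable square_leb (\<lambda>p. (h p * h p) / 2 + (?s p)\<^sup>2 / 2)"
          using graphon_mult_integrable[OF h h] graphon_mult_integrable[OF sg sg] by (simp add: power2_eq_square)
        show "h p * ?s p \<le> (h p * h p) / 2 + (?s p)\<^sup>2 / 2" for p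
          using sum_squares_bound[of "h p" "?s p"] by (simp add: power2_eq_square)
      qed
      also have "\<dots> = H / 2 + (LINT p|square_leb. (?s p)\<^sup>2) / 2"
        using graphon_mult_integrable[OF h h] graphon_mult_integrable[OF sg sg] by (simp add: H_def power2_eq_square)
      also have "(LINT p|square_leb. (?s p)\<^sup>2) = S N"
        unfolding S_def
        by (rule integral_fun_step_graphon[OF A N]) (use graphon_mult_integrable[OF sg sg] in \<open>simp add: power2_eq_square\<close>)
      finally show ?thesis by simp
    qed
    moreover have "(\<lambda>n. H / 2 + S N / 2 + c * cut_distance h (rearrange g (\<phi> n))) \<longlonglongrightarrow> H / 2 + S N / 2 + c * 0"
      by (intro tendsto_add tendsto_mult tendsto_const lim)
    ultimately have "S N \<le> H / 2 + S N / 2 + c * 0" by (intro LIMSEQ_le_const) auto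
    then show ?thesis by simp
  qed
  have S_g: "(LINT p|square_leb. g p * g p) - S N \<le> (LINT p|square_leb. \<bar>step_graphon N (block N) (block_avg N g) p - g p\<bar>)"
    if N: "N \<ge> 1" for N
  proof -
    note A = unit_partition_block[OF N]
    let ?s = "step_graphon N (block N) (block_avg N g)"
    have "S N = (LINT p|square_leb. g p * ?s p)"
      unfolding S_def integral_mult_step_graphon(2)[OF g A N] block_avg_cell[OF N]
      by (simp add: power2_eq_square sum_divide_distrib)
    then have "(LINT p|square_leb. g p * g p) - S N = (LINT p|square_leb. g p * g p - g p * ?s p)"
      using graphon_mult_integrable[OF g g] integral_mult_step_graphon(1)[OF g A N] by simp
    also have "\<dots> = - (LINT p|square_leb. g p * (?s p - g p))"
      by (simp only: Bochner_Integration.integral_minus[symmetric] right_diff_distrib minus_diff_eq)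
    also have "\<dots> \<le> (LINT p|square_leb. \<bar>?s p - g p\<bar>)"
      using abs_integral_mult_le(1)[OF graphon_measurable[OF g] graphon_abs_le_1[OF g], of "\<lambda>p. ?s p - g p"]
        integrable_step_graphon[OF A] graphon_integrable[OF g] by simp
    finally show ?thesis .
  qed
  have "(\<lambda>N. H + (LINT p|square_leb. \<bar>step_graphon N (block N) (block_avg N g) p - g p\<bar>)) \<longlonglongrightarrow> H + 0"
    by (intro tendsto_add tendsto_const block_approx_L1[OF g])
  moreover have "\<exists>M. \<forall>N\<ge>M. (LINT p|square_leb. g p * g p)
      \<le> H + (LINT p|square_leb. \<bar>step_graphon N (block N) (block_avg N g) p - g p\<bar>)"
  proof (intro exI[of _ 1] allI impI)
    fix N :: nat assume N: "1 \<le> N"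
    show "(LINT p|square_leb. g p * g p) \<le> H + (LINT p|square_leb. \<bar>step_graphon N (block N) (block_avg N g) p - g p\<bar>)"
      using S_g[OF N] SH[OF N] by linarith
  qed
  ultimately have "(LINT p|square_leb. g p * g p) \<le> H + 0" by (rule LIMSEQ_le_const)
  then show ?thesis by (simp add: H_def)
qed

text \<open>
  Rearrangements of \<open>g\<close> that converge to \<open>h\<close> in the cut metric converge weakly in \<open>L\<^sup>2\<close>; as the
  \<open>L\<^sup>2\<close> norms do not drop in the limit, they converge strongly.
\<close>

lemma cut_equivalent_L2_seq:
  assumes h: "h \<in> graphons" and g: "g \<in> graphons" and 0: "cut_metric h g = 0"
  obtains \<phi> where "\<And>n :: nat. \<phi> n \<in> mp_bijections" "AE p in square_leb. (\<lambda>n. rearrange g (\<phi> n) p) \<longlonglongrightarrow> h p"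
proof -
  obtain \<phi> where \<phi>: "\<And>n. \<phi> n \<in> mp_bijections" and lim: "(\<lambda>n :: nat. cut_distance h (rearrange g (\<phi> n))) \<longlonglongrightarrow> 0"
    by (rule cut_metric_zero_seq[OF h g 0]) (rule that)
  have p: "\<phi> n \<in> mp_maps" for n by (rule mp_bijections_subset[OF \<phi>])
  have gn: "rearrange g (\<phi> n) \<in> graphons" for n by (rule rearrange_graphon[OF p g])
  define D where "D n = (LINT p|square_leb. (rearrange g (\<phi> n) p - h p) * (rearrange g (\<phi> n) p - h p))" for n
  define e where "e N = (LINT p|square_leb. \<bar>step_graphon N (block N) (block_avg N h) p - h p\<bar>)" for N
  have D0: "0 \<le> D n" for n unfolding D_def by (rule Bochner_Integration.integral_nonneg) simp
  \<comment> \<open>As the rearranged \<open>g\<close> has the L^2 norm of \<open>g\<close>, at most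
    that of \<open>h\<close>, expanding the square leaves twice the pairing of \<open>h - ?k\<close>
    with \<open>h\<close>. There the second \<open>h\<close> is exchanged for its block averages:
    the pairing with those is a sum over N^2 cells, each bounded by the cut distance, and the
    exchange costs at most \<open>e N\<close>.\<close>
  have D_le: "D n \<le> 2 * (e N + (real N)\<^sup>2 * cut_distance h (rearrange g (\<phi> n)))" if N: "N \<ge> 1" for n N
  proof -
    let ?k = "rearrange g (\<phi> n)"
    note A = unit_partition_block[OF N]
    let ?s = "step_graphon N (block N) (block_avg N h)"
    have kk: "(LINT p|square_leb. ?k p * ?k p) = (LINT p|square_leb. g p * g p)"
      unfolding rearrange_eq using graphon_measurable[OF g]
      by (intro integral_mp_square[OF p, of "\<lambda>p. g p * g p"]) measurable
    have "D n = (LINT p|square_leb. ?k p * ?k p - 2 * (?k p * h p) + h p * h p)"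
      unfolding D_def by (intro Bochner_Integration.integral_cong refl) (simp add: algebra_simps)
    also have "\<dots> = (LINT p|square_leb. ?k p * ?k p) - 2 * (LINT p|square_leb. ?k p * h p) + (LINT p|square_leb. h p * h p)"
      using graphon_mult_integrable[OF gn[of n] gn[of n]] graphon_mult_integrable[OF gn[of n] h] graphon_mult_integrable[OF h h]
      by simp
    also have "\<dots> \<le> 2 * ((LINT p|square_leb. h p * h p) - (LINT p|square_leb. ?k p * h p))"
      unfolding kk using cut_equivalent_square_integral_le[OF h g 0] by simp
    also have "(LINT p|square_leb. h p * h p) - (LINT p|square_leb. ?k p * h p)
       = (LINT p|square_leb. h p * h p - ?k p * h p)"
      using graphon_mult_integrable[OF gn[of n] h] graphon_mult_integrable[OF h h] by simp
    also have "\<dots> = (LINT p|square_leb. (h p * ?s p - ?k p * ?s p) - (h p - ?k p) * (?s p - h p))"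
      by (intro Bochner_Integration.integral_cong refl) (simp add: algebra_simps)
    also have "\<dots> = ((LINT p|square_leb. h p * ?s p) - (LINT p|square_leb. ?k p * ?s p)) - (LINT p|square_leb. (h p - ?k p) * (?s p - h p))"
    proof -
      have i: "integrable square_leb (\<lambda>p. (h p - ?k p) * (?s p - h p))"
        by (rule abs_integral_mult_le(2))
           (use graphon_measurable[OF h] graphon_measurable[OF gn[of n]] graphon_diff_abs_le_1[OF h gn[of n]]
             integrable_step_graphon[OF A] graphon_integrable[OF h] in simp_all)
      show ?thesis
        unfolding Bochner_Integration.integral_diff[OF Bochner_Integration.integrable_diff[OF
            integral_mult_step_graphon(1)[OF h A N] integral_mult_step_graphon(1)[OF gn A N]] i]
          Bochner_Integration.integral_diff[OF integral_mult_step_graphon(1)[OF h A N] integral_mult_step_graphon(1)[OF gn A N]] ..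
    qed
    finally have "D n \<le> 2 * (((LINT p|square_leb. h p * ?s p) - (LINT p|square_leb. ?k p * ?s p))
        - (LINT p|square_leb. (h p - ?k p) * (?s p - h p)))" .
    moreover have "(LINT p|square_leb. h p * ?s p) - (LINT p|square_leb. ?k p * ?s p) \<le> (real N)\<^sup>2 * cut_distance h ?k"
    proof -
      have "(LINT p|square_leb. h p * ?s p) - (LINT p|square_leb. ?k p * ?s p)
        = (\<Sum>i<N. \<Sum>j<N. block_avg N h i j * ((LINT p|square_leb. h p * cell (block N) i j p) - (LINT p|square_leb. ?k p * cell (block N) i j p)))"
        unfolding integral_mult_step_graphon(2)[OF h A N] integral_mult_step_graphon(2)[OF gn A N]
        by (simp only: sum_subtractf right_diff_distrib)
      also have "\<dots> \<le> (\<Sum>i<N. \<Sum>j<N. cut_distance h ?k)"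
      proof (intro sum_mono)
        fix i j assume "i \<in> {..<N}" "j \<in> {..<N}"
        then have ij: "i < N" "j < N" by auto
        let ?x = "(LINT p|square_leb. h p * cell (block N) i j p) - (LINT p|square_leb. ?k p * cell (block N) i j p)"
        have "block_avg N h i j * ?x \<le> block_avg N h i j * \<bar>?x\<bar>"
          using block_avg_bounds[OF h N ij] by (intro mult_left_mono) auto
        also have "\<dots> \<le> \<bar>?x\<bar>" using block_avg_bounds[OF h N ij] by (intro mult_left_le_one_le) auto
        also have "\<dots> \<le> cut_distance h ?k" by (rule cell_cut_distance[OF h gn A N ij])
        finally show "block_avg N h i j * ?x \<le> cut_distance h ?k" .
      qed
      also have "\<dots> = (real N)\<^sup>2 * cut_distance h ?k" by (simp add: power2_eq_square)
      finally show ?thesis .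
    qed
    moreover have "- (LINT p|square_leb. (h p - ?k p) * (?s p - h p)) \<le> e N"
    proof -
      have "\<bar>LINT p|square_leb. (h p - ?k p) * (?s p - h p)\<bar> \<le> e N"
        unfolding e_def
        by (rule abs_integral_mult_le(1))
           (use graphon_measurable[OF h] graphon_measurable[OF gn[of n]] graphon_diff_abs_le_1[OF h gn[of n]]
             integrable_step_graphon[OF A] graphon_integrable[OF h] in simp_all)
      then show ?thesis by linarith
    qed
    moreover have "d \<le> 2 * (y + x)" if "d \<le> 2 * (a - c)" "a \<le> x" "- c \<le> y" for d a c x y :: real
      using that by (simp add: algebra_simps)
    ultimately show ?thesis by blast
  qed
  have "D \<longlonglongrightarrow> 0"
  proof (rule LIMSEQ_I)
    fix \<epsilon> :: real assume \<epsilon>: "\<epsilon> > 0"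
    \<comment> \<open>Order of choices: \<open>N\<close> first, for a small approximation error, and
      only then \<open>n\<close>, because the cut distance is multiplied by N^2.\<close>
    have "e \<longlonglongrightarrow> 0" unfolding e_def by (rule block_approx_L1[OF h])
    then have "eventually (\<lambda>N. e N < \<epsilon> / 4 \<and> N \<ge> 1) sequentially"
      using \<epsilon> by (intro eventually_conj order_tendstoD(2) eventually_ge_at_top) auto
    then obtain N where N: "e N < \<epsilon> / 4" "N \<ge> 1" by (auto simp: eventually_sequentially)
    have "(\<lambda>n. (real N)\<^sup>2 * cut_distance h (rearrange g (\<phi> n))) \<longlonglongrightarrow> (real N)\<^sup>2 * 0"
      by (intro tendsto_mult tendsto_const lim)
    then have "eventually (\<lambda>n. (real N)\<^sup>2 * cut_distance h (rearrange g (\<phi> n)) < \<epsilon> / 4) sequentially"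
      using \<epsilon> by (intro order_tendstoD(2)) auto
    then obtain M where M: "\<And>n. n \<ge> M \<Longrightarrow> (real N)\<^sup>2 * cut_distance h (rearrange g (\<phi> n)) < \<epsilon> / 4"
      by (auto simp: eventually_sequentially)
    have "norm (D n - 0) < \<epsilon>" if "n \<ge> M" for n
      using D_le[OF N(2), of n] M[OF that] N(1) D0[of n] by simp
    then show "\<exists>M. \<forall>n\<ge>M. norm (D n - 0) < \<epsilon>" by blast
  qed
  moreover have "integrable square_leb (\<lambda>p. (rearrange g (\<phi> n) p - h p) * (rearrange g (\<phi> n) p - h p))" for n
    by (rule abs_integral_mult_le(2))
       (use graphon_measurable[OF h] graphon_measurable[OF gn[of n]] graphon_diff_abs_le_1[OF gn[of n] h]
         graphon_integrable[OF h] graphon_integrable[OF gn[of n]] in simp_all)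
  ultimately obtain s where "AE p in square_leb. (\<lambda>n. (rearrange g (\<phi> (s n)) p - h p) * (rearrange g (\<phi> (s n)) p - h p)) \<longlonglongrightarrow> 0"
    using tendsto_L1_AE_subseq[of square_leb "\<lambda>n p. (rearrange g (\<phi> n) p - h p) * (rearrange g (\<phi> n) p - h p)"]
    unfolding D_def[abs_def] by (auto simp: abs_mult_self_eq)
  then have "AE p in square_leb. (\<lambda>n. rearrange g (\<phi> (s n)) p) \<longlonglongrightarrow> h p"
  proof eventually_elim
    case (elim p)
    have "(\<lambda>n. (rearrange g (\<phi> (s n)) p - h p)\<^sup>2) \<longlonglongrightarrow> 0" using elim by (simp only: power2_eq_square)
    then have "(\<lambda>n. sqrt ((rearrange g (\<phi> (s n)) p - h p)\<^sup>2)) \<longlonglongrightarrow> sqrt 0" by (rule tendsto_real_sqrt)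
    then have "(\<lambda>n. \<bar>rearrange g (\<phi> (s n)) p - h p\<bar>) \<longlonglongrightarrow> 0" by simp
    then have "(\<lambda>n. rearrange g (\<phi> (s n)) p - h p) \<longlonglongrightarrow> 0" by (rule tendsto_rabs_zero_cancel)
    then show ?case by (rule LIM_zero_cancel)
  qed
  then show ?thesis by (intro that[of "\<lambda>n. \<phi> (s n)"] \<phi>)
qed


section \<open>The rate function\<close>

lemma rel_entropy_expand:
  assumes "0 \<le> a" "a \<le> 1" "0 < b" "b < 1"
  shows "rel_entropy a b = a * ln a + (1 - a) * ln (1 - a) - a * ln b - (1 - a) * ln (1 - b)"
proof -
  have "a * ln (a / b) = a * ln a - a * ln b"
    using assms by (cases "a = 0") (simp_all add: ln_div right_diff_distrib)
  moreover have "(1 - a) * ln ((1 - a) / (1 - b)) = (1 - a) * ln (1 - a) - (1 - a) * ln (1 - b)"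
    using assms by (cases "a = 1") (simp_all add: ln_div right_diff_distrib)
  ultimately show ?thesis by (simp add: rel_entropy_def)
qed

lemma rel_entropy_nonneg:
  assumes "0 \<le> a" "a \<le> 1" "0 < b" "b < 1"
  shows "0 \<le> rel_entropy a b"
  using gibbs_term[of a b 1] gibbs_term[of "1 - a" "1 - b" 1] assms by (simp add: rel_entropy_def)

lemma mult_ln_nonpos: "0 \<le> a \<Longrightarrow> a \<le> 1 \<Longrightarrow> a * ln a \<le> (0 :: real)"
  by (cases "a = 0") (simp_all add: mult_nonneg_nonpos)

lemma rel_entropy_le:
  assumes "0 \<le> a" "a \<le> 1" "0 < b" "b < 1"
  shows "rel_entropy a b \<le> \<bar>ln b\<bar> + \<bar>ln (1 - b)\<bar>"
proof -
  have "- (a * ln b) \<le> \<bar>ln b\<bar>"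
    using assms mult_left_le_one_le[of "- ln b" a] by (simp add: ln_less_zero less_imp_le)
  moreover have "- ((1 - a) * ln (1 - b)) \<le> \<bar>ln (1 - b)\<bar>"
    using assms mult_left_le_one_le[of "- ln (1 - b)" "1 - a"] by (simp add: ln_less_zero less_imp_le)
  moreover have "a * ln a \<le> 0" "(1 - a) * ln (1 - a) \<le> 0"
    using assms by (auto intro!: mult_ln_nonpos)
  ultimately show ?thesis unfolding rel_entropy_expand[OF assms] by linarith
qed

text \<open>The reference value enters the entropy affinely through its two logarithms, with
  coefficients \<open>a\<close> and \<open>1 - a\<close> in the unit interval. Convergence of the
  logarithms in L^1 therefore controls the rate uniformly over all graphons.\<close>

lemma rel_entropy_diff_le:
  assumes "0 \<le> a" "a \<le> 1" "0 < b" "b < 1" "0 < b'" "b' < 1"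
  shows "\<bar>rel_entropy a b - rel_entropy a b'\<bar> \<le> \<bar>ln b - ln b'\<bar> + \<bar>ln (1 - b) - ln (1 - b')\<bar>"
proof -
  have "rel_entropy a b - rel_entropy a b' = - (a * (ln b - ln b')) - (1 - a) * (ln (1 - b) - ln (1 - b'))"
    using assms by (simp add: rel_entropy_expand algebra_simps)
  then have "\<bar>rel_entropy a b - rel_entropy a b'\<bar> \<le> \<bar>a * (ln b - ln b')\<bar> + \<bar>(1 - a) * (ln (1 - b) - ln (1 - b'))\<bar>"
    using abs_triangle_ineq4[of "- (a * (ln b - ln b'))"] by simp
  also have "\<bar>a * (ln b - ln b')\<bar> \<le> \<bar>ln b - ln b'\<bar>"
    using assms by (simp add: abs_mult mult_left_le_one_le)
  also have "\<bar>(1 - a) * (ln (1 - b) - ln (1 - b'))\<bar> \<le> \<bar>ln (1 - b) - ln (1 - b')\<bar>"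
    using assms by (simp add: abs_mult mult_left_le_one_le)
  finally show ?thesis by simp
qed

text \<open>With s = sqrt x one has - x ln x = 2 s^2 (- ln s), and - ln s \<le> 1/s. It supplies
  continuity of x ln x at 0, where \<open>ln\<close> itself is discontinuous.\<close>

lemma abs_mult_ln_le:
  assumes "0 \<le> x" "x \<le> (1::real)"
  shows "\<bar>x * ln x\<bar> \<le> 2 * sqrt x"
proof (cases "x = 0")
  case False
  then have x: "x > 0" using assms by simp
  define s where "s = sqrt x"
  have s: "s > 0" "x = s * s" using x by (simp_all add: s_def)
  have "ln (1 / s) \<le> 1 / s - 1" using s by (intro ln_le_minus_one) simp
  then have "- ln s \<le> 1 / s" using s by (simp add: ln_div)
  then have "s * (2 * (s * (- ln s))) \<le> s * (2 * (s * (1 / s)))"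
    using s by (intro mult_left_mono) auto
  then have "- (x * ln x) \<le> 2 * s" using s by (simp add: ln_mult algebra_simps)
  then show ?thesis using mult_ln_nonpos[OF assms] by (simp add: s_def)
qed simp

lemma tendsto_mult_ln:
  assumes "x \<longlonglongrightarrow> (a::real)" "\<And>n. 0 \<le> x n \<and> x n \<le> 1"
  shows "(\<lambda>n. x n * ln (x n)) \<longlonglongrightarrow> a * ln a"
proof (cases "a = 0")
  case True
  have "(\<lambda>n. 2 * sqrt (x n)) \<longlonglongrightarrow> 2 * sqrt 0"
    using assms(1) True by (intro tendsto_mult tendsto_real_sqrt tendsto_const) simp
  then have "(\<lambda>n. 2 * sqrt (x n)) \<longlonglongrightarrow> 0" by simp
  then have "(\<lambda>n. x n * ln (x n)) \<longlonglongrightarrow> 0"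
    by (rule Lim_null_comparison[rotated]) (use abs_mult_ln_le assms(2) in \<open>auto intro!: always_eventually\<close>)
  then show ?thesis using True by simp
next
  case False
  then show ?thesis using assms(1) by (intro tendsto_mult tendsto_ln)
qed

lemma rel_entropy_tendsto:
  assumes x: "x \<longlonglongrightarrow> a" "\<And>n. 0 \<le> x n \<and> x n \<le> 1" and b: "0 < b" "b < 1"
  shows "(\<lambda>n. rel_entropy (x n) b) \<longlonglongrightarrow> rel_entropy a b"
proof -
  have a: "0 \<le> a" "a \<le> 1"
    using x by (auto intro: LIMSEQ_le_const LIMSEQ_le_const2)
  have y: "(\<lambda>n. 1 - x n) \<longlonglongrightarrow> 1 - a" by (intro tendsto_diff tendsto_const x(1))
  have "(\<lambda>n. x n * ln (x n) + (1 - x n) * ln (1 - x n) - x n * ln b - (1 - x n) * ln (1 - b))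
      \<longlonglongrightarrow> a * ln a + (1 - a) * ln (1 - a) - a * ln b - (1 - a) * ln (1 - b)"
    using x(2) by (intro tendsto_diff[OF tendsto_diff[OF tendsto_add]] tendsto_mult_ln x y tendsto_mult tendsto_const) auto
  then show ?thesis
    using x(2) b a by (simp add: rel_entropy_expand)
qed

lemma rel_entropy_measurable [measurable]:
  assumes "h \<in> borel_measurable M" "r \<in> borel_measurable M"
  shows "(\<lambda>p. rel_entropy (h p) (r p)) \<in> borel_measurable M"
  unfolding rel_entropy_def using assms by measurable

lemma rate_integrable:
  assumes r: "r \<in> borel_measurable square_leb" "log_integrable r" and h: "h \<in> graphons"
  shows "integrable square_leb (\<lambda>p. rel_entropy (h p) (r p))"
    and "AE p in square_leb. 0 \<le> rel_entropy (h p) (r p) \<and> rel_entropy (h p) (r p) \<le> \<bar>ln (r p)\<bar> + \<bar>ln (1 - r p)\<bar>"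
proof -
  have "AE p in square_leb. 0 < r p \<and> r p < 1" using r(2) by (simp add: log_integrable_def)
  then show bd: "AE p in square_leb. 0 \<le> rel_entropy (h p) (r p) \<and> rel_entropy (h p) (r p) \<le> \<bar>ln (r p)\<bar> + \<bar>ln (1 - r p)\<bar>"
    using AE_space
  proof eventually_elim
    case (elim p)
    have "p \<in> unit_square" using elim(2) by simp
    then show ?case
      using graphon_bounds[OF h, of p] elim(1) by (intro conjI rel_entropy_nonneg rel_entropy_le) auto
  qed
  have i: "integrable square_leb (\<lambda>p. \<bar>ln (r p)\<bar> + \<bar>ln (1 - r p)\<bar>)"
    using r(2) by (simp add: log_integrable_def)
  show "integrable square_leb (\<lambda>p. rel_entropy (h p) (r p))"
    by (rule Bochner_Integration.integrable_bound[OF i rel_entropy_measurable[OF graphon_measurable[OF h] r(1)]])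
       (use bd in eventually_elim, simp)
qed

lemma rate_I_nonneg:
  assumes "r \<in> borel_measurable square_leb" "log_integrable r" "h \<in> graphons"
  shows "0 \<le> rate_I r h"
  unfolding rate_I_def
  by (intro Bochner_Integration.integral_nonneg_AE) (use rate_integrable(2)[OF assms] in eventually_elim, simp)

lemma rate_I_tendsto:
  assumes r: "r \<in> borel_measurable square_leb" "log_integrable r" and h: "\<And>n. h n \<in> graphons" and g: "g \<in> graphons"
    and ae: "AE p in square_leb. (\<lambda>n. h n p) \<longlonglongrightarrow> g p"
  shows "(\<lambda>n. rate_I r (h n)) \<longlonglongrightarrow> rate_I r g"
  unfolding rate_I_def
proof (rule integral_dominated_convergence[where w = "\<lambda>p. \<bar>ln (r p)\<bar> + \<bar>ln (1 - r p)\<bar>"])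
  show "integrable square_leb (\<lambda>p. \<bar>ln (r p)\<bar> + \<bar>ln (1 - r p)\<bar>)"
    using r(2) by (simp add: log_integrable_def)
  show "(\<lambda>p. rel_entropy (g p) (r p)) \<in> borel_measurable square_leb"
    by (rule rel_entropy_measurable[OF graphon_measurable[OF g] r(1)])
  show "(\<lambda>p. rel_entropy (h n p) (r p)) \<in> borel_measurable square_leb" for n
    by (rule rel_entropy_measurable[OF graphon_measurable[OF h] r(1)])
  show "AE p in square_leb. norm (rel_entropy (h n p) (r p)) \<le> \<bar>ln (r p)\<bar> + \<bar>ln (1 - r p)\<bar>" for n
    using rate_integrable(2)[OF r h[of n]] by eventually_elim simp
  have "AE p in square_leb. 0 < r p \<and> r p < 1" using r(2) by (simp add: log_integrable_def)
  then show "AE p in square_leb. (\<lambda>n. rel_entropy (h n p) (r p)) \<longlonglongrightarrow> rel_entropy (g p) (r p)"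
    using ae AE_space
  proof eventually_elim
    case (elim p)
    have "p \<in> unit_square" using elim(3) by simp
    then have "0 \<le> h n p \<and> h n p \<le> 1" for n by (rule graphon_bounds[OF h])
    then show ?case using elim by (intro rel_entropy_tendsto) auto
  qed
qed

section \<open>Graphon classes and the equality of the two infima\<close>

lemma zero_graphon: "(\<lambda>_. 0) \<in> graphons"
  by (simp add: graphons_def)

lemma laplacian_norm_zero: "laplacian_norm (\<lambda>_. 0) \<le> 0"
  by (rule laplacian_norm_le[OF zero_graphon]) (simp_all add: lap_form_def)

lemma cut_distance_nonneg: "h \<in> graphons \<Longrightarrow> k \<in> graphons \<Longrightarrow> 0 \<le> cut_distance h k"
  using cut_distance_upper[of h k "{}" "{}"] by simp

lemma rearrange_id: "rearrange h (\<lambda>x. x) = h"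
  by (simp add: rearrange_def)

lemma cut_metric_refl:
  assumes h: "h \<in> graphons"
  shows "cut_metric h h = 0"
proof -
  have ne: "sets unit_leb \<times> sets unit_leb \<noteq> {}" using sets.empty_sets by blast
  have "cut_distance h h = (SUP x \<in> sets unit_leb \<times> sets unit_leb. 0)"
    unfolding cut_distance_def by (intro SUP_cong) (auto simp: set_lebesgue_integral_def)
  also have "\<dots> = 0" using ne by (rule cSUP_const)
  finally have 0: "cut_distance h h = 0" .
  have nn: "0 \<le> cut_distance h (rearrange h \<phi>)" if "\<phi> \<in> mp_bijections" for \<phi>
    using that by (intro cut_distance_nonneg h rearrange_graphon mp_bijections_subset)
  have "cut_metric h h \<le> 0"
    unfolding cut_metric_def
    by (rule cINF_lower2[OF _ id_mp_bijection]) (use nn 0 in \<open>auto simp: rearrange_id intro: bdd_belowI2[of _ 0]\<close>)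
  moreover have "0 \<le> cut_metric h h"
    unfolding cut_metric_def using id_mp_bijection nn by (intro cINF_greatest) auto
  ultimately show ?thesis by simp
qed

text \<open>The image of \<open>h\<close> under the relation contains \<open>h\<close> by
  reflexivity, so the choice is from a nonempty set. The representative appears as the second,
  rearranged argument of the cut-metric, which is the orientation of the results on cut-equivalent
  graphons.\<close>

lemma class_rep_cut_equiv:
  assumes h: "h \<in> graphons"
  shows "class_rep (cut_equiv `` {h}) \<in> graphons" "cut_metric h (class_rep (cut_equiv `` {h})) = 0"
proof -
  have "h \<in> cut_equiv `` {h}" using h cut_metric_refl[OF h] by (simp add: cut_equiv_def)
  then have "class_rep (cut_equiv `` {h}) \<in> cut_equiv `` {h}"
    unfolding class_rep_def by (rule someI[of "\<lambda>x. x \<in> cut_equiv `` {h}"])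
  moreover have "k \<in> graphons \<and> cut_metric h k = 0" if "k \<in> cut_equiv `` {h}" for k
    using that by (simp add: cut_equiv_def)
  ultimately show "class_rep (cut_equiv `` {h}) \<in> graphons" "cut_metric h (class_rep (cut_equiv `` {h})) = 0"
    by blast+
qed

text \<open>For \<le>, the representative of the class of an admissible \<open>h\<close> is
  admissible, and its rearrangements converge to \<open>h\<close> almost everywhere along a
  sequence; by dominated convergence the infimum over rearrangements is at most the rate of
  \<open>h\<close>. For \<ge>, every rearrangement of an admissible representative is itself an
  admissible graphon.\<close>

lemma rate_psi_eq:
  assumes r: "r \<in> graphons" "log_integrable r" and \<beta>: "\<beta> \<ge> 0"
  shows "rate_psi r \<beta> = (INF h \<in> {h \<in> graphons. laplacian_norm h \<le> \<beta>}. rate_I r h)"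
proof (rule antisym)
  note rm = graphon_measurable[OF r(1)]
  have I0: "0 \<le> rate_I r h" if "h \<in> graphons" for h by (rule rate_I_nonneg[OF rm r(2) that])
  have bddJ: "bdd_below ((\<lambda>\<phi>. rate_I r (rearrange g \<phi>)) ` mp_bijections)" if "g \<in> graphons" for g
    using that by (intro bdd_belowI2[of _ 0] I0 rearrange_graphon mp_bijections_subset)
  have nemp: "mp_bijections \<noteq> {}" using id_mp_bijection by blast
  have cls: "\<exists>h\<in>graphons. C = cut_equiv `` {h}" if "C \<in> graphon_classes" for C
    using that unfolding graphon_classes_def by (elim quotientE) blast
  have rep: "class_rep C \<in> graphons" if "C \<in> graphon_classes" for C
    using cls[OF that] class_rep_cut_equiv(1) by blast
  have J0: "0 \<le> rate_J r C" if "C \<in> graphon_classes" for C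
    unfolding rate_J_def using nemp rep[OF that]
    by (intro cINF_greatest I0 rearrange_graphon mp_bijections_subset)
  have eligible: "cut_equiv `` {h} \<in> graphon_classes \<and> class_laplacian_norm (cut_equiv `` {h}) \<le> \<beta>"
    if h: "h \<in> graphons" "laplacian_norm h \<le> \<beta>" for h
  proof
    show "cut_equiv `` {h} \<in> graphon_classes"
      unfolding graphon_classes_def using h(1) by (rule quotientI)
    note g = class_rep_cut_equiv[OF h(1)]
    have "block_bound \<beta> (class_rep (cut_equiv `` {h}))"
      by (rule cut_equivalent_block_bound[OF h(1) g h(2)])
    then have "laplacian_norm (rearrange (class_rep (cut_equiv `` {h})) (\<lambda>x. x)) \<le> \<beta>"
      by (intro block_bound_imp_laplacian_norm[OF g(1) _ \<beta>] mp_bijections_subset id_mp_bijection)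
    then show "class_laplacian_norm (cut_equiv `` {h}) \<le> \<beta>"
      by (simp add: class_laplacian_norm_def rearrange_id)
  qed
  have neh: "{h \<in> graphons. laplacian_norm h \<le> \<beta>} \<noteq> {}"
    using zero_graphon laplacian_norm_zero \<beta> by (auto intro!: exI[of _ "\<lambda>_. 0"])
  have neC: "{C \<in> graphon_classes. class_laplacian_norm C \<le> \<beta>} \<noteq> {}"
    using neh eligible by blast
  show "rate_psi r \<beta> \<le> (INF h \<in> {h \<in> graphons. laplacian_norm h \<le> \<beta>}. rate_I r h)"
  proof (rule cINF_greatest[OF neh])
    fix h assume "h \<in> {h \<in> graphons. laplacian_norm h \<le> \<beta>}"
    then have h: "h \<in> graphons" "laplacian_norm h \<le> \<beta>" by auto
    let ?C = "cut_equiv `` {h}"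
    note g = class_rep_cut_equiv[OF h(1)]
    obtain \<phi> where \<phi>: "\<And>n :: nat. \<phi> n \<in> mp_bijections"
      and ae: "AE p in square_leb. (\<lambda>n. rearrange (class_rep ?C) (\<phi> n) p) \<longlonglongrightarrow> h p"
      by (rule cut_equivalent_L2_seq[OF h(1) g]) (rule that)
    have "(\<lambda>n. rate_I r (rearrange (class_rep ?C) (\<phi> n))) \<longlonglongrightarrow> rate_I r h"
      by (intro rate_I_tendsto[OF rm r(2)] rearrange_graphon mp_bijections_subset \<phi> g(1) h(1) ae)
    moreover have "rate_J r ?C \<le> rate_I r (rearrange (class_rep ?C) (\<phi> n))" for n
      unfolding rate_J_def by (rule cINF_lower[OF bddJ[OF g(1)] \<phi>])
    ultimately have "rate_J r ?C \<le> rate_I r h" by (intro LIMSEQ_le_const) auto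
    moreover have "rate_psi r \<beta> \<le> rate_J r ?C"
      unfolding rate_psi_def using eligible[OF h] J0
      by (intro cINF_lower bdd_belowI2[of _ 0]) auto
    ultimately show "rate_psi r \<beta> \<le> rate_I r h" by simp
  qed
  show "(INF h \<in> {h \<in> graphons. laplacian_norm h \<le> \<beta>}. rate_I r h) \<le> rate_psi r \<beta>"
    unfolding rate_psi_def
  proof (rule cINF_greatest[OF neC])
    fix C assume "C \<in> {C \<in> graphon_classes. class_laplacian_norm C \<le> \<beta>}"
    then have C: "C \<in> graphon_classes" "laplacian_norm (class_rep C) \<le> \<beta>"
      by (auto simp: class_laplacian_norm_def)
    show "(INF h \<in> {h \<in> graphons. laplacian_norm h \<le> \<beta>}. rate_I r h) \<le> rate_J r C"
      unfolding rate_J_def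
    proof (rule cINF_greatest[OF nemp])
      fix \<phi> assume "\<phi> \<in> mp_bijections"
      then have p: "\<phi> \<in> mp_maps" by (rule mp_bijections_subset)
      have "rearrange (class_rep C) \<phi> \<in> {h \<in> graphons. laplacian_norm h \<le> \<beta>}"
        using rearrange_graphon[OF p rep[OF C(1)]] laplacian_norm_rearrange_le[OF rep[OF C(1)] p C(2)] by simp
      moreover have "bdd_below (rate_I r ` {h \<in> graphons. laplacian_norm h \<le> \<beta>})"
        using I0 by (intro bdd_belowI2[of _ 0]) auto
      ultimately show "(INF h \<in> {h \<in> graphons. laplacian_norm h \<le> \<beta>}. rate_I r h) \<le> rate_I r (rearrange (class_rep C) \<phi>)"
        by (intro cINF_lower)
    qed
  qed
qed


section \<open>Block-constant reference graphons\<close>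

text \<open>The left side is the tangent line at \<open>q\<close> of the convex function of
  \<open>x\<close> on the right. The gap is exactly \<open>rel_entropy x q\<close>, so convexity
  reduces to nonnegativity of relative entropy.\<close>

lemma rel_entropy_tangent:
  assumes "0 \<le> x" "x \<le> 1" "0 < b" "b < 1" "0 < q" "q < 1"
  shows "x * ln (q / b) + (1 - x) * ln ((1 - q) / (1 - b)) \<le> rel_entropy x b"
proof -
  have "rel_entropy x b - (x * ln (q / b) + (1 - x) * ln ((1 - q) / (1 - b))) = rel_entropy x q"
    using assms by (simp add: rel_entropy_expand ln_div algebra_simps)
  then show ?thesis using rel_entropy_nonneg[of x q] assms by simp
qed

lemma rel_entropy_zero: "rel_entropy 0 b = - ln (1 - b)" if "b < 1"
  using that by (simp add: rel_entropy_def ln_div)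

text \<open>Jensen's inequality by integrating the tangent at the average. The tangent is vertical
  at 0 and 1: an average of 0 is treated apart, since then \<open>h\<close> vanishes almost
  everywhere on the cell, and an average of 1 is excluded by hypothesis, which the factor 1 - d
  guarantees in the application.\<close>

lemma cell_jensen:
  assumes h: "h \<in> graphons" and N: "N \<ge> 1" and ij: "i < N" "j < N" and b: "0 < b" "b < 1"
    and lt: "block_avg N h i j < 1"
  shows "rel_entropy (block_avg N h i j) b / (real N)\<^sup>2 \<le> (LINT p|square_leb. rel_entropy (h p) b * cell (block N) i j p)"
proof -
  note A = unit_partition_block[OF N]
  define q where "q = block_avg N h i j"
  let ?c = "cell (block N) i j"
  have hm [measurable]: "h \<in> borel_measurable square_leb" by (rule graphon_measurable[OF h])
  have cm [measurable]: "?c \<in> borel_measurable square_leb" by (rule cell_measurable[OF A ij])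
  have hi: "integrable square_leb (\<lambda>p. h p * ?c p)" by (rule integral_split_cells(1)[OF A N graphon_integrable[OF h] ij])
  note ci = integral_cell[OF A ij]
  have hc: "(LINT p|square_leb. h p * ?c p) = q / (real N)\<^sup>2" unfolding q_def by (rule block_avg_cell[OF N])
  have h01: "0 \<le> h p \<and> h p \<le> 1" if "p \<in> space square_leb" for p
    using that graphon_bounds[OF h, of p] by (simp only: space_restrict_space) simp
  have Ri: "integrable square_leb (\<lambda>p. rel_entropy (h p) b * ?c p)"
  proof (rule Bochner_Integration.integrable_bound)
    show "integrable square_leb (\<lambda>p. (\<bar>ln b\<bar> + \<bar>ln (1 - b)\<bar>) * ?c p)" by (rule integrable_mult_right[OF ci(1)])
    show "AE p in square_leb. norm (rel_entropy (h p) b * ?c p) \<le> norm ((\<bar>ln b\<bar> + \<bar>ln (1 - b)\<bar>) * ?c p)"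
    proof (rule AE_I2)
      fix p assume "p \<in> space square_leb"
      then have "0 \<le> h p" "h p \<le> 1" using h01 by blast+
      then have "0 \<le> rel_entropy (h p) b" "rel_entropy (h p) b \<le> \<bar>ln b\<bar> + \<bar>ln (1 - b)\<bar>"
        using rel_entropy_nonneg[OF _ _ b] rel_entropy_le[OF _ _ b] by blast+
      then show "norm (rel_entropy (h p) b * ?c p) \<le> norm ((\<bar>ln b\<bar> + \<bar>ln (1 - b)\<bar>) * ?c p)"
        using cell_nonneg[of "block N" i j p] by (simp add: abs_mult mult_right_mono)
    qed
  qed measurable
  have q0: "0 \<le> q" using block_avg_bounds[OF h N ij] by (simp add: q_def)
  show ?thesis
  proof (cases "q = 0")
    case True
    then have "AE p in square_leb. h p * ?c p = 0"
      using hc hi h01 cell_nonneg[of "block N" i j]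
      by (subst integral_nonneg_eq_0_iff_AE[symmetric]) (auto intro!: AE_I2)
    then have "AE p in square_leb. rel_entropy (h p) b * ?c p = rel_entropy 0 b * ?c p"
      by eventually_elim auto
    then have "(LINT p|square_leb. rel_entropy (h p) b * ?c p) = (LINT p|square_leb. rel_entropy 0 b * ?c p)"
      by (rule integral_cong_AE[rotated 2]) measurable
    also have "\<dots> = rel_entropy 0 b / (real N)\<^sup>2"
      by (simp only: Bochner_Integration.integral_mult_right_zero ci(2) times_divide_eq_right mult_1_right)
    finally show ?thesis using True by (simp add: q_def)
  next
    case False
    then have q: "0 < q" "q < 1" using q0 lt by (auto simp: q_def)
    define l0 l1 where "l0 = ln (q / b)" and "l1 = ln ((1 - q) / (1 - b))"
    have "rel_entropy q b / (real N)\<^sup>2 = l0 * (q / (real N)\<^sup>2) + l1 * (1 / (real N)\<^sup>2 - q / (real N)\<^sup>2)"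
      by (simp add: rel_entropy_def l0_def l1_def diff_divide_distrib add_divide_distrib algebra_simps)
    also have "\<dots> = (LINT p|square_leb. l0 * (h p * ?c p) + l1 * (?c p - h p * ?c p))"
      using hi ci by (simp add: hc)
    also have "\<dots> \<le> (LINT p|square_leb. rel_entropy (h p) b * ?c p)"
    proof (rule integral_mono[OF _ Ri])
      show "integrable square_leb (\<lambda>p. l0 * (h p * ?c p) + l1 * (?c p - h p * ?c p))"
        using hi ci(1) by (intro Bochner_Integration.integrable_add integrable_mult_right Bochner_Integration.integrable_diff)
      fix p assume "p \<in> space square_leb"
      then have "(h p * l0 + (1 - h p) * l1) * ?c p \<le> rel_entropy (h p) b * ?c p"
        unfolding l0_def l1_def using h01[of p] b q
        by (intro mult_right_mono rel_entropy_tangent cell_nonneg) auto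
      then show "l0 * (h p * ?c p) + l1 * (?c p - h p * ?c p) \<le> rel_entropy (h p) b * ?c p"
        by (simp add: algebra_simps)
    qed
    finally show ?thesis by (simp add: q_def)
  qed
qed

definition corner :: "nat \<Rightarrow> nat \<Rightarrow> nat \<Rightarrow> real \<times> real" where
  "corner N i j = (real i / real N, real j / real N)"

lemma corner_in_square: "i < N \<Longrightarrow> j < N \<Longrightarrow> corner N i j \<in> unit_square"
  by (simp add: corner_def)

locale block_reference =
  fixes N :: nat and s :: "real \<times> real \<Rightarrow> real"
  assumes N: "N \<ge> 1" and s: "s \<in> graphons" and s01: "\<And>p. p \<in> unit_square \<Longrightarrow> 0 < s p \<and> s p < 1"
    and s_block: "block_constant N s"
begin

abbreviation val :: "nat \<Rightarrow> nat \<Rightarrow> real" where "val i j \<equiv> s (corner N i j)"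

lemma val01: "i < N \<Longrightarrow> j < N \<Longrightarrow> 0 < val i j \<and> val i j < 1"
  by (rule s01) (rule corner_in_square)

lemma val_sym: "i < N \<Longrightarrow> j < N \<Longrightarrow> val i j = val j i"
  unfolding corner_def by (rule graphon_sym[OF s]) simp_all

lemma s_on_cell:
  assumes "i < N" "j < N" "cell (block N) i j p \<noteq> 0"
  shows "s p = val i j"
proof -
  obtain c where c: "\<And>p. p \<in> block N i \<times> block N j \<Longrightarrow> s p = c"
    using s_block assms(1,2) unfolding block_constant_def by blast
  have "p \<in> block N i \<times> block N j" using cell_eq_1[OF assms(3)] by (cases p) simp
  moreover have "corner N i j \<in> block N i \<times> block N j"
    using N by (simp add: corner_def block_def divide_strict_right_mono)
  ultimately show ?thesis using c by metis
qed

lemma integrable_fun_s: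
  assumes m: "(\<lambda>p. F (s p) :: real) \<in> borel_measurable square_leb"
  shows "integrable square_leb (\<lambda>p. F (s p))"
proof (rule integrable_cong_AE_imp[OF integrable_step_graphon[OF unit_partition_block[OF N]] m])
  show "AE p in square_leb. step_graphon N (block N) (\<lambda>i j. F (val i j)) p = F (s p)"
    using AE_cell[OF unit_partition_block[OF N] N]
  proof eventually_elim
    case (elim p)
    then obtain i j where ij: "i < N" "j < N" "fst p \<in> block N i" "snd p \<in> block N j" by blast
    have "cell (block N) i j p \<noteq> 0" using ij by (simp add: cell_def)
    then show ?case
      using step_graphon_value[OF unit_partition_block[OF N] ij] s_on_cell[OF ij(1,2)] by simp
  qed
qed

lemma log_integrable_s: "log_integrable s"
  unfolding log_integrable_def
proof (intro conjI)
  have [measurable]: "s \<in> borel_measurable square_leb" by (rule graphon_measurable[OF s])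
  show "AE p in square_leb. 0 < s p \<and> s p < 1"
    using s01 by (intro AE_I2) simp
  show "integrable square_leb (\<lambda>p. ln (s p))" by (rule integrable_fun_s[of ln]) measurable
  show "integrable square_leb (\<lambda>p. ln (1 - s p))" by (rule integrable_fun_s[of "\<lambda>x. ln (1 - x)"]) measurable
qed

lemma rate_cells:
  assumes h: "h \<in> graphons"
  shows "rate_I s h = (\<Sum>i<N. \<Sum>j<N. LINT p|square_leb. rel_entropy (h p) (val i j) * cell (block N) i j p)"
proof -
  note A = unit_partition_block[OF N]
  have "rate_I s h = (\<Sum>i<N. \<Sum>j<N. LINT p|square_leb. rel_entropy (h p) (s p) * cell (block N) i j p)"
    unfolding rate_I_def
    by (rule integral_split_cells(2)[OF A N rate_integrable(1)[OF graphon_measurable[OF s] log_integrable_s h]])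
  also have "\<dots> = (\<Sum>i<N. \<Sum>j<N. LINT p|square_leb. rel_entropy (h p) (val i j) * cell (block N) i j p)"
  proof (intro sum.cong refl Bochner_Integration.integral_cong)
    fix i j p assume "i \<in> {..<N}" "j \<in> {..<N}"
    then show "rel_entropy (h p) (s p) * cell (block N) i j p = rel_entropy (h p) (val i j) * cell (block N) i j p"
      using s_on_cell[of i j p] by (cases "cell (block N) i j p = 0") simp_all
  qed
  finally show ?thesis .
qed

lemma rate_step_graphon:
  assumes "step_graphon N (block N) Q \<in> graphons"
  shows "rate_I s (step_graphon N (block N) Q) = (\<Sum>i<N. \<Sum>j<N. rel_entropy (Q i j) (val i j)) / (real N)\<^sup>2"
proof -
  note A = unit_partition_block[OF N]
  have "(LINT p|square_leb. rel_entropy (step_graphon N (block N) Q p) (val i j) * cell (block N) i j p)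
      = rel_entropy (Q i j) (val i j) / (real N)\<^sup>2" if ij: "i < N" "j < N" for i j
  proof -
    have "rel_entropy (step_graphon N (block N) Q p) (val i j) * cell (block N) i j p
        = rel_entropy (Q i j) (val i j) * cell (block N) i j p" for p
      using step_graphon_value[OF A ij, of p Q] cell_eq_1[of "block N" i j p]
      by (cases "cell (block N) i j p = 0") simp_all
    then show ?thesis
      by (simp only: Bochner_Integration.integral_mult_right_zero integral_cell(2)[OF A ij] times_divide_eq_right mult_1_right)
  qed
  then show ?thesis unfolding rate_cells[OF assms] by (simp add: sum_divide_distrib)
qed

lemma sum_pairs_rel_entropy:
  assumes sym: "\<And>i j. i < N \<Longrightarrow> j < N \<Longrightarrow> Q i j = Q j i"
  shows "2 * (\<Sum>(i, j)\<in>pairs N. rel_entropy (Q i j) (val i j)) + (\<Sum>i<N. rel_entropy (Q i i) (val i i))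
    = (\<Sum>i<N. \<Sum>j<N. rel_entropy (Q i j) (val i j))"
proof -
  define f where "f i j = (if i = j then 0 else rel_entropy (Q i j) (val i j))" for i j
  have "(\<Sum>(i, j)\<in>pairs N. rel_entropy (Q i j) (val i j)) = (\<Sum>(i, j)\<in>pairs N. f i j)"
    by (intro sum.cong) (auto simp: pairs_def f_def)
  also have "\<dots> = (\<Sum>i<N. \<Sum>j<N. f i j) / 2"
    by (rule sum_pairs) (simp_all add: f_def sym val_sym)
  finally have 1: "2 * (\<Sum>(i, j)\<in>pairs N. rel_entropy (Q i j) (val i j)) = (\<Sum>i<N. \<Sum>j<N. f i j)" by simp
  have "(\<Sum>j<N. f i j) + rel_entropy (Q i i) (val i i) = (\<Sum>j<N. rel_entropy (Q i j) (val i j))" if "i < N" for i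
  proof -
    have "(\<Sum>j<N. f i j) + rel_entropy (Q i i) (val i i) = (\<Sum>j<N. f i j) + (\<Sum>j<N. if i = j then rel_entropy (Q i i) (val i i) else 0)"
      using that by simp
    also have "\<dots> = (\<Sum>j<N. rel_entropy (Q i j) (val i j))"
      unfolding sum.distrib[symmetric] by (intro sum.cong) (auto simp: f_def)
    finally show ?thesis .
  qed
  then have "(\<Sum>i<N. (\<Sum>j<N. f i j) + rel_entropy (Q i i) (val i i)) = (\<Sum>i<N. \<Sum>j<N. rel_entropy (Q i j) (val i j))"
    by (intro sum.cong) auto
  then show ?thesis unfolding 1 by (simp only: sum.distrib)
qed

definition err :: "(real \<times> real \<Rightarrow> real) \<Rightarrow> real" where
  "err r = (LINT p|square_leb. \<bar>ln (s p) - ln (r p)\<bar>) + (LINT p|square_leb. \<bar>ln (1 - s p) - ln (1 - r p)\<bar>)"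

text \<open>Uniformity in \<open>h\<close> matters: in the upper bound the graphon is built from the
  conditioned law and changes with \<open>N\<close>.\<close>

lemma rate_I_reference_diff:
  assumes r: "r \<in> graphons" "log_integrable r" and h: "h \<in> graphons"
  shows "\<bar>rate_I s h - rate_I r h\<bar> \<le> err r"
proof -
  note iS = rate_integrable(1)[OF graphon_measurable[OF s] log_integrable_s h]
    and ir = rate_integrable(1)[OF graphon_measurable[OF r(1)] r(2) h]
  have l: "integrable square_leb (\<lambda>p. \<bar>ln (s p) - ln (r p)\<bar>)" "integrable square_leb (\<lambda>p. \<bar>ln (1 - s p) - ln (1 - r p)\<bar>)"
    using log_integrable_s r(2) by (simp_all add: log_integrable_def)
  have "\<bar>rate_I s h - rate_I r h\<bar> = \<bar>LINT p|square_leb. rel_entropy (h p) (s p) - rel_entropy (h p) (r p)\<bar>"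
    unfolding rate_I_def using iS ir by simp
  also have "\<dots> \<le> (LINT p|square_leb. \<bar>rel_entropy (h p) (s p) - rel_entropy (h p) (r p)\<bar>)"
    by (rule integral_abs_bound)
  also have "\<dots> \<le> (LINT p|square_leb. \<bar>ln (s p) - ln (r p)\<bar> + \<bar>ln (1 - s p) - ln (1 - r p)\<bar>)"
  proof (rule integral_mono_AE)
    have "AE p in square_leb. 0 < r p \<and> r p < 1" using r(2) by (simp add: log_integrable_def)
    then show "AE p in square_leb. \<bar>rel_entropy (h p) (s p) - rel_entropy (h p) (r p)\<bar> \<le> \<bar>ln (s p) - ln (r p)\<bar> + \<bar>ln (1 - s p) - ln (1 - r p)\<bar>"
      using AE_space
    proof eventually_elim
      case (elim p)
      have "p \<in> unit_square" using elim(2) by simp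
      then show ?case using elim(1) s01[of p] graphon_bounds[OF h, of p] by (intro rel_entropy_diff_le) auto
    qed
  qed (use iS ir l in simp_all)
  also have "\<dots> = err r" unfolding err_def using l by simp
  finally show ?thesis .
qed

end

section \<open>The constraint event and the cost of the diagonal\<close>

definition small_form_event :: "nat \<Rightarrow> real \<Rightarrow> (nat \<times> nat \<Rightarrow> bool) set" where
  "small_form_event N \<beta> = {\<omega>. \<forall>v. (\<Sum>(i, j)\<in>pairs N. of_bool (\<omega> (i, j)) * (v i - v j)\<^sup>2) \<le> \<beta> * N * (\<Sum>i<N. (v i)\<^sup>2)}"

text \<open>A graph has no loops, so the graphon built from its edge marginals is 0 on the diagonal
  blocks, where the entropy of 0 relative to the reference is - ln (1 - r). This is the total of
  that cost, taken with the limit \<open>r\<close>.\<close>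

definition diag_mass :: "nat \<Rightarrow> (real \<times> real \<Rightarrow> real) \<Rightarrow> real" where
  "diag_mass N r = (LINT p|square_leb. \<bar>ln (1 - r p)\<bar> * (\<Sum>i<N. cell (block N) i i p))"

definition min_rate :: "(real \<times> real \<Rightarrow> real) \<Rightarrow> real \<Rightarrow> real" where
  "min_rate r \<beta> = (INF h \<in> {h \<in> graphons. laplacian_norm h \<le> \<beta>}. rate_I r h)"

lemma min_rate_le:
  assumes "r \<in> graphons" "log_integrable r" "h \<in> graphons" "laplacian_norm h \<le> \<beta>"
  shows "min_rate r \<beta> \<le> rate_I r h"
  unfolding min_rate_def using assms rate_I_nonneg[OF graphon_measurable[OF assms(1)] assms(2)]
  by (intro cINF_lower bdd_belowI2[of _ 0]) auto

lemma diagonal_cells_bound: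
  assumes N: "N \<ge> 1"
  shows "0 \<le> (\<Sum>i<N. cell (block N) i i p)" "(\<Sum>i<N. cell (block N) i i p) \<le> 1"
    and "(\<Sum>i<N. cell (block N) i i p) \<noteq> 0 \<Longrightarrow> \<bar>fst p - snd p\<bar> < 1 / N"
proof -
  note A = unit_partition_block[OF N]
  show "0 \<le> (\<Sum>i<N. cell (block N) i i p)" by (intro sum_nonneg cell_nonneg)
  have "(\<Sum>i<N. cell (block N) i i p) \<le> (\<Sum>i<N. indicator (block N i) (fst p))"
    by (intro sum_mono) (simp add: cell_def indicator_def)
  also have "\<dots> = step_fun N (block N) (\<lambda>_. 1) (fst p)" by (simp add: step_fun_def)
  also have "\<dots> \<le> 1"
  proof (cases "\<exists>i<N. fst p \<in> block N i")
    case True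
    then obtain i where "i < N" "fst p \<in> block N i" by blast
    then show ?thesis by (simp only: step_fun_value[OF A] order_refl)
  next
    case False
    then have "step_fun N (block N) (\<lambda>_. 1) (fst p) = 0"
      unfolding step_fun_def by (intro sum.neutral) (auto simp: indicator_def)
    then show ?thesis by (simp only: zero_le_one)
  qed
  finally show "(\<Sum>i<N. cell (block N) i i p) \<le> 1" .
  assume "(\<Sum>i<N. cell (block N) i i p) \<noteq> 0"
  then obtain i where "cell (block N) i i p \<noteq> 0" by (meson sum.neutral)
  then have "fst p \<in> block N i" "snd p \<in> block N i" using cell_eq_1 by blast+
  then show "\<bar>fst p - snd p\<bar> < 1 / N" by (auto simp: block_def add_divide_distrib abs_less_iff)
qed

lemma AE_off_diagonal: "AE p in square_leb. fst p \<noteq> snd p"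
proof -
  have "AE x in unit_leb. AE y in unit_leb. fst (x, y) \<noteq> snd (x, y)"
  proof (rule AE_I2)
    fix x :: real
    have "{x} \<in> null_sets lebesgue" by (simp add: null_sets_completionI)
    then have "AE y in lebesgue. y \<notin> {x}" by (rule AE_not_in)
    then show "AE y in unit_leb. fst (x, y) \<noteq> snd (x, y)"
      by (subst AE_restrict_space_iff) (auto elim: eventually_mono)
  qed
  moreover have "{p \<in> space square_prod. fst p \<noteq> snd p} \<in> sets square_prod"
  proof -
    have "closed {p :: real \<times> real. fst p = snd p}"
      by (intro closed_Collect_eq continuous_intros)
    then have "- {p :: real \<times> real. fst p = snd p} \<inter> unit_square \<in> sets square_prod"
      by (intro borel_square_prod) auto
    also have "- {p :: real \<times> real. fst p = snd p} \<inter> unit_square = {p \<in> space square_prod. fst p \<noteq> snd p}"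
      by (auto simp: space_square_prod)
    finally show ?thesis .
  qed
  ultimately show ?thesis
    unfolding AE_square_leb_iff by (intro square_prod.AE_pair_measure)
qed

text \<open>Off the diagonal a point leaves the diagonal blocks as soon as 1/N is below the distance
  of its coordinates, and the diagonal is a null set; \<open>\<bar>ln (1 - r p)\<bar>\<close>
  dominates.\<close>

lemma diag_mass_tendsto:
  assumes r: "r \<in> graphons" "log_integrable r"
  shows "(\<lambda>N. diag_mass N r) \<longlonglongrightarrow> 0"
proof -
  have rm [measurable]: "r \<in> borel_measurable square_leb" by (rule graphon_measurable[OF r(1)])
  have ri: "integrable square_leb (\<lambda>p. \<bar>ln (1 - r p)\<bar>)" using r(2) by (simp add: log_integrable_def)
  have "(\<lambda>n. diag_mass (Suc n) r) \<longlonglongrightarrow> (LINT p|square_leb. 0)"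
    unfolding diag_mass_def
  proof (rule integral_dominated_convergence[OF _ _ ri])
    show "(\<lambda>p. \<bar>ln (1 - r p)\<bar> * (\<Sum>i<Suc n. cell (block (Suc n)) i i p)) \<in> borel_measurable square_leb" for n
      using cell_measurable[OF unit_partition_block[of "Suc n"]]
      by (intro borel_measurable_times borel_measurable_sum) (simp_all, measurable)
    show "AE p in square_leb. norm (\<bar>ln (1 - r p)\<bar> * (\<Sum>i<Suc n. cell (block (Suc n)) i i p)) \<le> \<bar>ln (1 - r p)\<bar>" for n
    proof (rule AE_I2)
      fix p
      show "norm (\<bar>ln (1 - r p)\<bar> * (\<Sum>i<Suc n. cell (block (Suc n)) i i p)) \<le> \<bar>ln (1 - r p)\<bar>"
        using diagonal_cells_bound[of "Suc n" p] by (simp add: abs_mult mult_left_le del: sum.lessThan_Suc)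
    qed
    show "AE p in square_leb. (\<lambda>n. \<bar>ln (1 - r p)\<bar> * (\<Sum>i<Suc n. cell (block (Suc n)) i i p)) \<longlonglongrightarrow> 0"
      using AE_off_diagonal
    proof eventually_elim
      case (elim p)
      have "(\<lambda>n. 1 / real (Suc n)) \<longlonglongrightarrow> 0" by (rule LIMSEQ_Suc[OF lim_1_over_n])
      then have "eventually (\<lambda>n. 1 / real (Suc n) < \<bar>fst p - snd p\<bar>) sequentially"
        using elim by (intro order_tendstoD(2)) auto
      then have "eventually (\<lambda>n. \<bar>ln (1 - r p)\<bar> * (\<Sum>i<Suc n. cell (block (Suc n)) i i p) = 0) sequentially"
      proof eventually_elim
        case (elim n)
        then have "(\<Sum>i<Suc n. cell (block (Suc n)) i i p) = 0"
          using diagonal_cells_bound(3)[of "Suc n" p] by linarith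
        then show ?case by (simp only: mult_zero_right)
      qed
      then show ?case by (rule tendsto_eventually)
    qed
  qed simp
  then have "(\<lambda>n. diag_mass (Suc n) r) \<longlonglongrightarrow> 0" by (simp only: Bochner_Integration.integral_zero)
  then show ?thesis by (rule LIMSEQ_imp_Suc)
qed

section \<open>The two bounds on the probability for a fixed number of vertices\<close>

context block_reference
begin

abbreviation law :: "(nat \<times> nat \<Rightarrow> bool) pmf" where
  "law \<equiv> bernoulli_prod (pairs N) (\<lambda>(i, j). val i j)"

lemma val_pairs: "e \<in> pairs N \<Longrightarrow> 0 < (case e of (i, j) \<Rightarrow> val i j) \<and> (case e of (i, j) \<Rightarrow> val i j) < 1"
  by (cases e) (simp add: pairs_def val01)

text \<open>The empty graph satisfies the constraint for every nonnegative \<beta>. Positivity is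
  needed for conditioning and keeps the logarithm away from \<open>ln 0 = 0\<close>.\<close>

lemma prob_small_form_pos:
  assumes "\<beta> \<ge> 0"
  shows "0 < measure_pmf.prob law (small_form_event N \<beta>)"
proof (rule measure_pmf_posI)
  have "(\<lambda>_. False) \<in> configs (pairs N)" by (simp add: configs_def PiE_dflt_def)
  then have "pmf law (\<lambda>_. False) > 0"
    by (intro pmf_bernoulli_prod_pos val_pairs) simp_all
  then show "(\<lambda>_. False) \<in> set_pmf law" by (simp add: set_pmf_iff)
  show "(\<lambda>_. False) \<in> small_form_event N \<beta>"
    using assms by (simp add: small_form_event_def sum_nonneg)
qed

text \<open>The cost on the diagonal involves the reference \<open>s\<close>, which varies with
  \<open>N\<close>. Trading it for the fixed \<open>r\<close> leaves the integral of one fixed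
  function over shrinking sets, at the price of \<open>err r\<close>.\<close>

lemma diagonal_cost_le:
  assumes r: "r \<in> graphons" "log_integrable r"
  shows "(\<Sum>i<N. rel_entropy 0 (val i i)) / (real N)\<^sup>2 \<le> err r + diag_mass N r"
proof -
  note A = unit_partition_block[OF N]
  let ?d = "\<lambda>p. \<Sum>i<N. cell (block N) i i p"
  have [measurable]: "s \<in> borel_measurable square_leb" by (rule graphon_measurable[OF s])
  have dm: "?d \<in> borel_measurable square_leb"
    using cell_measurable[OF A] by (intro borel_measurable_sum) simp
  note db = diagonal_cells_bound[OF N]
  have dint: "integrable square_leb (\<lambda>p. f p * ?d p)" if "integrable square_leb f" for f :: "_ \<Rightarrow> real"
  proof (rule Bochner_Integration.integrable_bound[OF that])
    show "(\<lambda>p. f p * ?d p) \<in> borel_measurable square_leb" using that dm by (intro borel_measurable_times) simp_all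
    show "AE p in square_leb. norm (f p * ?d p) \<le> norm (f p)"
      using db by (intro AE_I2) (simp add: abs_mult mult_left_le)
  qed
  have i1: "integrable square_leb (\<lambda>p. \<bar>ln (1 - s p) - ln (1 - r p)\<bar>)" "integrable square_leb (\<lambda>p. \<bar>ln (1 - r p)\<bar>)"
    using log_integrable_s r(2) by (simp_all add: log_integrable_def)
  have "(\<Sum>i<N. rel_entropy 0 (val i i)) / (real N)\<^sup>2 = (\<Sum>i<N. LINT p|square_leb. - ln (1 - s p) * cell (block N) i i p)"
    unfolding sum_divide_distrib
  proof (intro sum.cong refl)
    fix i assume "i \<in> {..<N}"
    then have i: "i < N" by simp
    have "- ln (1 - s p) * cell (block N) i i p = rel_entropy 0 (val i i) * cell (block N) i i p" for p
      using s_on_cell[OF i i, of p] rel_entropy_zero[of "val i i"] val01[OF i i]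
      by (cases "cell (block N) i i p = 0") simp_all
    then show "rel_entropy 0 (val i i) / (real N)\<^sup>2 = (LINT p|square_leb. - ln (1 - s p) * cell (block N) i i p)"
      by (simp only: Bochner_Integration.integral_mult_right_zero integral_cell(2)[OF A i i] times_divide_eq_right mult_1_right)
  qed
  also have "\<dots> = (LINT p|square_leb. - ln (1 - s p) * ?d p)"
  proof -
    have "integrable square_leb (\<lambda>p. - ln (1 - s p))" using log_integrable_s by (simp add: log_integrable_def)
    then have "integrable square_leb (\<lambda>p. - ln (1 - s p) * cell (block N) i i p)" if "i < N" for i
      by (rule integral_split_cells(1)[OF A N _ that that])
    then have "(LINT p|square_leb. (\<Sum>i<N. - ln (1 - s p) * cell (block N) i i p)) = (\<Sum>i<N. LINT p|square_leb. - ln (1 - s p) * cell (block N) i i p)"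
      by (intro Bochner_Integration.integral_sum) simp
    then show ?thesis by (simp only: sum_distrib_left)
  qed
  also have "\<dots> \<le> (LINT p|square_leb. \<bar>ln (1 - s p) - ln (1 - r p)\<bar> + \<bar>ln (1 - r p)\<bar> * ?d p)"
  proof (rule integral_mono)
    show "integrable square_leb (\<lambda>p. - ln (1 - s p) * ?d p)"
      using log_integrable_s by (intro dint) (simp add: log_integrable_def)
    show "integrable square_leb (\<lambda>p. \<bar>ln (1 - s p) - ln (1 - r p)\<bar> + \<bar>ln (1 - r p)\<bar> * ?d p)"
      by (rule Bochner_Integration.integrable_add[OF i1(1) dint[OF i1(2)]])
    fix p
    have "- ln (1 - s p) * ?d p \<le> (\<bar>ln (1 - s p) - ln (1 - r p)\<bar> + \<bar>ln (1 - r p)\<bar>) * ?d p"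
      using db(1) by (intro mult_right_mono) linarith+
    also have "\<dots> \<le> \<bar>ln (1 - s p) - ln (1 - r p)\<bar> + \<bar>ln (1 - r p)\<bar> * ?d p"
      using db(1,2)[of p] by (simp add: distrib_right mult_left_le)
    finally show "- ln (1 - s p) * ?d p \<le> \<bar>ln (1 - s p) - ln (1 - r p)\<bar> + \<bar>ln (1 - r p)\<bar> * ?d p" .
  qed
  also have "\<dots> = (LINT p|square_leb. \<bar>ln (1 - s p) - ln (1 - r p)\<bar>) + diag_mass N r"
    unfolding diag_mass_def by (rule Bochner_Integration.integral_add[OF i1(1) dint[OF i1(2)]])
  also have "\<dots> \<le> err r + diag_mass N r"
    unfolding err_def by (simp add: Bochner_Integration.integral_nonneg)
  finally show ?thesis .
qed

text \<open>The edge marginals of the conditioned law form a step graphon of norm at most \<beta>,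
  whose rate is thus at least the minimum. That rate counts each edge twice, hence the prefactor
  N^2/2. One \<open>err r\<close> comes from replacing the reference, the other together with
  \<open>diag_mass\<close> from the diagonal blocks.\<close>

lemma ln_prob_upper:
  assumes r: "r \<in> graphons" "log_integrable r" and \<beta>: "\<beta> \<ge> 0"
  shows "ln (measure_pmf.prob law (small_form_event N \<beta>)) \<le> - ((real N)\<^sup>2 / 2 * (min_rate r \<beta> - (2 * err r + diag_mass N r)))"
proof -
  note A = unit_partition_block[OF N]
  obtain q where q: "(\<forall>e. 0 \<le> q e \<and> q e \<le> 1) \<and>
      (\<forall>c b. (\<forall>\<omega>\<in>configs (pairs N) \<inter> small_form_event N \<beta>. (\<Sum>e\<in>pairs N. c e * of_bool (\<omega> e)) \<le> b)
        \<longrightarrow> (\<Sum>e\<in>pairs N. c e * q e) \<le> b) \<and>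
      ln (measure_pmf.prob law (small_form_event N \<beta>)) \<le> - (\<Sum>e\<in>pairs N. rel_entropy (q e) (case e of (i, j) \<Rightarrow> val i j))"
    using ln_prob_le_marginals[OF finite_pairs _ prob_small_form_pos[OF \<beta>]] val_pairs by blast
  note q01 = conjunct1[OF q, rule_format] and lin = conjunct1[OF conjunct2[OF q], rule_format]
    and bound = conjunct2[OF conjunct2[OF q]]
  \<comment> \<open>With a zero diagonal \<open>degree_le_of_form\<close> has no excess, so the step
    graphon meets the constraint \<beta> itself and not merely \<beta> + 1/N.\<close>
  define Q where "Q i j = (if i = j then 0 else q (edge i j))" for i j
  have Qsym: "Q i j = Q j i" for i j by (simp add: Q_def edge_commute)
  have Q01: "0 \<le> Q i j \<and> Q i j \<le> 1" for i j using q01 by (simp add: Q_def)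
  have form: "(\<Sum>i<N. \<Sum>j<N. Q i j * (v i - v j)\<^sup>2) \<le> 2 * real N * \<beta> * (\<Sum>i<N. (v i)\<^sup>2)" for v :: "nat \<Rightarrow> real"
  proof -
    \<comment> \<open>For each fixed \<open>v\<close> the constraint is one linear inequality in the
      edge indicators, and such inequalities are inherited by the conditional marginals.\<close>
    have "(\<Sum>e\<in>pairs N. (case e of (i, j) \<Rightarrow> (v i - v j)\<^sup>2) * q e) \<le> \<beta> * N * (\<Sum>i<N. (v i)\<^sup>2)"
    proof (rule lin)
      fix \<omega> assume "\<omega> \<in> configs (pairs N) \<inter> small_form_event N \<beta>"
      then have "(\<Sum>(i, j)\<in>pairs N. of_bool (\<omega> (i, j)) * (v i - v j)\<^sup>2) \<le> \<beta> * N * (\<Sum>i<N. (v i)\<^sup>2)"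
        by (simp add: small_form_event_def)
      then show "(\<Sum>e\<in>pairs N. (case e of (i, j) \<Rightarrow> (v i - v j)\<^sup>2) * of_bool (\<omega> e)) \<le> \<beta> * N * (\<Sum>i<N. (v i)\<^sup>2)"
        by (simp add: case_prod_unfold mult.commute)
    qed
    also have "(\<Sum>e\<in>pairs N. (case e of (i, j) \<Rightarrow> (v i - v j)\<^sup>2) * q e) = (\<Sum>(i, j)\<in>pairs N. q (i, j) * (v i - v j)\<^sup>2)"
      by (simp add: case_prod_unfold mult.commute)
    also have "\<dots> = (\<Sum>i<N. \<Sum>j<N. q (edge i j) * (v i - v j)\<^sup>2) / 2" by (rule sum_pairs_edge)
    also have "(\<Sum>i<N. \<Sum>j<N. q (edge i j) * (v i - v j)\<^sup>2) = (\<Sum>i<N. \<Sum>j<N. Q i j * (v i - v j)\<^sup>2)"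
      by (intro sum.cong) (auto simp: Q_def)
    finally show ?thesis by (simp add: mult_ac)
  qed
  define H where "H = step_graphon N (block N) Q"
  have H: "H \<in> graphons" unfolding H_def using Q01 Qsym by (intro step_graphon_in_graphons[OF A])
  have "laplacian_norm H \<le> \<beta>"
  proof (rule laplacian_norm_le[OF H \<beta>])
    fix u assume u: "u \<in> L2_fun"
    show "lap_form H u \<le> 2 * \<beta> * (LINT x|unit_leb. (u x)\<^sup>2)"
      unfolding H_def
    proof (rule lap_form_step_graphon_le[OF A N Qsym form _ \<beta> order_refl u])
      fix i assume "i < N"
      from degree_le_of_form[of N Q i \<beta>, OF Qsym this form] show "(\<Sum>j<N. Q i j) \<le> real N * \<beta>"
        by (simp add: Q_def)
    qed
  qed
  then have "min_rate r \<beta> \<le> rate_I r H" by (rule min_rate_le[OF r H])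
  also have "\<dots> \<le> rate_I s H + err r" using rate_I_reference_diff[OF r H] by linarith
  also have "rate_I s H = (\<Sum>i<N. \<Sum>j<N. rel_entropy (Q i j) (val i j)) / (real N)\<^sup>2"
    unfolding H_def by (rule rate_step_graphon[OF H[unfolded H_def]])
  also have "(\<Sum>i<N. \<Sum>j<N. rel_entropy (Q i j) (val i j))
      = 2 * (\<Sum>(i, j)\<in>pairs N. rel_entropy (Q i j) (val i j)) + (\<Sum>i<N. rel_entropy 0 (val i i))"
    using sum_pairs_rel_entropy[of Q, OF Qsym] by (simp add: Q_def)
  also have "(\<Sum>(i, j)\<in>pairs N. rel_entropy (Q i j) (val i j)) = (\<Sum>e\<in>pairs N. rel_entropy (q e) (case e of (i, j) \<Rightarrow> val i j))"
    by (intro sum.cong refl) (auto simp: Q_def pairs_def edge_def)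
  finally have m: "min_rate r \<beta> \<le> 2 * (\<Sum>e\<in>pairs N. rel_entropy (q e) (case e of (i, j) \<Rightarrow> val i j)) / (real N)\<^sup>2
      + (\<Sum>i<N. rel_entropy 0 (val i i)) / (real N)\<^sup>2 + err r"
    by (simp add: add_divide_distrib)
  define S where "S = (\<Sum>e\<in>pairs N. rel_entropy (q e) (case e of (i, j) \<Rightarrow> val i j))"
  have "min_rate r \<beta> - (2 * err r + diag_mass N r) \<le> 2 * S / (real N)\<^sup>2"
    using m diagonal_cost_le[OF r] unfolding S_def by linarith
  then have "(real N)\<^sup>2 / 2 * (min_rate r \<beta> - (2 * err r + diag_mass N r)) \<le> (real N)\<^sup>2 / 2 * (2 * S / (real N)\<^sup>2)"
    by (intro mult_left_mono) auto
  also have "\<dots> = S" using N by simp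
  finally show ?thesis using bound unfolding S_def by linarith
qed

text \<open>
  For \<open>\<beta> = 0\<close> the quotient \<open>5 / 0\<close> below is \<open>0\<close>, which is the right value: the tilted graph is then
  almost surely empty.
\<close>

lemma ln_prob_lower:
  assumes r: "r \<in> graphons" "log_integrable r" and h: "h \<in> graphons" and norm: "laplacian_norm h \<le> \<beta>"
    and \<delta>: "0 < \<delta>" "\<delta> < 1" and pos: "0 < 1 - 5 / ((\<delta> * \<beta> / 2) ^ 4 * N)"
  shows "ln (measure_pmf.prob law (small_form_event N \<beta>))
     \<ge> - ((real N)\<^sup>2 / 2 * (rate_I r (\<lambda>p. (1 - \<delta>) * h p) + err r) + 2) / (1 - 5 / ((\<delta> * \<beta> / 2) ^ 4 * N))"
proof -
  have \<beta>: "\<beta> \<ge> 0" using laplacian_norm_nonneg[OF h] norm by simp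
  \<comment> \<open>Shrinking by 1 - \<delta> leaves a margin for the random fluctuations and keeps
    the block averages at most 1 - \<delta>, as \<open>cell_jensen\<close> requires.\<close>
  define h' where "h' = (\<lambda>p. (1 - \<delta>) * h p)"
  have h': "h' \<in> graphons"
    using h \<delta> by (auto simp: h'_def graphons_def intro!: mult_le_one)
  define a where "a i j = block_avg N h' i j" for i j
  have a_eq: "a i j = (1 - \<delta>) * block_avg N h i j" for i j
    by (simp add: a_def h'_def block_avg_def mult.assoc)
  have a01: "0 \<le> a i j \<and> a i j \<le> 1 - \<delta>" if "i < N" "j < N" for i j
    using block_avg_bounds[OF h N that] \<delta> by (simp add: a_eq mult_left_le)
  have asym: "a i j = a j i" if "i < N" "j < N" for i j
    using block_avg_sym[OF h N that] by (simp add: a_eq)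
  define q where "q = (\<lambda>(i, j). a i j)"
  have q01: "0 \<le> q e \<and> q e \<le> 1" if "e \<in> pairs N" for e
    using a01[of "fst e" "snd e"] that \<delta> by (cases e) (auto simp: q_def pairs_def)
  have form: "(\<Sum>(i, j)\<in>pairs N. q (i, j) * (v i - v j)\<^sup>2) \<le> ((1 - \<delta>) * \<beta> * N) * (\<Sum>i<N. (v i)\<^sup>2)" for v :: "nat \<Rightarrow> real"
  proof -
    have "(\<Sum>(i, j)\<in>pairs N. q (i, j) * (v i - v j)\<^sup>2) = (\<Sum>i<N. \<Sum>j<N. a i j * (v i - v j)\<^sup>2) / 2"
      unfolding q_def prod.case by (rule sum_pairs) (auto simp: asym power2_commute)
    also have "(\<Sum>i<N. \<Sum>j<N. a i j * (v i - v j)\<^sup>2) = (1 - \<delta>) * (\<Sum>i<N. \<Sum>j<N. block_avg N h i j * (v i - v j)\<^sup>2)"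
      unfolding sum_distrib_left a_eq by (simp only: mult.assoc)
    also have "\<dots> \<le> (1 - \<delta>) * (2 * real N * \<beta> * (\<Sum>i<N. (v i)\<^sup>2))"
      using laplacian_norm_imp_block_bound[OF h norm] N \<delta> unfolding block_bound_def
      by (intro mult_left_mono) auto
    finally show ?thesis by (simp add: mult_ac)
  qed
  define \<kappa> where "\<kappa> = measure_pmf.prob (bernoulli_prod (pairs N) q) (small_form_event N \<beta>)"
  have \<kappa>: "\<kappa> \<ge> 1 - 5 / ((\<delta> * \<beta> / 2) ^ 4 * N)"
  proof (cases "\<beta> = 0")
    case False
    then have t: "\<delta> * \<beta> / 2 > 0" using \<beta> \<delta> by simp
    \<comment> \<open>The choice t = \<delta> \<beta> / 2 spends the margin exactly: what shrinking
      gained is the allowance \<open>2 * t * N\<close> of \<open>form_concentration\<close>.\<close>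
    have "(1 - \<delta>) * \<beta> * N + 2 * (\<delta> * \<beta> / 2) * N = \<beta> * N" by (simp add: algebra_simps)
    then show ?thesis
      using form_concentration[OF q01 t N form] unfolding \<kappa>_def small_form_event_def by simp
  next
    case True
    have q0: "q e = 0" if e: "e \<in> pairs N" for e
    proof -
      \<comment> \<open>For \<beta> = 0 all forms vanish. The indicator of one endpoint of
        \<open>e\<close> makes the summand of \<open>e\<close> equal to \<open>q e\<close>, and the
        nonnegative sum then forces \<open>q e\<close> to be 0.\<close>
      define v where "v i = (if i = fst e then 1 else 0 :: real)" for i
      have nn: "0 \<le> (case e of (i, j) \<Rightarrow> q (i, j) * (v i - v j)\<^sup>2)" if "e \<in> pairs N" for e
        using q01[OF that] by (cases e) simp
      have "(case e of (i, j) \<Rightarrow> q (i, j) * (v i - v j)\<^sup>2) \<le> (\<Sum>(i, j)\<in>pairs N. q (i, j) * (v i - v j)\<^sup>2)"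
        using e nn by (intro member_le_sum) auto
      also have "\<dots> \<le> 0" using form[of v] True by simp
      finally show ?thesis using e q01[OF e] by (cases e) (simp add: v_def pairs_def)
    qed
    have "\<omega> \<in> small_form_event N \<beta>" if \<omega>: "\<omega> \<in> set_pmf (bernoulli_prod (pairs N) q)" for \<omega>
    proof -
      have c: "\<omega> \<in> configs (pairs N)" using \<omega> set_bernoulli_prod[OF finite_pairs] by blast
      have "pmf (bernoulli_prod (pairs N) q) \<omega> \<noteq> 0" using \<omega> by (simp add: set_pmf_iff)
      then have nz: "(\<Prod>e\<in>pairs N. if \<omega> e then q e else 1 - q e) \<noteq> 0"
        using pmf_bernoulli_prod[OF finite_pairs c, of q] q01 by simp
      have "\<not> \<omega> e" if "e \<in> pairs N" for e
        using nz q0[OF that] that by (auto simp: prod_zero_iff)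
      then have "(\<Sum>(i, j)\<in>pairs N. of_bool (\<omega> (i, j)) * (v i - v j)\<^sup>2) = 0" for v :: "nat \<Rightarrow> real"
        by (intro sum.neutral) auto
      then show ?thesis using True by (simp add: small_form_event_def)
    qed
    then have "\<kappa> = 1"
      unfolding \<kappa>_def by (subst measure_pmf.prob_eq_1) (auto simp: AE_measure_pmf_iff)
    then show ?thesis using True by simp
  qed
  then have \<kappa>0: "\<kappa> > 0" using pos by simp
  define S where "S = (\<Sum>e\<in>pairs N. rel_entropy (q e) (case e of (i, j) \<Rightarrow> val i j))"
  have S0: "0 \<le> S"
    unfolding S_def using q01 val_pairs by (intro sum_nonneg rel_entropy_nonneg) auto
  \<comment> \<open>The diagonal terms are only added here and are nonnegative, so the lower bound
    has no diagonal correction.\<close>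
  have "2 * S \<le> (\<Sum>i<N. \<Sum>j<N. rel_entropy (a i j) (val i j))"
  proof -
    have "S = (\<Sum>(i, j)\<in>pairs N. rel_entropy (a i j) (val i j))"
      unfolding S_def q_def by (intro sum.cong) auto
    moreover have "0 \<le> (\<Sum>i<N. rel_entropy (a i i) (val i i))"
    proof (intro sum_nonneg)
      fix i assume "i \<in> {..<N}"
      then have i: "i < N" by simp
      show "0 \<le> rel_entropy (a i i) (val i i)"
        using a01[OF i i] val01[OF i i] \<delta> by (intro rel_entropy_nonneg) auto
    qed
    ultimately show ?thesis using sum_pairs_rel_entropy[of a, OF asym] by linarith
  qed
  also have "\<dots> \<le> (\<Sum>i<N. \<Sum>j<N. (real N)\<^sup>2 * (LINT p|square_leb. rel_entropy (h' p) (val i j) * cell (block N) i j p))"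
  proof (intro sum_mono)
    fix i j assume "i \<in> {..<N}" "j \<in> {..<N}"
    then have ij: "i < N" "j < N" by auto
    have "rel_entropy (block_avg N h' i j) (val i j) / (real N)\<^sup>2 \<le> (LINT p|square_leb. rel_entropy (h' p) (val i j) * cell (block N) i j p)"
      using val01[OF ij] a01[OF ij] \<delta> by (intro cell_jensen[OF h' N ij]) (auto simp: a_def)
    then show "rel_entropy (a i j) (val i j) \<le> (real N)\<^sup>2 * (LINT p|square_leb. rel_entropy (h' p) (val i j) * cell (block N) i j p)"
      using N by (simp add: a_def pos_divide_le_eq mult.commute)
  qed
  also have "\<dots> = (real N)\<^sup>2 * rate_I s h'"
    unfolding rate_cells[OF h'] by (simp only: sum_distrib_left)
  also have "\<dots> \<le> (real N)\<^sup>2 * (rate_I r h' + err r)"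
    using rate_I_reference_diff[OF r h'] by (intro mult_left_mono) auto
  finally have S: "S \<le> (real N)\<^sup>2 / 2 * (rate_I r h' + err r)" by simp
  have "ln (measure_pmf.prob law (small_form_event N \<beta>)) \<ge> - (S + 2) / \<kappa>"
    unfolding S_def \<kappa>_def by (rule ln_prob_ge_tilted[OF finite_pairs q01 val_pairs \<kappa>0[unfolded \<kappa>_def]])
  moreover have "(S + 2) / \<kappa> \<le> ((real N)\<^sup>2 / 2 * (rate_I r h' + err r) + 2) / (1 - 5 / ((\<delta> * \<beta> / 2) ^ 4 * N))"
    using S S0 \<kappa> pos by (intro frac_le) auto
  ultimately show ?thesis unfolding h'_def minus_divide_left[symmetric] by linarith
qed

end


section \<open>The limit\<close>

text \<open>The quotient is N/(N - 1) = 1 + 1/(N - 1). The shift of the index by two avoids the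
  vanishing binomials at 0 and 1.\<close>

lemma choose_two_ratio: "(\<lambda>N. (real N)\<^sup>2 / 2 / real (N choose 2)) \<longlonglongrightarrow> 1"
proof -
  have "(\<lambda>n. 1 + 1 / real (Suc n)) \<longlonglongrightarrow> 1 + 0"
    by (intro tendsto_add tendsto_const LIMSEQ_Suc[OF lim_1_over_n])
  moreover have "1 + 1 / real (Suc n) = (real (Suc (Suc n)))\<^sup>2 / 2 / real (Suc (Suc n) choose 2)" for n
  proof -
    have "real (Suc (Suc n) choose 2) = real (Suc (Suc n)) * real (Suc n) / 2"
      using binomial_gbinomial[of "Suc (Suc n)" 2, where ?'a = real]
      by (simp add: gbinomial_prod_rev numeral_2_eq_2 atLeast0LessThan lessThan_Suc mult.commute)
    moreover have "real (Suc (Suc n)) = real (Suc n) + 1" by simp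
    moreover have "1 + 1 / x = (x + 1)\<^sup>2 / 2 / ((x + 1) * x / 2)" if "x > 0" for x :: real
      using that by (simp add: divide_simps power2_eq_square)
    ultimately show ?thesis by (simp only: of_nat_0_less_iff zero_less_Suc)
  qed
  ultimately have "(\<lambda>n. (real (Suc (Suc n)))\<^sup>2 / 2 / real (Suc (Suc n) choose 2)) \<longlonglongrightarrow> 1" by simp
  then show ?thesis
    by (rule LIMSEQ_imp_Suc[OF LIMSEQ_imp_Suc])
qed

lemma choose_two_inverse: "(\<lambda>N. 1 / real (N choose 2)) \<longlonglongrightarrow> 0"
proof -
  have "(\<lambda>N. (real N)\<^sup>2 / 2 / real (N choose 2) * (2 * ((1 / real N) * (1 / real N)))) \<longlonglongrightarrow> 1 * (2 * (0 * 0))"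
    by (intro tendsto_mult choose_two_ratio tendsto_const lim_1_over_n)
  moreover have "eventually (\<lambda>N. (real N)\<^sup>2 / 2 / real (N choose 2) * (2 * ((1 / real N) * (1 / real N))) = 1 / real (N choose 2)) sequentially"
    by (intro eventually_sequentiallyI[of 1]) (simp add: power2_eq_square)
  ultimately show ?thesis by (simp add: tendsto_cong)
qed

theorem theorem2:
  fixes r :: "real \<times> real \<Rightarrow> real"
    and rN :: "nat \<Rightarrow> real \<times> real \<Rightarrow> real"
    and \<beta> :: real
  assumes "r \<in> graphons"
    and "log_integrable r"
    and "\<And>N. 1 \<le> N \<Longrightarrow> rN N \<in> graphons"
    and "\<And>N p. 1 \<le> N \<Longrightarrow> p \<in> unit_square \<Longrightarrow> 0 < rN N p \<and> rN N p < 1"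
    and "\<And>N. 1 \<le> N \<Longrightarrow> block_constant N (rN N)"
    and "AE p in square_leb. (\<lambda>N. rN N p) \<longlonglongrightarrow> r p"
    and "(\<lambda>N. LINT p|square_leb. \<bar>rN N p - r p\<bar>) \<longlonglongrightarrow> 0"
    and "(\<lambda>N. LINT p|square_leb. \<bar>ln (rN N p) - ln (r p)\<bar>) \<longlonglongrightarrow> 0"
    and "(\<lambda>N. LINT p|square_leb. \<bar>ln (1 - rN N p) - ln (1 - r p)\<bar>) \<longlonglongrightarrow> 0"
    and "\<beta> \<in> {0..laplacian_norm r}"
  shows "(\<lambda>N. ln (measure_pmf.prob (laplacian_law N (rN N)) {x. x / real N \<le> \<beta>})
              / real (N choose 2)) \<longlonglongrightarrow> - rate_psi r \<beta>
         \<and> rate_psi r \<beta> = (INF h \<in> {h \<in> graphons. laplacian_norm h \<le> \<beta>}. rate_I r h)"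
proof
  note r = assms(1,2)
  have \<beta>: "\<beta> \<ge> 0" using assms(10) by simp
  show psi: "rate_psi r \<beta> = (INF h \<in> {h \<in> graphons. laplacian_norm h \<le> \<beta>}. rate_I r h)"
    by (rule rate_psi_eq[OF r \<beta>])
  then have psi_min: "rate_psi r \<beta> = min_rate r \<beta>" by (simp only: min_rate_def)
  have B: "block_reference N (rN N)" if "N \<ge> 1" for N
    using assms(3-5) that by unfold_locales simp_all
  define e where "e N = (LINT p|square_leb. \<bar>ln (rN N p) - ln (r p)\<bar>) + (LINT p|square_leb. \<bar>ln (1 - rN N p) - ln (1 - r p)\<bar>)" for N
  have e: "e \<longlonglongrightarrow> 0 + 0" unfolding e_def[abs_def] by (intro tendsto_add assms(8,9))
  have err: "block_reference.err (rN N) r = e N" if "N \<ge> 1" for N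
    unfolding block_reference.err_def[OF B[OF that]] e_def ..
  define b where "b N = real (N choose 2)" for N
  define a where "a N = ln (measure_pmf.prob (laplacian_law N (rN N)) {x. x / real N \<le> \<beta>})" for N
  define \<rho> where "\<rho> N = (real N)\<^sup>2 / 2 / b N" for N
  have \<rho>: "\<rho> \<longlonglongrightarrow> 1" unfolding \<rho>_def[abs_def] b_def by (rule choose_two_ratio)
  have ib: "(\<lambda>N. 1 / b N) \<longlonglongrightarrow> 0" unfolding b_def by (rule choose_two_inverse)
  have b0: "b N \<ge> 0" for N by (simp add: b_def)
  have a_eq: "a N = ln (measure_pmf.prob (bernoulli_prod (pairs N) (\<lambda>(i, j). rN N (corner N i j))) (small_form_event N \<beta>))"
    if "N \<ge> 1" for N
    unfolding a_def prob_laplacian_law[OF that] small_form_event_def corner_def ..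
  have upper: "a N / b N \<le> - (\<rho> N * (min_rate r \<beta> - (2 * e N + diag_mass N r)))" if N: "N \<ge> 1" for N
  proof -
    have "a N \<le> - ((real N)\<^sup>2 / 2 * (min_rate r \<beta> - (2 * e N + diag_mass N r)))"
      using block_reference.ln_prob_upper[OF B[OF N] r \<beta>] unfolding a_eq[OF N] err[OF N] .
    then have "a N / b N \<le> - ((real N)\<^sup>2 / 2 * (min_rate r \<beta> - (2 * e N + diag_mass N r))) / b N"
      using b0 by (rule divide_right_mono)
    then show ?thesis by (simp add: \<rho>_def)
  qed
  \<comment> \<open>The prefactor N^2/2 matches the number of pairs in the limit, so the rate
    integral over the whole square appears without a factor.\<close>
  have "(\<lambda>N. - (\<rho> N * (min_rate r \<beta> - (2 * e N + diag_mass N r)))) \<longlonglongrightarrow> - (1 * (min_rate r \<beta> - (2 * (0 + 0) + 0)))"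
    by (intro tendsto_minus tendsto_mult tendsto_diff tendsto_add[OF tendsto_mult] tendsto_const \<rho> e diag_mass_tendsto[OF r])
  then have upper_lim: "(\<lambda>N. - (\<rho> N * (min_rate r \<beta> - (2 * e N + diag_mass N r)))) \<longlonglongrightarrow> - min_rate r \<beta>" by simp
  have "(\<lambda>N. a N / b N) \<longlonglongrightarrow> - min_rate r \<beta>"
  proof (rule order_tendstoI)
    fix c assume "- min_rate r \<beta> < c"
    with upper_lim have "eventually (\<lambda>N. - (\<rho> N * (min_rate r \<beta> - (2 * e N + diag_mass N r))) < c) sequentially"
      by (rule order_tendstoD(2))
    then show "eventually (\<lambda>N. a N / b N < c) sequentially"
      using eventually_ge_at_top[of 1]
    proof eventually_elim
      case (elim N)
      show ?case using upper[OF elim(2)] elim(1) by (rule le_less_trans)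
    qed
  next
    fix c assume c: "c < - min_rate r \<beta>"
    have "(INF h \<in> {h \<in> graphons. laplacian_norm h \<le> \<beta>}. rate_I r h) < - c"
      using c by (simp add: min_rate_def)
    moreover have "{h \<in> graphons. laplacian_norm h \<le> \<beta>} \<noteq> {}"
      using zero_graphon laplacian_norm_zero \<beta> by (auto intro!: exI[of _ "\<lambda>_. 0"])
    ultimately have "\<exists>y \<in> rate_I r ` {h \<in> graphons. laplacian_norm h \<le> \<beta>}. y < - c"
      by (intro cInf_lessD) auto
    \<comment> \<open>A nearly optimal graphon suffices, so no minimizer has to exist. It is fixed
      before \<delta>, and both before \<open>N\<close>.\<close>
    then obtain h where h: "h \<in> graphons" and norm: "laplacian_norm h \<le> \<beta>" and hc: "rate_I r h < - c" by blast
    \<comment> \<open>The values 1/(n + 2) run through admissible \<delta>, strictly between 0 and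
      1. The rate is continuous along the shrinking, so some \<delta> keeps it below
      \<open>- c\<close>.\<close>
    have "(\<lambda>n. (1 - 1 / real (Suc (Suc n))) * h p) \<longlonglongrightarrow> (1 - 0) * h p" for p
      by (intro tendsto_mult tendsto_diff tendsto_const LIMSEQ_Suc[OF LIMSEQ_Suc[OF lim_1_over_n]])
    then have ptw: "(\<lambda>n. (1 - 1 / real (Suc (Suc n))) * h p) \<longlonglongrightarrow> h p" for p by simp
    have hn: "(\<lambda>p. (1 - 1 / real (Suc (Suc n))) * h p) \<in> graphons" for n
      using h by (auto simp: graphons_def intro!: mult_le_one)
    have "(\<lambda>n. rate_I r (\<lambda>p. (1 - 1 / real (Suc (Suc n))) * h p)) \<longlonglongrightarrow> rate_I r h"
      by (rule rate_I_tendsto[OF graphon_measurable[OF r(1)] r(2) hn h]) (intro AE_I2 ptw)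
    then have "eventually (\<lambda>n. rate_I r (\<lambda>p. (1 - 1 / real (Suc (Suc n))) * h p) < - c) sequentially"
      using hc by (rule order_tendstoD(2))
    then obtain n where n: "rate_I r (\<lambda>p. (1 - 1 / real (Suc (Suc n))) * h p) < - c"
      by (auto simp: eventually_sequentially)
    define \<delta> where "\<delta> = 1 / real (Suc (Suc n))"
    have \<delta>: "0 < \<delta>" "\<delta> < 1" by (simp_all add: \<delta>_def)
    define I where "I = rate_I r (\<lambda>p. (1 - \<delta>) * h p)"
    have I: "I < - c" using n by (simp add: I_def \<delta>_def)
    \<comment> \<open>Lower bound for the probability that the tilted graph meets the constraint. If
      \<beta> = 0, division by 0 yields 0, so \<open>\<kappa> N\<close> is 1 and the limit below
      holds in that case as well.\<close>
    define \<kappa> where "\<kappa> N = 1 - 5 / ((\<delta> * \<beta> / 2) ^ 4 * real N)" for N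
    have \<kappa>: "\<kappa> \<longlonglongrightarrow> 1"
    proof -
      have "(\<lambda>N. 1 - 5 / (\<delta> * \<beta> / 2) ^ 4 * (1 / real N)) \<longlonglongrightarrow> 1 - 5 / (\<delta> * \<beta> / 2) ^ 4 * 0"
        by (intro tendsto_diff tendsto_mult tendsto_const lim_1_over_n)
      then show ?thesis by (simp add: \<kappa>_def[abs_def])
    qed
    have "(\<lambda>N. - ((\<rho> N * (I + e N) + 2 * (1 / b N)) / \<kappa> N)) \<longlonglongrightarrow> - ((1 * (I + (0 + 0)) + 2 * 0) / 1)"
      by (intro tendsto_minus tendsto_divide tendsto_add[OF tendsto_mult] tendsto_add[OF tendsto_const] tendsto_mult tendsto_const \<rho> e ib \<kappa>) simp
    then have "(\<lambda>N. - ((\<rho> N * (I + e N) + 2 * (1 / b N)) / \<kappa> N)) \<longlonglongrightarrow> - I" by simp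
    moreover have "c < - I" using I by simp
    ultimately have "eventually (\<lambda>N. c < - ((\<rho> N * (I + e N) + 2 * (1 / b N)) / \<kappa> N)) sequentially"
      by (rule order_tendstoD(1))
    moreover have "eventually (\<lambda>N. 0 < \<kappa> N) sequentially"
      using \<kappa> by (rule order_tendstoD(1)) simp
    ultimately show "eventually (\<lambda>N. c < a N / b N) sequentially"
      using eventually_ge_at_top[of 1]
    proof eventually_elim
      case (elim N)
      note N = elim(3)
      have "- ((real N)\<^sup>2 / 2 * (I + e N) + 2) / \<kappa> N \<le> a N"
        using block_reference.ln_prob_lower[OF B[OF N] r h norm \<delta>] elim(2)
        unfolding a_eq[OF N] err[OF N] I_def \<kappa>_def by blast
      then have "- ((real N)\<^sup>2 / 2 * (I + e N) + 2) / \<kappa> N / b N \<le> a N / b N"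
        using b0 by (rule divide_right_mono)
      moreover have "- ((real N)\<^sup>2 / 2 * (I + e N) + 2) / \<kappa> N / b N = - ((\<rho> N * (I + e N) + 2 * (1 / b N)) / \<kappa> N)"
        by (simp add: \<rho>_def add_divide_distrib diff_divide_distrib mult.commute)
      ultimately show ?case using elim(1) by linarith
    qed
  qed
  then show "(\<lambda>N. ln (measure_pmf.prob (laplacian_law N (rN N)) {x. x / real N \<le> \<beta>})
              / real (N choose 2)) \<longlonglongrightarrow> - rate_psi r \<beta>"
    unfolding a_def b_def psi_min .
qed

end
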